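(* Let $n$ be a natural number and $p$ a prime dividing $n$. Let $\Bbbk=\mathbb F_p[t_1,\dots,t_{n+1}]/(t_1^2,\dots,t_{n+1}^2)$ and let $$M=\Bbbk^{n+1}/\langle t_1e_1+\dots+t_{n+1}e_{n+1}\rangle$$ be the $\Bbbk$-module generated by $e_1,\dots,e_{n+1}$ modulo the relation $t_1e_1+\dots+t_{n+1}e_{n+1}=0$. Then the map $$\partial:\Lambda^nM\to M\otimes\Lambda^{n-1}M,\qquad \partial(a_1\wedge\dots\wedge a_n)=\sum_{i=1}^n(-1)^{i+1}a_i\otimes a_1\wedge\dots\wedge\hat a_i\wedge\dots\wedge a_n,$$ is not injective, and hence the complex $\mathrm{Kos}_\bullet(M,n)$ is not acyclic. More precisely, $t_1e_1\wedge t_2e_2\wedge\dots\wedge t_ne_n\in\Lambda^nM$ is a non-trivial element of $\mathrm{Ker}(\partial:\Lambda^nM\to M\otimes\Lambda^{n-1}M)$.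
   Context: Tensor, exterior ($\Lambda^i$) and symmetric ($S^i$) powers are over $\Bbbk$. $\mathrm{Kos}_\bullet(M,n)$ is the complex $0\to\Lambda^nM\to M\otimes\Lambda^{n-1}M\to\dots\to S^{n-1}M\otimes M\to S^nM\to0$ with components $\mathrm{Kos}_i(M,n)=S^{n-i}M\otimes\Lambda^iM$ and differential $\partial(\alpha\otimes a_1\wedge\dots\wedge a_i)=\sum_{j=1}^i(-1)^{j+1}\alpha a_j\otimes a_1\wedge\dots\wedge\hat a_j\wedge\dots\wedge a_i$. *)

theory Defs
  imports
    "HOL-Algebra.Module"
    "HOL-Algebra.QuotRing"
    "HOL-Algebra.Indexed_Polynomials"
    "HOL-Number_Theory.Residues"
begin

section \<open>Multivariate polynomial rings\<close>

text \<open>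
  A polynomial is its coefficient function on monomials, a monomial being a multiset of
  variables. The library provides the set of polynomials but not the ring structure.
\<close>

definition mpoly_ring :: "('a, 'm) ring_scheme \<Rightarrow> 'c set \<Rightarrow> ('c multiset \<Rightarrow> 'a) ring" where
  "mpoly_ring R I =
    \<lparr>carrier = ring.indexed_pset R I (carrier R),
     monoid.mult = (\<lambda>P Q m. \<Oplus>\<^bsub>R\<^esub>a\<in>{a. a \<subseteq># m}. P a \<otimes>\<^bsub>R\<^esub> Q (m - a)),
     one = ring.indexed_const R \<one>\<^bsub>R\<^esub>,
     zero = ring.indexed_const R \<zero>\<^bsub>R\<^esub>,
     add = ring.indexed_padd R\<rparr>"

lemma finite_submultisets: "finite {a. a \<subseteq># m}"
proof (rule finite_subset)
  show "{a. a \<subseteq># m} \<subseteq> {a. set_mset a \<subseteq> set_mset m \<and> size a \<le> size m}"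
    by (auto dest: set_mset_mono size_mset_mono)
  show "finite {a. set_mset a \<subseteq> set_mset m \<and> size a \<le> size m}"
  proof (rule finite_subset)
    show "{a. set_mset a \<subseteq> set_mset m \<and> size a \<le> size m} \<subseteq>
        mset ` {as. set as \<subseteq> set_mset m \<and> length as \<le> size m}"
    proof
      fix a assume a: "a \<in> {a. set_mset a \<subseteq> set_mset m \<and> size a \<le> size m}"
      obtain as where "mset as = a" using ex_mset by blast
      with a show "a \<in> mset ` {as. set as \<subseteq> set_mset m \<and> length as \<le> size m}"
        by auto
    qed
    show "finite (mset ` {as. set as \<subseteq> set_mset m \<and> length as \<le> size m})"
      by (intro finite_imageI finite_lists_length_le) simp
  qed
qed

context cring
begin

lemma mpoly_mult_const:
  assumes "c \<in> carrier R" "carrier_coeff Q"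
  shows "indexed_const c \<otimes>\<^bsub>mpoly_ring R I\<^esub> Q = (\<lambda>m. c \<otimes> Q m)"
proof
  fix m
  have Q: "\<And>m. Q m \<in> carrier R" using assms(2) by (rule carrier_coeffE)
  have "(\<Oplus>a\<in>{a. a \<subseteq># m}. indexed_const c a \<otimes> Q (m - a)) =
      (\<Oplus>a\<in>{a. a \<subseteq># m}. if {#} = a then c \<otimes> Q (m - a) else \<zero>)"
    using assms(1) Q by (intro finsum_cong') (auto simp: indexed_const_def)
  also have "\<dots> = c \<otimes> Q m"
    using assms(1) Q finsum_singleton[of "{#}" "{a. a \<subseteq># m}" "\<lambda>a. c \<otimes> Q (m - a)"]
    by (simp add: finite_submultisets)
  finally show "(indexed_const c \<otimes>\<^bsub>mpoly_ring R I\<^esub> Q) m = c \<otimes> Q m"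
    by (simp add: mpoly_ring_def)
qed

lemma mpoly_mult_coeff:
  assumes "carrier_coeff P" "carrier_coeff Q"
  shows "carrier_coeff (P \<otimes>\<^bsub>mpoly_ring R I\<^esub> Q)"
  using assms unfolding carrier_coeff_def mpoly_ring_def by (auto intro!: finsum_closed)

lemma mpoly_mult_padd:
  assumes "carrier_coeff P" "carrier_coeff P'" "carrier_coeff Q"
  shows "indexed_padd P P' \<otimes>\<^bsub>mpoly_ring R I\<^esub> Q =
    indexed_padd (P \<otimes>\<^bsub>mpoly_ring R I\<^esub> Q) (P' \<otimes>\<^bsub>mpoly_ring R I\<^esub> Q)"
proof
  fix m
  show "(indexed_padd P P' \<otimes>\<^bsub>mpoly_ring R I\<^esub> Q) m =
    indexed_padd (P \<otimes>\<^bsub>mpoly_ring R I\<^esub> Q) (P' \<otimes>\<^bsub>mpoly_ring R I\<^esub> Q) m"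
    using assms unfolding mpoly_ring_def carrier_coeff_def indexed_padd_def
    by (simp add: l_distr finsum_addf Pi_def)
qed

lemma mpoly_mult_pmult:
  assumes "carrier_coeff P" "carrier_coeff Q"
  shows "indexed_pmult P i \<otimes>\<^bsub>mpoly_ring R I\<^esub> Q = indexed_pmult (P \<otimes>\<^bsub>mpoly_ring R I\<^esub> Q) i"
proof
  fix m
  have P: "\<And>m. P m \<in> carrier R" and Q: "\<And>m. Q m \<in> carrier R"
    using assms by (simp_all add: carrier_coeff_def)
  have "(\<Oplus>a\<in>{a. a \<subseteq># m}. indexed_pmult P i a \<otimes> Q (m - a)) =
      (\<Oplus>a\<in>{a. a \<subseteq># m \<and> i \<in># a}. P (a - {#i#}) \<otimes> Q (m - a))"
    by (rule add.finprod_mono_neutral_cong_right)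
      (auto simp: finite_submultisets indexed_pmult_def P Q)
  also have "\<dots> = (if i \<in># m then \<Oplus>a\<in>{a. a \<subseteq># m - {#i#}}. P a \<otimes> Q (m - {#i#} - a) else \<zero>)"
  proof (cases "i \<in># m")
    case True
    have im: "{a. a \<subseteq># m \<and> i \<in># a} = (\<lambda>a. add_mset i a) ` {a. a \<subseteq># m - {#i#}}"
    proof (intro equalityI subsetI)
      fix a assume "a \<in> {a. a \<subseteq># m \<and> i \<in># a}"
      then have "a = add_mset i (a - {#i#})" "a - {#i#} \<subseteq># m - {#i#}"
        by (auto simp: insert_subset_eq_iff dest: mset_subset_eqD)
          (metis insert_DiffM insert_subset_eq_iff)
      then show "a \<in> (\<lambda>a. add_mset i a) ` {a. a \<subseteq># m - {#i#}}" by blast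
    qed (use True in \<open>auto simp: insert_subset_eq_iff\<close>)
    have "(\<Oplus>a\<in>{a. a \<subseteq># m \<and> i \<in># a}. P (a - {#i#}) \<otimes> Q (m - a)) =
        (\<Oplus>a\<in>{a. a \<subseteq># m - {#i#}}. P (add_mset i a - {#i#}) \<otimes> Q (m - add_mset i a))"
      unfolding im by (rule finsum_reindex) (auto simp: P Q inj_on_def)
    then show ?thesis using True by (simp)
  next
    case False
    then have "{a. a \<subseteq># m \<and> i \<in># a} = {}" by (auto dest: mset_subset_eqD)
    then show ?thesis using False by (simp only: finsum_empty if_False)
  qed
  finally show "(indexed_pmult P i \<otimes>\<^bsub>mpoly_ring R I\<^esub> Q) m =
      indexed_pmult (P \<otimes>\<^bsub>mpoly_ring R I\<^esub> Q) i m"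
    by (simp add: mpoly_ring_def indexed_pmult_def)
qed

lemma mpoly_mult_comm:
  fixes P Q :: "'c multiset \<Rightarrow> 'a"
  assumes "carrier_coeff P" "carrier_coeff Q"
  shows "P \<otimes>\<^bsub>mpoly_ring R I\<^esub> Q = Q \<otimes>\<^bsub>mpoly_ring R I\<^esub> P"
proof
  fix m :: "'c multiset"
  have P: "\<And>m. P m \<in> carrier R" and Q: "\<And>m. Q m \<in> carrier R"
    using assms by (simp_all add: carrier_coeff_def)
  have mm: "m - (m - a) = a" if "a \<subseteq># m" for a :: "'c multiset"
    using that by (simp add: multiset_eq_iff subseteq_mset_def)
  have im: "{a. a \<subseteq># m} = (\<lambda>a. m - a) ` {a. a \<subseteq># m}"
  proof (intro equalityI subsetI)
    fix a assume "a \<in> {a. a \<subseteq># m}"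
    then show "a \<in> (\<lambda>a. m - a) ` {a. a \<subseteq># m}"
      using mm by (intro image_eqI[of _ _ "m - a"]) auto
  qed auto
  have "(\<Oplus>a\<in>{a. a \<subseteq># m}. P a \<otimes> Q (m - a)) = (\<Oplus>a\<in>(\<lambda>a. m - a) ` {a. a \<subseteq># m}. P a \<otimes> Q (m - a))"
    by (simp flip: im)
  also have "\<dots> = (\<Oplus>a\<in>{a. a \<subseteq># m}. P (m - a) \<otimes> Q (m - (m - a)))"
    by (rule finsum_reindex) (auto simp: P Q intro!: inj_onI, metis mm)
  also have "\<dots> = (\<Oplus>a\<in>{a. a \<subseteq># m}. Q a \<otimes> P (m - a))"
    by (rule finsum_cong') (auto simp: P Q mm m_comm)
  finally show "(P \<otimes>\<^bsub>mpoly_ring R I\<^esub> Q) m = (Q \<otimes>\<^bsub>mpoly_ring R I\<^esub> P) m"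
    by (simp add: mpoly_ring_def)
qed

lemma mpoly_coeff: "P \<in> carrier (mpoly_ring R I) \<Longrightarrow> carrier_coeff P"
  by (simp add: mpoly_ring_def indexed_pset_in_carrier[OF subset_refl])

lemma mpoly_scale_closed:
  assumes "c \<in> carrier R" "P \<in> indexed_pset I (carrier R)"
  shows "(\<lambda>m. c \<otimes> P m) \<in> indexed_pset I (carrier R)"
  using assms(2)
proof (induction rule: indexed_pset.induct)
  case (indexed_const k)
  have "(\<lambda>m. c \<otimes> indexed_const k m) = indexed_const (c \<otimes> k)"
    using assms(1) by (auto simp: indexed_const_def)
  also have "\<dots> \<in> indexed_pset I (carrier R)"
    using assms(1) indexed_const by (intro indexed_pset.indexed_const) simp
  finally show ?case .
next
  case (indexed_padd P Q)
  have "(\<lambda>m. c \<otimes> indexed_padd P Q m) = indexed_padd (\<lambda>m. c \<otimes> P m) (\<lambda>m. c \<otimes> Q m)"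
    using indexed_padd(1,2)[THEN indexed_pset_in_carrier[OF subset_refl]] assms(1)
    by (simp add: indexed_padd_def carrier_coeff_def r_distr)
  also have "\<dots> \<in> indexed_pset I (carrier R)"
    using indexed_padd(3,4) by (rule indexed_pset.indexed_padd)
  finally show ?case .
next
  case (indexed_pmult P i)
  have "(\<lambda>m. c \<otimes> indexed_pmult P i m) = indexed_pmult (\<lambda>m. c \<otimes> P m) i"
    using assms(1) by (auto simp: indexed_pmult_def)
  also have "\<dots> \<in> indexed_pset I (carrier R)"
    using indexed_pmult(3,2) by (rule indexed_pset.indexed_pmult)
  finally show ?case .
qed

lemma mpoly_mult_closed:
  assumes "P \<in> indexed_pset I (carrier R)" "Q \<in> indexed_pset I (carrier R)"
  shows "P \<otimes>\<^bsub>mpoly_ring R I\<^esub> Q \<in> indexed_pset I (carrier R)"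
proof -
  have Q: "carrier_coeff Q" by (rule indexed_pset_in_carrier[OF subset_refl assms(2)])
  show ?thesis
    using assms(1)
  proof (induction rule: indexed_pset.induct)
    case (indexed_const k)
    then show ?case using Q by (simp add: mpoly_mult_const mpoly_scale_closed assms(2))
  next
    case (indexed_padd P P')
    then show ?case
      by (simp add: mpoly_mult_padd indexed_pset_in_carrier[OF subset_refl] Q indexed_pset.indexed_padd)
  next
    case (indexed_pmult P i)
    then show ?case
      by (simp add: mpoly_mult_pmult indexed_pset_in_carrier[OF subset_refl] Q indexed_pset.indexed_pmult)
  qed
qed

lemma mpoly_mult_assoc:
  assumes "P \<in> indexed_pset I (carrier R)" "carrier_coeff Q" "carrier_coeff S"
  shows "P \<otimes>\<^bsub>mpoly_ring R I\<^esub> Q \<otimes>\<^bsub>mpoly_ring R I\<^esub> S = P \<otimes>\<^bsub>mpoly_ring R I\<^esub> (Q \<otimes>\<^bsub>mpoly_ring R I\<^esub> S)"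
  using assms(1)
proof (induction rule: indexed_pset.induct)
  case (indexed_const k)
  have Q: "\<And>m. Q m \<in> carrier R" and S: "\<And>m. S m \<in> carrier R"
    using assms by (simp_all add: carrier_coeff_def)
  have "(\<lambda>m. k \<otimes> Q m) \<otimes>\<^bsub>mpoly_ring R I\<^esub> S = (\<lambda>m. k \<otimes> (Q \<otimes>\<^bsub>mpoly_ring R I\<^esub> S) m)"
    using indexed_const Q S by (simp add: mpoly_ring_def m_assoc finsum_rdistr finite_submultisets Pi_def)
  then show ?case using indexed_const assms(2,3) by (simp add: mpoly_mult_const mpoly_mult_coeff)
next
  case (indexed_padd P P')
  then show ?case
    by (simp add: mpoly_mult_padd indexed_pset_in_carrier[OF subset_refl] assms(2,3) mpoly_mult_coeff)
next
  case (indexed_pmult P i)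
  then show ?case
    by (simp add: mpoly_mult_pmult indexed_pset_in_carrier[OF subset_refl] assms(2,3) mpoly_mult_coeff)
qed

end

lemma cring_mpoly_ring:
  fixes R (structure)
  assumes "cring R"
  shows "cring (mpoly_ring R I)"
proof -
  interpret cring R by fact
  let ?S = "mpoly_ring R I"
  note co = indexed_pset_in_carrier[OF subset_refl, of _ I]
  have carr [simp]: "carrier ?S = indexed_pset I (carrier R)"
    and add [simp]: "P \<oplus>\<^bsub>?S\<^esub> Q = indexed_padd P Q"
    and zero [simp]: "\<zero>\<^bsub>?S\<^esub> = indexed_const \<zero>"
    and one [simp]: "\<one>\<^bsub>?S\<^esub> = indexed_const \<one>" for P Q
    by (simp_all add: mpoly_ring_def)
  show ?thesis
  proof (rule cringI)
    show "abelian_group ?S"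
    proof (rule abelian_groupI)
      fix P assume P: "P \<in> carrier ?S"
      then have "(\<lambda>m. (\<ominus> \<one>) \<otimes> P m) \<in> carrier ?S" by (simp add: mpoly_scale_closed)
      moreover have "(\<lambda>m. (\<ominus> \<one>) \<otimes> P m) \<oplus>\<^bsub>?S\<^esub> P = \<zero>\<^bsub>?S\<^esub>"
        using co P by (auto simp: indexed_padd_def indexed_zero_def carrier_coeff_def l_minus l_neg)
      ultimately show "\<exists>Q\<in>carrier ?S. Q \<oplus>\<^bsub>?S\<^esub> P = \<zero>\<^bsub>?S\<^esub>" by blast
    next
      fix P Q assume "P \<in> carrier ?S" "Q \<in> carrier ?S"
      then show "P \<oplus>\<^bsub>?S\<^esub> Q = Q \<oplus>\<^bsub>?S\<^esub> P"
        using co by (simp add: indexed_padd_def carrier_coeff_def a_comm)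
    next
      fix P Q S assume "P \<in> carrier ?S" "Q \<in> carrier ?S" "S \<in> carrier ?S"
      then show "P \<oplus>\<^bsub>?S\<^esub> Q \<oplus>\<^bsub>?S\<^esub> S = P \<oplus>\<^bsub>?S\<^esub> (Q \<oplus>\<^bsub>?S\<^esub> S)"
        using co by (simp add: indexed_padd_def carrier_coeff_def a_assoc)
    next
      fix P assume "P \<in> carrier ?S"
      then show "\<zero>\<^bsub>?S\<^esub> \<oplus>\<^bsub>?S\<^esub> P = P" using co by (simp add: indexed_padd_zero)
    qed (simp_all add: indexed_pset.indexed_const indexed_pset.indexed_padd)
    show "comm_monoid ?S"
    proof (rule comm_monoidI)
      fix P assume "P \<in> carrier ?S"
      then show "\<one>\<^bsub>?S\<^esub> \<otimes>\<^bsub>?S\<^esub> P = P"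
        using co by (simp add: mpoly_mult_const carrier_coeff_def)
    next
      fix P Q assume "P \<in> carrier ?S" "Q \<in> carrier ?S"
      then show "P \<otimes>\<^bsub>?S\<^esub> Q = Q \<otimes>\<^bsub>?S\<^esub> P" using co by (intro mpoly_mult_comm) simp_all
    qed (simp_all add: mpoly_mult_closed indexed_pset.indexed_const mpoly_mult_assoc co)
  qed (simp add: mpoly_mult_padd co)
qed

section \<open>Modules given by generators and relations\<close>

definition free_module :: "('a, 'm) ring_scheme \<Rightarrow> 'b set \<Rightarrow> ('a, 'b \<Rightarrow> 'a) module" where
  "free_module R B =
    \<lparr>carrier = {f. (\<forall>x\<in>B. f x \<in> carrier R) \<and> (\<forall>x. x \<notin> B \<longrightarrow> f x = \<zero>\<^bsub>R\<^esub>) \<and>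
                   finite {x. f x \<noteq> \<zero>\<^bsub>R\<^esub>}},
     monoid.mult = undefined,
     one = undefined,
     zero = (\<lambda>_. \<zero>\<^bsub>R\<^esub>),
     add = (\<lambda>f g x. f x \<oplus>\<^bsub>R\<^esub> g x),
     module.smult = (\<lambda>c f x. c \<otimes>\<^bsub>R\<^esub> f x)\<rparr>"

lemma module_free_module:
  fixes R :: "('a, 'm) ring_scheme" (structure) and B :: "'b set"
  assumes "cring R"
  shows "module R (free_module R B)"
proof -
  interpret cring R by fact
  have sub: "finite {x. f x \<oplus> g x \<noteq> \<zero>}"
    if "finite {x. f x \<noteq> \<zero>}" "finite {x. g x \<noteq> \<zero>}" for f g :: "'b \<Rightarrow> 'a"
    by (rule finite_subset[OF _ finite_UnI[OF that]]) auto
  have sub2: "finite {x. c \<otimes> f x \<noteq> \<zero>}"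
    if "finite {x. f x \<noteq> \<zero>}" "c \<in> carrier R" for f :: "'b \<Rightarrow> 'a" and c
    by (rule finite_subset[OF _ that(1)]) (use that in auto)
  have in_car: "f x \<in> carrier R" if "f \<in> carrier (free_module R B)" for f x
    using that by (cases "x \<in> B") (auto simp: free_module_def)
  show ?thesis
  proof (rule moduleI)
    show "abelian_group (free_module R B)"
    proof (rule abelian_groupI)
      fix f assume f: "f \<in> carrier (free_module R B)"
      have "(\<lambda>x. \<ominus> f x) \<in> carrier (free_module R B)"
        using f in_car[OF f] finite_subset[of "{x. \<ominus> f x \<noteq> \<zero>}" "{x. f x \<noteq> \<zero>}"]
        by (fastforce simp: free_module_def)
      moreover have "(\<lambda>x. \<ominus> f x) \<oplus>\<^bsub>free_module R B\<^esub> f = \<zero>\<^bsub>free_module R B\<^esub>"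
        using in_car[OF f] by (simp add: free_module_def l_neg)
      ultimately show "\<exists>g\<in>carrier (free_module R B). g \<oplus>\<^bsub>free_module R B\<^esub> f = \<zero>\<^bsub>free_module R B\<^esub>"
        by blast
    next
      fix f g h
      assume "f \<in> carrier (free_module R B)" "g \<in> carrier (free_module R B)"
        "h \<in> carrier (free_module R B)"
      from this[THEN in_car]
      show "f \<oplus>\<^bsub>free_module R B\<^esub> g \<oplus>\<^bsub>free_module R B\<^esub> h =
            f \<oplus>\<^bsub>free_module R B\<^esub> (g \<oplus>\<^bsub>free_module R B\<^esub> h)"
        by (simp add: free_module_def a_assoc)
    next
      fix f g
      assume "f \<in> carrier (free_module R B)" "g \<in> carrier (free_module R B)"
      from this[THEN in_car]
      show "f \<oplus>\<^bsub>free_module R B\<^esub> g = g \<oplus>\<^bsub>free_module R B\<^esub> f"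
        by (simp add: free_module_def a_comm)
    next
      fix f assume "f \<in> carrier (free_module R B)"
      from this[THEN in_car]
      show "\<zero>\<^bsub>free_module R B\<^esub> \<oplus>\<^bsub>free_module R B\<^esub> f = f"
        by (simp add: free_module_def)
    qed (auto simp: free_module_def intro: sub)
  next
    fix c f
    assume c: "c \<in> carrier R" and f: "f \<in> carrier (free_module R B)"
    note cf = c in_car[OF f]
    show "c \<odot>\<^bsub>free_module R B\<^esub> f \<in> carrier (free_module R B)"
      using f cf by (auto simp: free_module_def sub2)
    show "(c \<oplus> d) \<odot>\<^bsub>free_module R B\<^esub> f =
        c \<odot>\<^bsub>free_module R B\<^esub> f \<oplus>\<^bsub>free_module R B\<^esub> d \<odot>\<^bsub>free_module R B\<^esub> f"
      if "d \<in> carrier R" for d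
      using cf that by (simp add: free_module_def l_distr)
    show "c \<otimes> d \<odot>\<^bsub>free_module R B\<^esub> f = c \<odot>\<^bsub>free_module R B\<^esub> (d \<odot>\<^bsub>free_module R B\<^esub> f)"
      if "d \<in> carrier R" for d
      using cf that by (simp add: free_module_def m_assoc)
    show "c \<odot>\<^bsub>free_module R B\<^esub> (f \<oplus>\<^bsub>free_module R B\<^esub> g) =
        c \<odot>\<^bsub>free_module R B\<^esub> f \<oplus>\<^bsub>free_module R B\<^esub> c \<odot>\<^bsub>free_module R B\<^esub> g"
      if "g \<in> carrier (free_module R B)" for g
      using cf in_car[OF that] by (simp add: free_module_def r_distr)
  next
    fix f assume "f \<in> carrier (free_module R B)"
    from this[THEN in_car]
    show "\<one> \<odot>\<^bsub>free_module R B\<^esub> f = f"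
      by (simp add: free_module_def)
  qed (fact assms)
qed

definition free_gen :: "('a, 'm) ring_scheme \<Rightarrow> 'b \<Rightarrow> 'b \<Rightarrow> 'a" where
  "free_gen R x = (\<lambda>y. if y = x then \<one>\<^bsub>R\<^esub> else \<zero>\<^bsub>R\<^esub>)"

lemma free_gen_carrier: "cring R \<Longrightarrow> x \<in> B \<Longrightarrow> free_gen R x \<in> carrier (free_module R B)"
  by (auto simp: free_module_def free_gen_def cring.cring_simprules)

definition generated_submodule ::
    "('a, 'm) ring_scheme \<Rightarrow> ('a, 'b, 'k) module_scheme \<Rightarrow> 'b set \<Rightarrow> 'b set" where
  "generated_submodule R M G = \<Inter>{N. submodule N R M \<and> G \<subseteq> N}"

lemma submodule_generated:
  assumes "module R M" "G \<subseteq> carrier M"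
  shows "submodule (generated_submodule R M G) R M" "G \<subseteq> generated_submodule R M G"
proof -
  interpret module R M by fact
  have car: "submodule (carrier M) R M" by (rule carrier_is_submodule)
  show "submodule (generated_submodule R M G) R M"
  proof (rule submoduleI)
    show "generated_submodule R M G \<subseteq> carrier M"
      using car assms(2) by (auto simp: generated_submodule_def)
    show "\<zero>\<^bsub>M\<^esub> \<in> generated_submodule R M G"
      unfolding generated_submodule_def
      using subgroup.one_closed[OF submodule.axioms(1)] by fastforce
  qed (auto simp: generated_submodule_def dest: submoduleE)
  show "G \<subseteq> generated_submodule R M G"
    by (auto simp: generated_submodule_def)
qed

definition quotient_module ::
    "('a, 'b, 'k) module_scheme \<Rightarrow> 'b set \<Rightarrow> ('a, 'b set) module" where
  "quotient_module M N =
    \<lparr>carrier = a_rcosets\<^bsub>M\<^esub> N,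
     monoid.mult = undefined,
     one = undefined,
     zero = N,
     add = set_add M,
     module.smult = (\<lambda>c Y. \<Union>x\<in>Y. N +>\<^bsub>M\<^esub> (c \<odot>\<^bsub>M\<^esub> x))\<rparr>"

lemma module_quotient_module:
  assumes "module R M" "submodule N R M"
  shows "module R (quotient_module M N)"
    and "\<And>x y. \<lbrakk>x \<in> carrier M; y \<in> carrier M\<rbrakk> \<Longrightarrow>
      (N +>\<^bsub>M\<^esub> x) \<oplus>\<^bsub>quotient_module M N\<^esub> (N +>\<^bsub>M\<^esub> y) = N +>\<^bsub>M\<^esub> (x \<oplus>\<^bsub>M\<^esub> y)"
    and "\<And>c x. \<lbrakk>c \<in> carrier R; x \<in> carrier M\<rbrakk> \<Longrightarrow>
      c \<odot>\<^bsub>quotient_module M N\<^esub> (N +>\<^bsub>M\<^esub> x) = N +>\<^bsub>M\<^esub> (c \<odot>\<^bsub>M\<^esub> x)"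
proof -
  interpret module R M by fact
  let ?Q = "quotient_module M N"
  interpret N: submodule N R M by fact
  interpret N: abelian_subgroup N M
    by (intro abelian_subgroupI3 additive_subgroup.intro) (unfold_locales)
  have car: "carrier ?Q = (\<lambda>x. N +>\<^bsub>M\<^esub> x) ` carrier M"
    by (auto simp: quotient_module_def A_RCOSETS_def')
  show add: "(N +>\<^bsub>M\<^esub> x) \<oplus>\<^bsub>?Q\<^esub> (N +>\<^bsub>M\<^esub> y) = N +>\<^bsub>M\<^esub> (x \<oplus>\<^bsub>M\<^esub> y)"
    if "x \<in> carrier M" "y \<in> carrier M" for x y
    using that by (simp add: quotient_module_def N.a_rcos_sum)
  show smult: "c \<odot>\<^bsub>?Q\<^esub> (N +>\<^bsub>M\<^esub> x) = N +>\<^bsub>M\<^esub> (c \<odot>\<^bsub>M\<^esub> x)"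
    if c: "c \<in> carrier R" and x: "x \<in> carrier M" for c x
  proof -
    have *: "N +>\<^bsub>M\<^esub> (c \<odot>\<^bsub>M\<^esub> y) = N +>\<^bsub>M\<^esub> (c \<odot>\<^bsub>M\<^esub> x)" if "y \<in> N +>\<^bsub>M\<^esub> x" for y
    proof -
      from that obtain h where h: "h \<in> N" "y = h \<oplus>\<^bsub>M\<^esub> x"
        by (auto simp: a_r_coset_def')
      then have "c \<odot>\<^bsub>M\<^esub> y = c \<odot>\<^bsub>M\<^esub> h \<oplus>\<^bsub>M\<^esub> c \<odot>\<^bsub>M\<^esub> x"
        using c x N.a_Hcarr by (simp add: smult_r_distr)
      then have "c \<odot>\<^bsub>M\<^esub> y \<in> N +>\<^bsub>M\<^esub> (c \<odot>\<^bsub>M\<^esub> x)"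
        using c h N.smult_closed by (auto simp: a_r_coset_def')
      then show ?thesis
        using c x by (metis N.a_repr_independence' smult_closed)
    qed
    have "x \<in> N +>\<^bsub>M\<^esub> x" using x N.a_rcos_self by blast
    then have "(\<Union>y\<in>N +>\<^bsub>M\<^esub> x. N +>\<^bsub>M\<^esub> (c \<odot>\<^bsub>M\<^esub> y)) = N +>\<^bsub>M\<^esub> (c \<odot>\<^bsub>M\<^esub> x)"
      by (intro SUP_eq_const) (auto dest: *)
    then show ?thesis
      by (simp only: quotient_module_def module.simps)
  qed
  have zero: "\<zero>\<^bsub>?Q\<^esub> = N +>\<^bsub>M\<^esub> \<zero>\<^bsub>M\<^esub>"
    using N.a_subset by (simp add: quotient_module_def M.a_coset_add_zero)
  show "module R ?Q"
  proof (rule moduleI)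
    show "abelian_group ?Q"
    proof (rule abelian_groupI)
      fix A assume "A \<in> carrier ?Q"
      then obtain x where "x \<in> carrier M" "A = N +>\<^bsub>M\<^esub> x" by (auto simp: car)
      then have "(N +>\<^bsub>M\<^esub> (\<ominus>\<^bsub>M\<^esub> x)) \<oplus>\<^bsub>?Q\<^esub> A = \<zero>\<^bsub>?Q\<^esub>"
        by (simp add: add zero M.l_neg)
      then show "\<exists>B\<in>carrier ?Q. B \<oplus>\<^bsub>?Q\<^esub> A = \<zero>\<^bsub>?Q\<^esub>"
        using \<open>x \<in> carrier M\<close> by (auto simp: car)
    qed (auto simp: car add zero M.a_ac)
  qed (auto simp: car add smult smult_l_distr smult_r_distr smult_assoc1 is_cring)
qed

definition presented_module ::
    "('a, 'm) ring_scheme \<Rightarrow> 'b set \<Rightarrow> ('b \<Rightarrow> 'a) set \<Rightarrow> ('a, ('b \<Rightarrow> 'a) set) module" where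
  "presented_module R B G =
     quotient_module (free_module R B) (generated_submodule R (free_module R B) G)"

definition presented_gen ::
    "('a, 'm) ring_scheme \<Rightarrow> 'b set \<Rightarrow> ('b \<Rightarrow> 'a) set \<Rightarrow> 'b \<Rightarrow> ('b \<Rightarrow> 'a) set" where
  "presented_gen R B G x =
     generated_submodule R (free_module R B) G +>\<^bsub>free_module R B\<^esub> free_gen R x"

text \<open>
  The linear map into \<open>N\<close> from a module presented by generators and relations which sends
  the generator \<open>x\<close> to \<open>g x\<close>. An element \<open>A\<close> of the presented module is a coset of formal linear
  combinations of generators. If \<open>g\<close> respects the relations, all members of \<open>A\<close> have the same
  value, which is the one selected (see \<open>linear_extension_gen\<close> and
  \<open>linear_extension_linear\<close> below).
\<close>

definition linear_extension ::
    "('a, 'm) ring_scheme \<Rightarrow> ('a, 'c, 'k) module_scheme \<Rightarrow> ('b \<Rightarrow> 'c) \<Rightarrow> ('b \<Rightarrow> 'a) set \<Rightarrow> 'c" where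
  "linear_extension R N g A =
     the_elem ((\<lambda>f. \<Oplus>\<^bsub>N\<^esub>x\<in>{x. f x \<noteq> \<zero>\<^bsub>R\<^esub>}. f x \<odot>\<^bsub>N\<^esub> g x) ` A)"

context
  fixes R :: "('a, 'm) ring_scheme" (structure) and N :: "('a, 'c, 'k) module_scheme"
    and B :: "'b set" and G :: "('b \<Rightarrow> 'a) set" and g :: "'b \<Rightarrow> 'c"
  assumes N: "module R N"
    and G: "G \<subseteq> carrier (free_module R B)"
    and g: "g \<in> B \<rightarrow> carrier N"
    and relations: "\<And>r. r \<in> G \<Longrightarrow> (\<Oplus>\<^bsub>N\<^esub>x\<in>{x. r x \<noteq> \<zero>}. r x \<odot>\<^bsub>N\<^esub> g x) = \<zero>\<^bsub>N\<^esub>"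
begin

interpretation N: module R N by (fact N)

interpretation F: module R "free_module R B"
  by (rule module_free_module) (rule N.is_cring)

private abbreviation "val f \<equiv> \<Oplus>\<^bsub>N\<^esub>x\<in>{x. f x \<noteq> \<zero>}. f x \<odot>\<^bsub>N\<^esub> g x"

private lemma freeD:
  assumes "f \<in> carrier (free_module R B)"
  shows "f x \<in> carrier R" "x \<notin> B \<Longrightarrow> f x = \<zero>" "finite {x. f x \<noteq> \<zero>}" "{x. f x \<noteq> \<zero>} \<subseteq> B"
  using assms by (cases "x \<in> B"; force simp: free_module_def)+

private lemma val_eq:
  assumes "f \<in> carrier (free_module R B)" "finite A" "{x. f x \<noteq> \<zero>} \<subseteq> A" "A \<subseteq> B"
  shows "val f = (\<Oplus>\<^bsub>N\<^esub>x\<in>A. f x \<odot>\<^bsub>N\<^esub> g x)"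
proof -
  have gA: "g x \<in> carrier N" if "x \<in> A" for x using g assms(4) that by blast
  show ?thesis
    using assms(2,3) freeD(1)[OF assms(1)] gA
    by (intro N.M.add.finprod_mono_neutral_cong_left) auto
qed

private lemma val_closed: "f \<in> carrier (free_module R B) \<Longrightarrow> val f \<in> carrier N"
  using freeD g by (intro N.M.finsum_closed) fastforce

private lemma val_add:
  assumes f: "f \<in> carrier (free_module R B)" "f' \<in> carrier (free_module R B)"
  shows "val (f \<oplus>\<^bsub>free_module R B\<^esub> f') = val f \<oplus>\<^bsub>N\<^esub> val f'"
proof -
  define A where "A = {x. f x \<noteq> \<zero>} \<union> {x. f' x \<noteq> \<zero>}"
  have A: "finite A" "A \<subseteq> B" using freeD[OF f(1)] freeD[OF f(2)] by (auto simp: A_def)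
  have gA: "g x \<in> carrier N" if "x \<in> A" for x using g A(2) that by blast
  have *: "(f \<oplus>\<^bsub>free_module R B\<^esub> f') x = f x \<oplus> f' x" for x by (simp add: free_module_def)
  have s: "{x. (f \<oplus>\<^bsub>free_module R B\<^esub> f') x \<noteq> \<zero>} \<subseteq> A" by (auto simp: A_def *)
  have "val (f \<oplus>\<^bsub>free_module R B\<^esub> f') =
      (\<Oplus>\<^bsub>N\<^esub>x\<in>A. (f \<oplus>\<^bsub>free_module R B\<^esub> f') x \<odot>\<^bsub>N\<^esub> g x)"
    by (rule val_eq) (use f A s in auto)
  also have "\<dots> = (\<Oplus>\<^bsub>N\<^esub>x\<in>A. f x \<odot>\<^bsub>N\<^esub> g x \<oplus>\<^bsub>N\<^esub> f' x \<odot>\<^bsub>N\<^esub> g x)"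
    using gA freeD(1)[OF f(1)] freeD(1)[OF f(2)]
    by (intro N.M.finsum_cong') (auto simp: * N.smult_l_distr)
  also have "\<dots> = (\<Oplus>\<^bsub>N\<^esub>x\<in>A. f x \<odot>\<^bsub>N\<^esub> g x) \<oplus>\<^bsub>N\<^esub> (\<Oplus>\<^bsub>N\<^esub>x\<in>A. f' x \<odot>\<^bsub>N\<^esub> g x)"
    using gA freeD(1)[OF f(1)] freeD(1)[OF f(2)] by (intro N.M.finsum_addf) auto
  also have "\<dots> = val f \<oplus>\<^bsub>N\<^esub> val f'"
    using val_eq[OF f(1) A(1) _ A(2)] val_eq[OF f(2) A(1) _ A(2)] by (simp add: A_def)
  finally show ?thesis .
qed

private lemma val_smult:
  assumes c: "c \<in> carrier R" and f: "f \<in> carrier (free_module R B)"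
  shows "val (c \<odot>\<^bsub>free_module R B\<^esub> f) = c \<odot>\<^bsub>N\<^esub> val f"
proof -
  have gf: "g x \<in> carrier N" if "f x \<noteq> \<zero>" for x using g freeD(2)[OF f, of x] that by blast
  have *: "(c \<odot>\<^bsub>free_module R B\<^esub> f) x = c \<otimes> f x" for x by (simp add: free_module_def)
  have s: "{x. (c \<odot>\<^bsub>free_module R B\<^esub> f) x \<noteq> \<zero>} \<subseteq> {x. f x \<noteq> \<zero>}"
    using c by (auto simp: *)
  have "val (c \<odot>\<^bsub>free_module R B\<^esub> f) =
      (\<Oplus>\<^bsub>N\<^esub>x\<in>{x. f x \<noteq> \<zero>}. (c \<odot>\<^bsub>free_module R B\<^esub> f) x \<odot>\<^bsub>N\<^esub> g x)"
    by (rule val_eq[OF F.smult_closed[OF c f] freeD(3)[OF f] s freeD(4)[OF f]])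
  also have "\<dots> = (\<Oplus>\<^bsub>N\<^esub>x\<in>{x. f x \<noteq> \<zero>}. c \<odot>\<^bsub>N\<^esub> (f x \<odot>\<^bsub>N\<^esub> g x))"
    using c gf freeD(1,3)[OF f] by (intro N.M.finsum_cong') (auto simp: * N.smult_assoc1)
  also have "\<dots> = c \<odot>\<^bsub>N\<^esub> val f"
    using c gf freeD(1,3)[OF f] by (intro N.finsum_smult_ldistr[symmetric]) auto
  finally show ?thesis .
qed

private lemma val_generated: "h \<in> generated_submodule R (free_module R B) G \<Longrightarrow> val h = \<zero>\<^bsub>N\<^esub>"
proof -
  let ?K = "{f \<in> carrier (free_module R B). val f = \<zero>\<^bsub>N\<^esub>}"
  have "submodule ?K R (free_module R B)"
  proof (rule F.submoduleI)
    show "\<zero>\<^bsub>free_module R B\<^esub> \<in> ?K"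
      using F.M.zero_closed by (simp add: free_module_def)
    fix f assume f: "f \<in> ?K"
    then have "\<ominus>\<^bsub>free_module R B\<^esub> f = (\<ominus> \<one>) \<odot>\<^bsub>free_module R B\<^esub> f"
      by (simp add: F.smult_l_minus)
    then show "\<ominus>\<^bsub>free_module R B\<^esub> f \<in> ?K"
      using f by (simp only: mem_Collect_eq val_smult N.R.a_inv_closed N.R.one_closed) simp
  qed (auto simp: val_add val_smult simp del: N.M.finsum_zero)
  moreover have "G \<subseteq> ?K" using G relations by auto
  ultimately show "h \<in> generated_submodule R (free_module R B) G \<Longrightarrow> val h = \<zero>\<^bsub>N\<^esub>"
    by (auto simp: generated_submodule_def)
qed

private lemma linear_extension_coset:
  assumes f: "f \<in> carrier (free_module R B)"
  shows "linear_extension R N g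
      (generated_submodule R (free_module R B) G +>\<^bsub>free_module R B\<^esub> f) = val f"
proof -
  let ?S = "generated_submodule R (free_module R B) G"
  have S: "?S \<subseteq> carrier (free_module R B)" "\<zero>\<^bsub>free_module R B\<^esub> \<in> ?S"
    using submodule_generated(1)[OF F.module_axioms G]
    by (auto simp: submodule_def subgroup_def)
  have *: "val h = val f" if "h \<in> ?S +>\<^bsub>free_module R B\<^esub> f" for h
  proof -
    from that obtain s where s: "s \<in> ?S" "h = s \<oplus>\<^bsub>free_module R B\<^esub> f"
      by (auto simp: a_r_coset_def')
    then show ?thesis
      using f S val_add[of s f] val_generated[OF s(1)] val_closed[OF f] by auto
  qed
  have "f \<in> ?S +>\<^bsub>free_module R B\<^esub> f"
    using f S(2) by (force simp: a_r_coset_def')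
  then have "?S +>\<^bsub>free_module R B\<^esub> f \<noteq> {}" by blast
  then show ?thesis
    unfolding linear_extension_def by (rule the_elem_image_unique) (rule *)
qed

lemma linear_extension_gen:
  assumes x: "x \<in> B"
  shows "linear_extension R N g (presented_gen R B G x) = g x"
proof -
  have "val (free_gen R x) = (\<Oplus>\<^bsub>N\<^esub>y\<in>{x}. free_gen R x y \<odot>\<^bsub>N\<^esub> g y)"
    by (rule val_eq) (use x free_gen_carrier[OF N.is_cring x] in \<open>auto simp: free_gen_def\<close>)
  also have "\<dots> = g x"
  proof -
    have "g x \<in> carrier N" using x g by blast
    then show ?thesis
      using N.M.finsum_insert[of "{}" x "\<lambda>y. free_gen R x y \<odot>\<^bsub>N\<^esub> g y"]
      by (simp add: free_gen_def)
  qed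
  finally show ?thesis
    using x by (simp add: presented_gen_def linear_extension_coset free_gen_carrier N.is_cring)
qed

lemma linear_extension_linear:
  assumes u: "u \<in> carrier (presented_module R B G)"
  shows "linear_extension R N g u \<in> carrier N"
    and "v \<in> carrier (presented_module R B G) \<Longrightarrow>
      linear_extension R N g (u \<oplus>\<^bsub>presented_module R B G\<^esub> v) =
      linear_extension R N g u \<oplus>\<^bsub>N\<^esub> linear_extension R N g v"
    and "c \<in> carrier R \<Longrightarrow>
      linear_extension R N g (c \<odot>\<^bsub>presented_module R B G\<^esub> u) = c \<odot>\<^bsub>N\<^esub> linear_extension R N g u"
proof -
  note Q = module_quotient_module[OF F.module_axioms submodule_generated(1)[OF F.module_axioms G]]
  have rep: "\<exists>f\<in>carrier (free_module R B).
      w = generated_submodule R (free_module R B) G +>\<^bsub>free_module R B\<^esub> f"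
    if "w \<in> carrier (presented_module R B G)" for w
    using that by (auto simp: presented_module_def quotient_module_def A_RCOSETS_def')
  from rep[OF u] obtain f where f: "f \<in> carrier (free_module R B)"
    "u = generated_submodule R (free_module R B) G +>\<^bsub>free_module R B\<^esub> f" by blast
  show "linear_extension R N g u \<in> carrier N"
    using f by (simp add: linear_extension_coset val_closed)
  show "linear_extension R N g (u \<oplus>\<^bsub>presented_module R B G\<^esub> v) =
      linear_extension R N g u \<oplus>\<^bsub>N\<^esub> linear_extension R N g v"
    if v: "v \<in> carrier (presented_module R B G)"
  proof -
    from rep[OF v] obtain f' where f': "f' \<in> carrier (free_module R B)"
      "v = generated_submodule R (free_module R B) G +>\<^bsub>free_module R B\<^esub> f'" by blast
    show ?thesis
      using f f' by (simp add: presented_module_def Q(2) linear_extension_coset val_add)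
  qed
  show "linear_extension R N g (c \<odot>\<^bsub>presented_module R B G\<^esub> u) = c \<odot>\<^bsub>N\<^esub> linear_extension R N g u"
    if c: "c \<in> carrier R"
    using f c by (simp add: presented_module_def Q(3) linear_extension_coset val_smult)
qed

end

section \<open>Tensor products, exterior powers and symmetric powers\<close>

definition bilinear_relations ::
    "('a, 'm) ring_scheme \<Rightarrow> ('a, 'b, 'k) module_scheme \<Rightarrow> ('a, 'c, 'l) module_scheme
      \<Rightarrow> ('b \<times> 'c \<Rightarrow> 'a) set" where
  "bilinear_relations R M N =
    (let F = free_module R (carrier M \<times> carrier N); \<delta> = free_gen R in
      {\<delta> (x \<oplus>\<^bsub>M\<^esub> x', y) \<ominus>\<^bsub>F\<^esub> (\<delta> (x, y) \<oplus>\<^bsub>F\<^esub> \<delta> (x', y)) | x x' y.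
         x \<in> carrier M \<and> x' \<in> carrier M \<and> y \<in> carrier N} \<union>
      {\<delta> (x, y \<oplus>\<^bsub>N\<^esub> y') \<ominus>\<^bsub>F\<^esub> (\<delta> (x, y) \<oplus>\<^bsub>F\<^esub> \<delta> (x, y')) | x y y'.
         x \<in> carrier M \<and> y \<in> carrier N \<and> y' \<in> carrier N} \<union>
      {\<delta> (c \<odot>\<^bsub>M\<^esub> x, y) \<ominus>\<^bsub>F\<^esub> c \<odot>\<^bsub>F\<^esub> \<delta> (x, y) | c x y.
         c \<in> carrier R \<and> x \<in> carrier M \<and> y \<in> carrier N} \<union>
      {\<delta> (x, c \<odot>\<^bsub>N\<^esub> y) \<ominus>\<^bsub>F\<^esub> c \<odot>\<^bsub>F\<^esub> \<delta> (x, y) | c x y.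
         c \<in> carrier R \<and> x \<in> carrier M \<and> y \<in> carrier N})"

definition tensor_product ::
    "('a, 'm) ring_scheme \<Rightarrow> ('a, 'b, 'k) module_scheme \<Rightarrow> ('a, 'c, 'l) module_scheme
      \<Rightarrow> ('a, ('b \<times> 'c \<Rightarrow> 'a) set) module" where
  "tensor_product R M N =
     presented_module R (carrier M \<times> carrier N) (bilinear_relations R M N)"

definition tensor ::
    "('a, 'm) ring_scheme \<Rightarrow> ('a, 'b, 'k) module_scheme \<Rightarrow> ('a, 'c, 'l) module_scheme
      \<Rightarrow> 'b \<Rightarrow> 'c \<Rightarrow> ('b \<times> 'c \<Rightarrow> 'a) set" where
  "tensor R M N x y =
     presented_gen R (carrier M \<times> carrier N) (bilinear_relations R M N) (x, y)"

text \<open>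
  The exterior and symmetric powers are the quotients of the tensor power by the alternating
  and the symmetry relations. The tensor power is itself presented by the tuples
  \<open>[a\<^sub>1, \<dots>, a\<^sub>i]\<close> (standing for \<open>a\<^sub>1 \<otimes> \<dots> \<otimes> a\<^sub>i\<close>) with the multilinear relations, so both
  quotients are written in a single step. In degree \<open>0\<close> they are free on the empty tuple.
\<close>

definition tuples :: "('a, 'b, 'k) module_scheme \<Rightarrow> nat \<Rightarrow> 'b list set" where
  "tuples M i = {as. length as = i \<and> set as \<subseteq> carrier M}"

definition multilinear_relations ::
    "('a, 'm) ring_scheme \<Rightarrow> ('a, 'b, 'k) module_scheme \<Rightarrow> nat \<Rightarrow> ('b list \<Rightarrow> 'a) set" where
  "multilinear_relations R M i =
    (let F = free_module R (tuples M i); \<delta> = free_gen R in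
      {\<delta> (as[j := x \<oplus>\<^bsub>M\<^esub> y]) \<ominus>\<^bsub>F\<^esub> (\<delta> (as[j := x]) \<oplus>\<^bsub>F\<^esub> \<delta> (as[j := y])) | as j x y.
         as \<in> tuples M i \<and> j < i \<and> x \<in> carrier M \<and> y \<in> carrier M} \<union>
      {\<delta> (as[j := c \<odot>\<^bsub>M\<^esub> x]) \<ominus>\<^bsub>F\<^esub> c \<odot>\<^bsub>F\<^esub> \<delta> (as[j := x]) | as j c x.
         as \<in> tuples M i \<and> j < i \<and> c \<in> carrier R \<and> x \<in> carrier M})"

definition exterior_relations ::
    "('a, 'm) ring_scheme \<Rightarrow> ('a, 'b, 'k) module_scheme \<Rightarrow> nat \<Rightarrow> ('b list \<Rightarrow> 'a) set" where
  "exterior_relations R M i =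
     multilinear_relations R M i \<union> {free_gen R as | as. as \<in> tuples M i \<and> \<not> distinct as}"

definition exterior_power ::
    "('a, 'm) ring_scheme \<Rightarrow> ('a, 'b, 'k) module_scheme \<Rightarrow> nat
      \<Rightarrow> ('a, ('b list \<Rightarrow> 'a) set) module" where
  "exterior_power R M i = presented_module R (tuples M i) (exterior_relations R M i)"

definition wedge ::
    "('a, 'm) ring_scheme \<Rightarrow> ('a, 'b, 'k) module_scheme \<Rightarrow> 'b list \<Rightarrow> ('b list \<Rightarrow> 'a) set" where
  "wedge R M as = presented_gen R (tuples M (length as)) (exterior_relations R M (length as)) as"

definition symmetric_relations ::
    "('a, 'm) ring_scheme \<Rightarrow> ('a, 'b, 'k) module_scheme \<Rightarrow> nat \<Rightarrow> ('b list \<Rightarrow> 'a) set" where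
  "symmetric_relations R M i =
     multilinear_relations R M i \<union>
     {free_gen R as \<ominus>\<^bsub>free_module R (tuples M i)\<^esub> free_gen R bs | as bs.
        as \<in> tuples M i \<and> bs \<in> tuples M i \<and> mset as = mset bs}"

definition symmetric_power ::
    "('a, 'm) ring_scheme \<Rightarrow> ('a, 'b, 'k) module_scheme \<Rightarrow> nat
      \<Rightarrow> ('a, ('b list \<Rightarrow> 'a) set) module" where
  "symmetric_power R M i = presented_module R (tuples M i) (symmetric_relations R M i)"

definition sym_prod ::
    "('a, 'm) ring_scheme \<Rightarrow> ('a, 'b, 'k) module_scheme \<Rightarrow> 'b list \<Rightarrow> ('b list \<Rightarrow> 'a) set" where
  "sym_prod R M as =
     presented_gen R (tuples M (length as)) (symmetric_relations R M (length as)) as"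

text \<open>The product \<open>\<alpha> a\<close> of \<open>\<alpha>\<close> in the \<open>i\<close>-th symmetric power and \<open>a\<close> in \<open>M\<close>.\<close>

definition sym_mult ::
    "('a, 'm) ring_scheme \<Rightarrow> ('a, 'b, 'k) module_scheme \<Rightarrow> nat
      \<Rightarrow> ('b list \<Rightarrow> 'a) set \<Rightarrow> 'b \<Rightarrow> ('b list \<Rightarrow> 'a) set" where
  "sym_mult R M i \<alpha> a =
     linear_extension R (symmetric_power R M (Suc i)) (\<lambda>as. sym_prod R M (as @ [a])) \<alpha>"

section \<open>The Koszul complex\<close>

text \<open>Positions in lists count from \<open>0\<close>, so the sign \<open>(-1)\<^sup>j\<^sup>+\<^sup>1\<close> of the usual formula becomes \<open>(-1)\<^sup>j\<close>.\<close>

definition alt_sign :: "('a, 'm) ring_scheme \<Rightarrow> nat \<Rightarrow> 'a" where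
  "alt_sign R j = (\<ominus>\<^bsub>R\<^esub> \<one>\<^bsub>R\<^esub>) [^]\<^bsub>R\<^esub> j"

definition omit :: "nat \<Rightarrow> 'b list \<Rightarrow> 'b list" where
  "omit j as = take j as @ drop (Suc j) as"

definition exterior_diff ::
    "('a, 'm) ring_scheme \<Rightarrow> ('a, 'b, 'k) module_scheme \<Rightarrow> nat
      \<Rightarrow> ('b list \<Rightarrow> 'a) set \<Rightarrow> ('b \<times> ('b list \<Rightarrow> 'a) set \<Rightarrow> 'a) set" where
  "exterior_diff R M i =
    (let T = tensor_product R M (exterior_power R M (i - 1)) in
      linear_extension R T
        (\<lambda>as. \<Oplus>\<^bsub>T\<^esub>j\<in>{..<i}. alt_sign R j \<odot>\<^bsub>T\<^esub>
           tensor R M (exterior_power R M (i - 1)) (as ! j) (wedge R M (omit j as))))"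

definition Kos ::
    "('a, 'm) ring_scheme \<Rightarrow> ('a, 'b, 'k) module_scheme \<Rightarrow> nat \<Rightarrow> nat
      \<Rightarrow> ('a, (('b list \<Rightarrow> 'a) set \<times> ('b list \<Rightarrow> 'a) set \<Rightarrow> 'a) set) module" where
  "Kos R M n i = tensor_product R (symmetric_power R M (n - i)) (exterior_power R M i)"

text \<open>
  The differential from \<open>Kos R M n i\<close> to \<open>Kos R M n (i - 1)\<close>, for \<open>1 \<le> i \<le> n\<close>. The outer
  extension is along the tensors \<open>\<alpha> \<otimes> \<omega>\<close>, the inner one along the decomposable
  \<open>\<omega> = a\<^sub>1 \<and> \<dots> \<and> a\<^sub>i\<close>.
\<close>

definition Kos_diff ::
    "('a, 'm) ring_scheme \<Rightarrow> ('a, 'b, 'k) module_scheme \<Rightarrow> nat \<Rightarrow> nat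
      \<Rightarrow> (('b list \<Rightarrow> 'a) set \<times> ('b list \<Rightarrow> 'a) set \<Rightarrow> 'a) set
      \<Rightarrow> (('b list \<Rightarrow> 'a) set \<times> ('b list \<Rightarrow> 'a) set \<Rightarrow> 'a) set" where
  "Kos_diff R M n i =
    (let T = Kos R M n (i - 1) in
      linear_extension R T (\<lambda>(\<alpha>, \<omega>).
        linear_extension R T
          (\<lambda>as. \<Oplus>\<^bsub>T\<^esub>j\<in>{..<i}. alt_sign R j \<odot>\<^bsub>T\<^esub>
             tensor R (symmetric_power R M (n - (i - 1))) (exterior_power R M (i - 1))
               (sym_mult R M (n - i) \<alpha> (as ! j)) (wedge R M (omit j as))) \<omega>))"

text \<open>
  Acyclicity (vanishing homology in all degrees) of a complex
  \<open>0 \<rightarrow> C n \<rightarrow> \<dots> \<rightarrow> C 1 \<rightarrow> C 0 \<rightarrow> 0\<close> with differentials \<open>d i\<close> from \<open>C i\<close> to \<open>C (i - 1)\<close>.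
\<close>

definition acyclic_complex ::
    "nat \<Rightarrow> (nat \<Rightarrow> ('a, 'b, 'k) module_scheme) \<Rightarrow> (nat \<Rightarrow> 'b \<Rightarrow> 'b) \<Rightarrow> bool" where
  "acyclic_complex n C d \<longleftrightarrow>
    (\<forall>i\<le>n. (if i = 0 then carrier (C 0) else a_kernel (C i) (C (i - 1)) (d i)) =
           (if i = n then {\<zero>\<^bsub>C n\<^esub>} else d (Suc i) ` carrier (C (Suc i))))"

section \<open>The base ring and the module\<close>

text \<open>The variables \<open>t\<^sub>i\<close> and the generators \<open>e\<^sub>i\<close> are indexed by \<open>{1..n + 1}\<close>.\<close>

definition poly_Fp :: "nat \<Rightarrow> nat \<Rightarrow> (nat multiset \<Rightarrow> int) ring" where
  "poly_Fp p n = mpoly_ring (residue_ring (int p)) {1..n + 1}"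

definition poly_var :: "nat \<Rightarrow> nat \<Rightarrow> nat multiset \<Rightarrow> int" where
  "poly_var p i = ring.indexed_var (residue_ring (int p)) i"

definition square_ideal :: "nat \<Rightarrow> nat \<Rightarrow> (nat multiset \<Rightarrow> int) set" where
  "square_ideal p n =
     Idl\<^bsub>poly_Fp p n\<^esub> ((\<lambda>i. poly_var p i [^]\<^bsub>poly_Fp p n\<^esub> (2::nat)) ` {1..n + 1})"

definition base_ring :: "nat \<Rightarrow> nat \<Rightarrow> (nat multiset \<Rightarrow> int) set ring" where
  "base_ring p n = poly_Fp p n Quot square_ideal p n"

lemma cring_base_ring:
  assumes "prime p"
  shows "cring (base_ring p n)"
proof -
  have "residues (int p)"
    using prime_gt_1_nat[OF assms] by (simp add: residues_def)
  then have R: "cring (residue_ring (int p))"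
    by (rule residues.cring)
  interpret R: cring "residue_ring (int p)" by (rule R)
  interpret P: cring "poly_Fp p n"
    unfolding poly_Fp_def by (rule cring_mpoly_ring) (rule R)
  have "poly_var p i \<in> carrier (poly_Fp p n)" if "i \<in> {1..n + 1}" for i
    using R.indexed_pset.indexed_pmult[OF R.indexed_pset.indexed_const[OF R.one_closed] that]
    by (simp add: poly_var_def poly_Fp_def mpoly_ring_def R.indexed_var_def)
  then have "ideal (square_ideal p n) (poly_Fp p n)"
    unfolding square_ideal_def by (intro P.genideal_ideal) auto
  then show ?thesis
    unfolding base_ring_def by (rule ideal.quotient_is_cring) (rule P.is_cring)
qed

definition t_elem :: "nat \<Rightarrow> nat \<Rightarrow> nat \<Rightarrow> (nat multiset \<Rightarrow> int) set" where
  "t_elem p n i = square_ideal p n +>\<^bsub>poly_Fp p n\<^esub> poly_var p i"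

definition M_relation :: "nat \<Rightarrow> nat \<Rightarrow> nat \<Rightarrow> (nat multiset \<Rightarrow> int) set" where
  "M_relation p n =
    (let F = free_module (base_ring p n) {1..n + 1} in
      \<Oplus>\<^bsub>F\<^esub>i\<in>{1..n + 1}. t_elem p n i \<odot>\<^bsub>F\<^esub> free_gen (base_ring p n) i)"

definition M_module ::
    "nat \<Rightarrow> nat \<Rightarrow> ((nat multiset \<Rightarrow> int) set, (nat \<Rightarrow> (nat multiset \<Rightarrow> int) set) set) module" where
  "M_module p n = presented_module (base_ring p n) {1..n + 1} {M_relation p n}"

definition e_elem :: "nat \<Rightarrow> nat \<Rightarrow> nat \<Rightarrow> (nat \<Rightarrow> (nat multiset \<Rightarrow> int) set) set" where
  "e_elem p n i = presented_gen (base_ring p n) {1..n + 1} {M_relation p n} i"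

end

(* Put x_i = t_i e_i, so that x_1 + ... + x_(n+1) = 0, while expressions in which some x_i occurs
   twice vanish because t_i^2 = 0. Using the relation to exchange factors, any two consecutive
   summands of the differential of w = x_1 /\ ... /\ x_n are equal. Hence it is n times one of them,
   which is 0 in characteristic p. On the other hand a_1 /\ ... /\ a_n |-> det (r, a_1, ..., a_n) with
   r = (t_1, ..., t_(n+1)) is a linear form on the exterior power of M, since r spans the relations,
   and up to sign its value at w is t_1 ... t_(n+1), which is not 0. The element 1 (x) w then
   contradicts the acyclicity of the Koszul complex at its left end. *)

theory Submission
  imports Defs
begin

section \<open>Linear maps and presented modules\<close>

text \<open>Elements of the tensor, exterior and symmetric powers are cosets of formal combinations.
  Maps out of them are therefore obtained from universal properties, and an element is shown to be
  nonzero by a linear form that does not vanish on it. One fact makes three constructions well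
  defined: the signed sum of b(a_j)(remaining entries) is alternating whenever b is linear in its
  first and alternating in its second argument. It yields the exterior differential, the Koszul
  differential and, through Laplace expansion, the determinant. The spare index n+1 has two jobs.
  The factor x_(n+1) is absent from w and serves as a buffer when factors of a summand are
  exchanged. Moreover, for n > 0, with only n generators the relation x_1 + ... + x_n = 0 would
  express x_n by the other factors and force w = 0. That t_1 ... t_(n+1) survives in the base ring
  is read off from squarefree monomials: polynomials whose squarefree coefficients all vanish form
  an ideal, and it contains every t_i^2. The case n = 0 is included, as p divides 0; the
  differential is then an empty sum, and acyclicity fails because the only component is
  nonzero.\<close>

definition linear_map ::
    "('a, 'm) ring_scheme \<Rightarrow> ('a, 'b, 'k) module_scheme \<Rightarrow> ('a, 'c, 'l) module_scheme
      \<Rightarrow> ('b \<Rightarrow> 'c) \<Rightarrow> bool" where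
  "linear_map R M N f \<longleftrightarrow> f \<in> carrier M \<rightarrow> carrier N \<and>
     (\<forall>x\<in>carrier M. \<forall>y\<in>carrier M. f (x \<oplus>\<^bsub>M\<^esub> y) = f x \<oplus>\<^bsub>N\<^esub> f y) \<and>
     (\<forall>c\<in>carrier R. \<forall>x\<in>carrier M. f (c \<odot>\<^bsub>M\<^esub> x) = c \<odot>\<^bsub>N\<^esub> f x)"

lemma linear_mapI:
  assumes "\<And>x. x \<in> carrier M \<Longrightarrow> f x \<in> carrier N"
    and "\<And>x y. x \<in> carrier M \<Longrightarrow> y \<in> carrier M \<Longrightarrow> f (x \<oplus>\<^bsub>M\<^esub> y) = f x \<oplus>\<^bsub>N\<^esub> f y"
    and "\<And>c x. c \<in> carrier R \<Longrightarrow> x \<in> carrier M \<Longrightarrow> f (c \<odot>\<^bsub>M\<^esub> x) = c \<odot>\<^bsub>N\<^esub> f x"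
  shows "linear_map R M N f"
  using assms by (auto simp: linear_map_def)

lemma linear_mapD:
  assumes "linear_map R M N f"
  shows "x \<in> carrier M \<Longrightarrow> f x \<in> carrier N"
    and "x \<in> carrier M \<Longrightarrow> y \<in> carrier M \<Longrightarrow> f (x \<oplus>\<^bsub>M\<^esub> y) = f x \<oplus>\<^bsub>N\<^esub> f y"
    and "c \<in> carrier R \<Longrightarrow> x \<in> carrier M \<Longrightarrow> f (c \<odot>\<^bsub>M\<^esub> x) = c \<odot>\<^bsub>N\<^esub> f x"
  using assms by (auto simp: linear_map_def)

lemma linear_map_cong:
  assumes M: "module R M" and "\<And>x. x \<in> carrier M \<Longrightarrow> f x = g x" "linear_map R M N g"
  shows "linear_map R M N f"
proof -
  interpret M: module R M by fact
  show ?thesis using assms(2,3) by (auto simp: linear_map_def)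
qed

lemma linear_map_comp:
  "linear_map R M N f \<Longrightarrow> linear_map R N T g \<Longrightarrow> linear_map R M T (\<lambda>x. g (f x))"
  by (auto simp: linear_map_def Pi_iff)

lemma linear_map_id: "linear_map R M M (\<lambda>x. x)"
  by (simp add: linear_map_def)

context
  fixes R :: "('a, 'm) ring_scheme" (structure) and M :: "('a, 'b, 'k) module_scheme"
    and N :: "('a, 'c, 'l) module_scheme"
  assumes M: "module R M" and N: "module R N"
begin

interpretation M: module R M by (fact M)
interpretation N: module R N by (fact N)

lemma linear_map_zero:
  assumes f: "linear_map R M N f"
  shows "f \<zero>\<^bsub>M\<^esub> = \<zero>\<^bsub>N\<^esub>"
  using linear_mapD(3)[OF f, of \<zero> "\<zero>\<^bsub>M\<^esub>"] linear_mapD(1)[OF f, of "\<zero>\<^bsub>M\<^esub>"] by simp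

lemma linear_map_uminus:
  assumes f: "linear_map R M N f" and x: "x \<in> carrier M"
  shows "f (\<ominus>\<^bsub>M\<^esub> x) = \<ominus>\<^bsub>N\<^esub> f x"
  using linear_mapD(3)[OF f, of "\<ominus> \<one>" x] linear_mapD(1)[OF f x] x
  by (simp add: M.smult_l_minus N.smult_l_minus)

lemma linear_map_minus:
  assumes f: "linear_map R M N f" and "x \<in> carrier M" "y \<in> carrier M"
  shows "f (x \<ominus>\<^bsub>M\<^esub> y) = f x \<ominus>\<^bsub>N\<^esub> f y"
  using assms linear_map_uminus by (simp add: a_minus_def linear_mapD)

lemma linear_map_finsum:
  assumes f: "linear_map R M N f" and "finite A" "g \<in> A \<rightarrow> carrier M"
  shows "f (\<Oplus>\<^bsub>M\<^esub>i\<in>A. g i) = (\<Oplus>\<^bsub>N\<^esub>i\<in>A. f (g i))"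
  using assms(2,3)
proof (induction rule: finite_induct)
  case empty
  then show ?case using linear_map_zero[OF f] by (simp del: M.M.finsum_zero N.M.finsum_zero)
next
  case (insert a A)
  then have "g a \<in> carrier M" "g \<in> A \<rightarrow> carrier M" by auto
  moreover from this have "(\<lambda>i. f (g i)) \<in> A \<rightarrow> carrier N"
    using linear_mapD(1)[OF f] by auto
  ultimately show ?case using insert linear_mapD(1,2)[OF f] by simp
qed

lemma linear_map_const_zero: "linear_map R M N (\<lambda>_. \<zero>\<^bsub>N\<^esub>)"
  by (intro linear_mapI) auto

lemma linear_map_add:
  assumes "linear_map R M N f" "linear_map R M N g"
  shows "linear_map R M N (\<lambda>x. f x \<oplus>\<^bsub>N\<^esub> g x)"
  by (intro linear_mapI)
    (auto simp: linear_mapD[OF assms(1)] linear_mapD[OF assms(2)] N.smult_r_distr N.M.a_ac)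

lemma linear_map_scale:
  assumes "linear_map R M N f" "c \<in> carrier R"
  shows "linear_map R M N (\<lambda>x. c \<odot>\<^bsub>N\<^esub> f x)"
proof (intro linear_mapI)
  fix d x assume dx: "d \<in> carrier R" "x \<in> carrier M"
  then have "c \<odot>\<^bsub>N\<^esub> (d \<odot>\<^bsub>N\<^esub> f x) = d \<odot>\<^bsub>N\<^esub> (c \<odot>\<^bsub>N\<^esub> f x)"
    using assms by (simp add: linear_mapD M.m_comm flip: N.smult_assoc1)
  then show "c \<odot>\<^bsub>N\<^esub> f (d \<odot>\<^bsub>M\<^esub> x) = d \<odot>\<^bsub>N\<^esub> (c \<odot>\<^bsub>N\<^esub> f x)"
    using dx assms by (simp add: linear_mapD)
qed (use assms in \<open>auto simp: linear_mapD N.smult_r_distr\<close>)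

lemma linear_map_sum:
  assumes "finite A" "\<And>i. i \<in> A \<Longrightarrow> linear_map R M N (f i)"
  shows "linear_map R M N (\<lambda>x. \<Oplus>\<^bsub>N\<^esub>i\<in>A. f i x)"
  using assms
proof (induction rule: finite_induct)
  case empty
  then show ?case using linear_map_const_zero by simp
next
  case (insert a A)
  show ?case
  proof (rule linear_map_cong[OF M])
    fix x assume "x \<in> carrier M"
    then show "(\<Oplus>\<^bsub>N\<^esub>i\<in>insert a A. f i x) = f a x \<oplus>\<^bsub>N\<^esub> (\<Oplus>\<^bsub>N\<^esub>i\<in>A. f i x)"
      using insert.hyps insert.prems linear_mapD(1)
      by (intro N.M.finsum_insert) fast+
  qed (use insert in \<open>auto intro: linear_map_add\<close>)
qed

text \<open>\<open>generated_submodule\<close> is an intersection, so a linear map that kills the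
  relations kills all of it once its kernel is known to be one of the submodules
  intersected.\<close>

lemma submodule_kernel:
  assumes f: "linear_map R M N f"
  shows "submodule {x \<in> carrier M. f x = \<zero>\<^bsub>N\<^esub>} R M"
  by (rule M.submoduleI) (auto simp: linear_mapD[OF f] linear_map_zero[OF f] linear_map_uminus[OF f])

end

text \<open>The function whose common value on a coset is selected by
  \<open>linear_extension\<close>. Having it separately allows relations to be tested on single
  formal combinations.\<close>

definition free_eval ::
    "('a, 'm) ring_scheme \<Rightarrow> ('a, 'c, 'k) module_scheme \<Rightarrow> ('b \<Rightarrow> 'c) \<Rightarrow> ('b \<Rightarrow> 'a) \<Rightarrow> 'c" where
  "free_eval R N g f = (\<Oplus>\<^bsub>N\<^esub>x\<in>{x. f x \<noteq> \<zero>\<^bsub>R\<^esub>}. f x \<odot>\<^bsub>N\<^esub> g x)"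

definition presented_class ::
    "('a, 'm) ring_scheme \<Rightarrow> 'b set \<Rightarrow> ('b \<Rightarrow> 'a) set \<Rightarrow> ('b \<Rightarrow> 'a) \<Rightarrow> ('b \<Rightarrow> 'a) set" where
  "presented_class R B G f =
     generated_submodule R (free_module R B) G +>\<^bsub>free_module R B\<^esub> f"

lemma presented_gen_eq_class: "presented_gen R B G x = presented_class R B G (free_gen R x)"
  by (simp add: presented_gen_def presented_class_def)

text \<open>Without relations the presented module consists of the singletons, so the linearity of
  formal evaluation is an instance of the one of \<open>linear_extension\<close>.\<close>

lemma
  fixes R :: "('a, 'm) ring_scheme" (structure)
  assumes N: "module R N" and g: "g \<in> B \<rightarrow> carrier N"
  shows linear_map_free_eval: "linear_map R (free_module R B) N (free_eval R N g)"
    and free_eval_gen: "x \<in> B \<Longrightarrow> free_eval R N g (free_gen R x) = g x"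
proof -
  interpret N: module R N by fact
  let ?F = "free_module R B"
  interpret F: module R ?F by (rule module_free_module) (rule N.is_cring)
  have "submodule {\<zero>\<^bsub>?F\<^esub>} R ?F" by (rule F.submoduleI) auto
  moreover have "\<zero>\<^bsub>?F\<^esub> \<in> K" if "submodule K R ?F" for K
    using subgroup.one_closed[OF submodule.axioms(1)[OF that]] by simp
  ultimately have gen: "generated_submodule R ?F {} = {\<zero>\<^bsub>?F\<^esub>}"
    unfolding generated_submodule_def by blast
  have ext: "linear_extension R N g {f} = free_eval R N g f" for f
    by (simp add: linear_extension_def free_eval_def)
  have class_single: "generated_submodule R ?F {} +>\<^bsub>?F\<^esub> f = {f}" if "f \<in> carrier ?F" for f
    using that by (simp add: gen a_r_coset_def')
  note Q = module_quotient_module[OF F.module_axioms submodule_generated(1)[OF F.module_axioms, of "{}"]]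
  have car: "{f} \<in> carrier (presented_module R B {})" if "f \<in> carrier ?F" for f
    using that class_single[OF that]
    by (auto simp: presented_module_def quotient_module_def A_RCOSETS_def')
  have add: "{f} \<oplus>\<^bsub>presented_module R B {}\<^esub> {h} = {f \<oplus>\<^bsub>?F\<^esub> h}"
    if "f \<in> carrier ?F" "h \<in> carrier ?F" for f h
    using Q(2)[of f h] that by (simp add: presented_module_def class_single)
  have smult: "c \<odot>\<^bsub>presented_module R B {}\<^esub> {f} = {c \<odot>\<^bsub>?F\<^esub> f}"
    if "f \<in> carrier ?F" "c \<in> carrier R" for f c
    using Q(3)[of c f] that by (simp add: presented_module_def class_single)
  note L = linear_extension_linear[OF N, of "{}" B g, OF _ g]
  show "linear_map R ?F N (free_eval R N g)"
  proof (rule linear_mapI)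
    fix f assume f: "f \<in> carrier ?F"
    show "free_eval R N g f \<in> carrier N"
      using L(1)[OF _ _ car[OF f]] by (simp add: ext)
    show "free_eval R N g (f \<oplus>\<^bsub>?F\<^esub> h) = free_eval R N g f \<oplus>\<^bsub>N\<^esub> free_eval R N g h"
      if h: "h \<in> carrier ?F" for h
      using L(2)[OF _ _ car[OF f] car[OF h]] f h by (simp add: ext add)
    show "free_eval R N g (c \<odot>\<^bsub>?F\<^esub> f) = c \<odot>\<^bsub>N\<^esub> free_eval R N g f"
      if c: "c \<in> carrier R" for c
      using L(3)[OF _ _ car[OF f] c] f c by (simp add: ext smult)
  qed
  show "free_eval R N g (free_gen R x) = g x" if x: "x \<in> B"
    using linear_extension_gen[OF N, of "{}" B g x, OF _ g _ x] class_single[of "free_gen R x"]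
      free_gen_carrier[OF N.is_cring x]
    by (simp add: ext presented_gen_def)
qed

text \<open>Uniqueness half of the universal property of a free module: formal combinations have
  finite support, so they can be dismantled one coordinate at a time.\<close>

lemma free_linear_map_eqI:
  fixes R :: "('a, 'm) ring_scheme" (structure) and B :: "'b set"
  assumes N: "module R N"
    and f: "linear_map R (free_module R B) N f" and g: "linear_map R (free_module R B) N g"
    and eq: "\<And>x. x \<in> B \<Longrightarrow> f (free_gen R x) = g (free_gen R x)"
    and u: "u \<in> carrier (free_module R B)"
  shows "f u = g u"
proof -
  interpret N: module R N by fact
  let ?F = "free_module R B"
  interpret F: module R ?F by (rule module_free_module) (rule N.is_cring)
  \<comment> \<open>The support is only required to lie inside \<open>A\<close>, so the induction
    can enlarge \<open>A\<close> by an index without knowing whether it is used.\<close>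
  have "\<forall>u\<in>carrier ?F. {x. u x \<noteq> \<zero>} \<subseteq> A \<longrightarrow> f u = g u" if "finite A" for A
    using that
  proof (induction rule: finite_induct)
    case empty
    have "u = \<zero>\<^bsub>?F\<^esub>" if "{x. u x \<noteq> \<zero>} \<subseteq> {}" for u :: "'b \<Rightarrow> 'a"
      using that by (auto simp: free_module_def)
    then show ?case
      using linear_map_zero[OF F.module_axioms N f] linear_map_zero[OF F.module_axioms N g] by metis
  next
    case (insert a A)
    show ?case
    proof (intro ballI impI)
      fix u assume u: "u \<in> carrier ?F" and sub: "{x. u x \<noteq> \<zero>} \<subseteq> insert a A"
      show "f u = g u"
      proof (cases "a \<in> B")
        case False
        then have "u a = \<zero>" using u by (auto simp: free_module_def)
        then have "{x. u x \<noteq> \<zero>} \<subseteq> A" using sub by auto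
        then show ?thesis using insert.IH u by blast
      next
        case a: True
        \<comment> \<open>The coordinate at \<open>a\<close> is erased; what is lost is a multiple
          of the generator at \<open>a\<close>, where both maps agree.\<close>
        define v where "v = u(a := \<zero>)"
        have ua: "u a \<in> carrier R" using u a by (auto simp: free_module_def)
        have ux: "u x \<in> carrier R" for x using u by (cases "x \<in> B") (auto simp: free_module_def)
        have "finite {x. v x \<noteq> \<zero>}"
          by (rule finite_subset[of _ "{x. u x \<noteq> \<zero>}"])
            (use u in \<open>auto simp: v_def free_module_def\<close>)
        then have v: "v \<in> carrier ?F" using u by (auto simp: v_def free_module_def)
        have "{x. v x \<noteq> \<zero>} \<subseteq> A" using sub by (auto simp: v_def)
        then have IH: "f v = g v" using insert.IH v by blast
        have d: "free_gen R a \<in> carrier ?F" using free_gen_carrier[OF N.is_cring a] .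
        have "u = v \<oplus>\<^bsub>?F\<^esub> u a \<odot>\<^bsub>?F\<^esub> free_gen R a"
          using ua ux by (auto simp: v_def free_gen_def free_module_def fun_eq_iff)
        then show ?thesis
          using v d ua IH eq[OF a] by (metis F.smult_closed linear_mapD(2,3)[OF f] linear_mapD(2,3)[OF g])
      qed
    qed
  qed
  from this[of "{x. u x \<noteq> \<zero>}"] show ?thesis using u by (auto simp: free_module_def)
qed

section \<open>Universal property of a module given by generators and relations\<close>

context
  fixes R :: "('a, 'm) ring_scheme" (structure) and B :: "'b set" and G :: "('b \<Rightarrow> 'a) set"
  assumes R: "cring R" and G: "G \<subseteq> carrier (free_module R B)"
begin

interpretation R: cring R by (fact R)

interpretation F: module R "free_module R B"
  by (rule module_free_module) (rule R)

lemma module_presented_module: "module R (presented_module R B G)"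
  unfolding presented_module_def
  by (rule module_quotient_module[OF F.module_axioms submodule_generated(1)[OF F.module_axioms G]])

lemma carrier_presented_module:
  "carrier (presented_module R B G) = presented_class R B G ` carrier (free_module R B)"
  by (auto simp: presented_module_def presented_class_def quotient_module_def A_RCOSETS_def')

lemma linear_map_presented_class:
  "linear_map R (free_module R B) (presented_module R B G) (presented_class R B G)"
  using module_quotient_module(2,3)[OF F.module_axioms submodule_generated(1)[OF F.module_axioms G]]
    carrier_presented_module
  by (intro linear_mapI) (auto simp: presented_module_def presented_class_def)

lemma presented_class_eq_iff:
  assumes f: "f \<in> carrier (free_module R B)" and h: "h \<in> carrier (free_module R B)"
  shows "presented_class R B G f = presented_class R B G h \<longleftrightarrow>
    f \<ominus>\<^bsub>free_module R B\<^esub> h \<in> generated_submodule R (free_module R B) G"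
proof -
  let ?F = "free_module R B" and ?S = "generated_submodule R (free_module R B) G"
  interpret S: submodule ?S R ?F by (rule submodule_generated(1)[OF F.module_axioms G])
  interpret S: abelian_subgroup ?S ?F
    by (intro abelian_subgroupI3 additive_subgroup.intro) (unfold_locales)
  have "f \<in> presented_class R B G h \<longleftrightarrow> f \<ominus>\<^bsub>?F\<^esub> h \<in> ?S"
  proof
    assume "f \<in> presented_class R B G h"
    then obtain s where "s \<in> ?S" "f = s \<oplus>\<^bsub>?F\<^esub> h"
      by (auto simp: presented_class_def a_r_coset_def')
    then show "f \<ominus>\<^bsub>?F\<^esub> h \<in> ?S"
      using h S.a_subset by (auto simp: a_minus_def F.M.a_assoc F.M.r_neg)
  next
    assume "f \<ominus>\<^bsub>?F\<^esub> h \<in> ?S"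
    moreover have "f = (f \<ominus>\<^bsub>?F\<^esub> h) \<oplus>\<^bsub>?F\<^esub> h"
      using f h by (simp add: a_minus_def F.M.a_assoc F.M.l_neg)
    ultimately show "f \<in> presented_class R B G h"
      by (auto simp: presented_class_def a_r_coset_def')
  qed
  moreover have "f \<in> presented_class R B G f"
    unfolding presented_class_def using f by (rule S.a_rcos_self)
  moreover have "presented_class R B G f = presented_class R B G h" if "f \<in> presented_class R B G h"
    using S.a_repr_independence'[OF that[unfolded presented_class_def] h]
    by (simp add: presented_class_def)
  ultimately show ?thesis by blast
qed

lemma presented_class_relation:
  assumes "f \<in> carrier (free_module R B)" "h \<in> carrier (free_module R B)"
    and "f \<ominus>\<^bsub>free_module R B\<^esub> h \<in> G"
  shows "presented_class R B G f = presented_class R B G h"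
  using assms presented_class_eq_iff submodule_generated(2)[OF F.module_axioms G] by blast

lemma presented_class_zero:
  assumes "r \<in> G"
  shows "presented_class R B G r = \<zero>\<^bsub>presented_module R B G\<^esub>"
proof -
  interpret P: module R "presented_module R B G" by (rule module_presented_module)
  have r: "r \<in> carrier (free_module R B)" using assms G by blast
  have "\<ominus>\<^bsub>free_module R B\<^esub> \<zero>\<^bsub>free_module R B\<^esub> = \<zero>\<^bsub>free_module R B\<^esub>"
    by (metis F.M.a_inv_closed F.M.l_zero F.M.r_neg F.M.zero_closed)
  then have "r \<ominus>\<^bsub>free_module R B\<^esub> \<zero>\<^bsub>free_module R B\<^esub> \<in> G"
    using assms F.M.r_zero[OF r] by (simp only: a_minus_def)
  then have "presented_class R B G r = presented_class R B G \<zero>\<^bsub>free_module R B\<^esub>"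
    using r by (intro presented_class_relation) auto
  then show ?thesis
    using linear_map_zero[OF F.module_axioms P.module_axioms linear_map_presented_class] by simp
qed

lemma presented_gen_closed: "x \<in> B \<Longrightarrow> presented_gen R B G x \<in> carrier (presented_module R B G)"
  unfolding presented_gen_eq_class
  by (intro linear_mapD(1)[OF linear_map_presented_class] free_gen_carrier[OF R])

text \<open>The class map from the free module is onto, so both maps can be pulled back along it and
  compared on free generators.\<close>

lemma presented_linear_map_eqI:
  assumes N: "module R N"
    and f: "linear_map R (presented_module R B G) N f"
    and g: "linear_map R (presented_module R B G) N g"
    and eq: "\<And>x. x \<in> B \<Longrightarrow> f (presented_gen R B G x) = g (presented_gen R B G x)"
    and u: "u \<in> carrier (presented_module R B G)"
  shows "f u = g u"
proof -
  from u obtain v where v: "v \<in> carrier (free_module R B)" "u = presented_class R B G v"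
    by (auto simp: carrier_presented_module)
  note l = linear_map_comp[OF linear_map_presented_class]
  show ?thesis
    using free_linear_map_eqI[OF N l[OF f] l[OF g] _ v(1)] eq v(2)
    by (simp add: presented_gen_eq_class)
qed

lemma
  assumes N: "module R N" and g: "g \<in> B \<rightarrow> carrier N"
    and rel: "\<And>r. r \<in> G \<Longrightarrow> free_eval R N g r = \<zero>\<^bsub>N\<^esub>"
  shows linear_map_linear_extension:
      "linear_map R (presented_module R B G) N (linear_extension R N g)"
    and linear_extension_presented_gen:
      "x \<in> B \<Longrightarrow> linear_extension R N g (presented_gen R B G x) = g x"
  using linear_extension_linear[OF N G g] linear_extension_gen[OF N G g] rel
  by (auto simp: free_eval_def intro!: linear_mapI)

end

section \<open>Multilinear maps and universal properties\<close>

text \<open>Linearity in slot \<open>j\<close> is expressed by \<open>as[j := x]\<close>, the same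
  device as in \<open>multilinear_relations\<close>; the two then correspond term by term.\<close>

definition multilinear_map ::
    "('a, 'm) ring_scheme \<Rightarrow> ('a, 'b, 'k) module_scheme \<Rightarrow> nat \<Rightarrow> ('a, 'c, 'l) module_scheme
      \<Rightarrow> ('b list \<Rightarrow> 'c) \<Rightarrow> bool" where
  "multilinear_map R M i T A \<longleftrightarrow> (\<forall>as\<in>tuples M i. A as \<in> carrier T) \<and>
     (\<forall>as\<in>tuples M i. \<forall>j<i. linear_map R M T (\<lambda>x. A (as[j := x])))"

definition alternating_map ::
    "('a, 'm) ring_scheme \<Rightarrow> ('a, 'b, 'k) module_scheme \<Rightarrow> nat \<Rightarrow> ('a, 'c, 'l) module_scheme
      \<Rightarrow> ('b list \<Rightarrow> 'c) \<Rightarrow> bool" where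
  "alternating_map R M i T A \<longleftrightarrow> multilinear_map R M i T A \<and>
     (\<forall>as\<in>tuples M i. \<not> distinct as \<longrightarrow> A as = \<zero>\<^bsub>T\<^esub>)"

text \<open>The map takes a pair because pairs are the generators of \<open>tensor_product\<close>;
  it can thus be fed to \<open>linear_extension\<close> directly.\<close>

definition bilinear_map ::
    "('a, 'm) ring_scheme \<Rightarrow> ('a, 'b, 'k) module_scheme \<Rightarrow> ('a, 'c, 'l) module_scheme
      \<Rightarrow> ('a, 'd, 'n) module_scheme \<Rightarrow> ('b \<times> 'c \<Rightarrow> 'd) \<Rightarrow> bool" where
  "bilinear_map R M N T g \<longleftrightarrow> (\<forall>y\<in>carrier N. linear_map R M T (\<lambda>x. g (x, y))) \<and>
     (\<forall>x\<in>carrier M. linear_map R N T (\<lambda>y. g (x, y)))"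

lemma tuples_update: "as \<in> tuples M i \<Longrightarrow> x \<in> carrier M \<Longrightarrow> as[j := x] \<in> tuples M i"
  using set_update_subset_insert[of as j x] by (auto simp: tuples_def)

lemma multilinear_mapD:
  assumes "multilinear_map R M i T A" "as \<in> tuples M i"
  shows "A as \<in> carrier T" "j < i \<Longrightarrow> linear_map R M T (\<lambda>x. A (as[j := x]))"
  using assms by (auto simp: multilinear_map_def)

lemma alternating_mapD:
  assumes "alternating_map R M i T A"
  shows "multilinear_map R M i T A"
    and "as \<in> tuples M i \<Longrightarrow> A as \<in> carrier T"
    and "as \<in> tuples M i \<Longrightarrow> \<not> distinct as \<Longrightarrow> A as = \<zero>\<^bsub>T\<^esub>"
  using assms by (auto simp: alternating_map_def multilinear_map_def)

lemma multilinear_map_cong: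
  assumes M: "module R M" and eq: "\<And>as. as \<in> tuples M i \<Longrightarrow> A as = A' as"
  shows "multilinear_map R M i T A \<longleftrightarrow> multilinear_map R M i T A'"
proof -
  have "linear_map R M T (\<lambda>x. A (as[j := x])) \<longleftrightarrow> linear_map R M T (\<lambda>x. A' (as[j := x]))"
    if "as \<in> tuples M i" for as j
    using eq[OF tuples_update[OF that]]
      linear_map_cong[OF M, of "\<lambda>x. A (as[j := x])" "\<lambda>x. A' (as[j := x])"]
      linear_map_cong[OF M, of "\<lambda>x. A' (as[j := x])" "\<lambda>x. A (as[j := x])"]
    by metis
  then show ?thesis by (auto simp: multilinear_map_def eq)
qed

lemma alternating_map_cong:
  assumes M: "module R M" and eq: "\<And>as. as \<in> tuples M i \<Longrightarrow> A as = A' as"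
  shows "alternating_map R M i T A \<longleftrightarrow> alternating_map R M i T A'"
proof -
  have "multilinear_map R M i T A \<longleftrightarrow> multilinear_map R M i T A'"
    using multilinear_map_cong[OF M, of i A A' T] eq by blast
  then show ?thesis using eq by (simp add: alternating_map_def)
qed

lemma multilinear_map_slot:
  assumes A: "multilinear_map R M i T A" and M: "module R M"
    and "set P \<subseteq> carrier M" "set S \<subseteq> carrier M" "length P + Suc (length S) = i"
  shows "linear_map R M T (\<lambda>x. A (P @ x # S))"
proof -
  interpret M: module R M by fact
  \<comment> \<open>The zero is a placeholder for the entry that gets overwritten.\<close>
  have "P @ \<zero>\<^bsub>M\<^esub> # S \<in> tuples M i" using assms by (auto simp: tuples_def)
  from multilinear_mapD(2)[OF A this, of "length P"] show ?thesis using assms(5) by simp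
qed

lemma (in module) minus_eq_zero_iff:
  assumes x: "x \<in> carrier M" and y: "y \<in> carrier M"
  shows "x \<ominus>\<^bsub>M\<^esub> y = \<zero>\<^bsub>M\<^esub> \<longleftrightarrow> x = y"
proof
  assume "x \<ominus>\<^bsub>M\<^esub> y = \<zero>\<^bsub>M\<^esub>"
  then have "(x \<ominus>\<^bsub>M\<^esub> y) \<oplus>\<^bsub>M\<^esub> y = y" using y by simp
  then show "x = y" using x y by (simp add: a_minus_def M.a_assoc M.l_neg)
qed (use y in \<open>simp add: a_minus_def M.r_neg\<close>)

section \<open>Multilinearity and bilinearity as vanishing on relations\<close>

context
  fixes R :: "('a, 'm) ring_scheme" (structure) and M :: "('a, 'b, 'k) module_scheme"
  assumes M: "module R M"
begin

interpretation M: module R M by (fact M)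

lemma free_gen_tuples:
  "as \<in> tuples M i \<Longrightarrow> free_gen R as \<in> carrier (free_module R (tuples M i))"
  by (rule free_gen_carrier[OF M.is_cring])

lemma multilinear_relations_carrier:
  "multilinear_relations R M i \<subseteq> carrier (free_module R (tuples M i))"
proof -
  interpret F: module R "free_module R (tuples M i)"
    by (rule module_free_module) (rule M.is_cring)
  show ?thesis
    by (auto simp: multilinear_relations_def Let_def intro!: free_gen_tuples tuples_update)
qed

lemma exterior_relations_carrier:
  "exterior_relations R M i \<subseteq> carrier (free_module R (tuples M i))"
  using multilinear_relations_carrier by (auto simp: exterior_relations_def intro: free_gen_tuples)

lemma symmetric_relations_carrier:
  "symmetric_relations R M i \<subseteq> carrier (free_module R (tuples M i))"
proof -
  interpret F: module R "free_module R (tuples M i)"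
    by (rule module_free_module) (rule M.is_cring)
  show ?thesis
    using multilinear_relations_carrier by (auto simp: symmetric_relations_def intro!: free_gen_tuples)
qed

text \<open>Every relation is a formal difference, so killing it is one instance of additivity or
  homogeneity on generators. The equivalence is used in both directions. For \<phi> the class map,
  which kills relations, it shows that the canonical map on tuples is multilinear; for \<phi> a free
  evaluation, it shows that a multilinear map passes to the quotient. The analogues for exterior,
  symmetric and bilinear relations play the same double role.\<close>

lemma multilinear_relations_iff:
  assumes T: "module R T" and \<phi>: "linear_map R (free_module R (tuples M i)) T \<phi>"
  shows "(\<forall>r\<in>multilinear_relations R M i. \<phi> r = \<zero>\<^bsub>T\<^esub>) \<longleftrightarrow>
    multilinear_map R M i T (\<lambda>as. \<phi> (free_gen R as))"
proof -
  let ?F = "free_module R (tuples M i)"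
  interpret F: module R ?F by (rule module_free_module) (rule M.is_cring)
  interpret T: module R T by fact
  have d: "free_gen R (as[j := x]) \<in> carrier ?F" if "as \<in> tuples M i" "x \<in> carrier M" for as j x
    using that by (intro free_gen_tuples tuples_update)
  note m = linear_map_minus[OF F.module_axioms T \<phi>]
  have add: "\<phi> (free_gen R (as[j := x \<oplus>\<^bsub>M\<^esub> y]) \<ominus>\<^bsub>?F\<^esub>
        (free_gen R (as[j := x]) \<oplus>\<^bsub>?F\<^esub> free_gen R (as[j := y]))) = \<zero>\<^bsub>T\<^esub> \<longleftrightarrow>
      \<phi> (free_gen R (as[j := x \<oplus>\<^bsub>M\<^esub> y])) =
        \<phi> (free_gen R (as[j := x])) \<oplus>\<^bsub>T\<^esub> \<phi> (free_gen R (as[j := y]))"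
    if "as \<in> tuples M i" "x \<in> carrier M" "y \<in> carrier M" for as j x y
    using that d by (simp add: m linear_mapD[OF \<phi>] T.minus_eq_zero_iff)
  have smult: "\<phi> (free_gen R (as[j := c \<odot>\<^bsub>M\<^esub> x]) \<ominus>\<^bsub>?F\<^esub> c \<odot>\<^bsub>?F\<^esub> free_gen R (as[j := x])) = \<zero>\<^bsub>T\<^esub> \<longleftrightarrow>
      \<phi> (free_gen R (as[j := c \<odot>\<^bsub>M\<^esub> x])) = c \<odot>\<^bsub>T\<^esub> \<phi> (free_gen R (as[j := x]))"
    if "as \<in> tuples M i" "x \<in> carrier M" "c \<in> carrier R" for as j x c
    using that d by (simp add: m linear_mapD[OF \<phi>] T.minus_eq_zero_iff)
  have closed: "\<phi> (free_gen R as) \<in> carrier T" if "as \<in> tuples M i" for as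
    using that by (intro linear_mapD(1)[OF \<phi>] free_gen_tuples)
  \<comment> \<open>The set comprehensions are turned into quantifiers, one conjunct per family of
    relations, so that the two equivalences above can rewrite them.\<close>
  have "(\<forall>r\<in>multilinear_relations R M i. \<phi> r = \<zero>\<^bsub>T\<^esub>) \<longleftrightarrow>
      (\<forall>as j x y. as \<in> tuples M i \<and> j < i \<and> x \<in> carrier M \<and> y \<in> carrier M \<longrightarrow>
        \<phi> (free_gen R (as[j := x \<oplus>\<^bsub>M\<^esub> y]) \<ominus>\<^bsub>?F\<^esub>
          (free_gen R (as[j := x]) \<oplus>\<^bsub>?F\<^esub> free_gen R (as[j := y]))) = \<zero>\<^bsub>T\<^esub>) \<and>
      (\<forall>as j c x. as \<in> tuples M i \<and> j < i \<and> c \<in> carrier R \<and> x \<in> carrier M \<longrightarrow>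
        \<phi> (free_gen R (as[j := c \<odot>\<^bsub>M\<^esub> x]) \<ominus>\<^bsub>?F\<^esub> c \<odot>\<^bsub>?F\<^esub> free_gen R (as[j := x])) = \<zero>\<^bsub>T\<^esub>)"
    unfolding multilinear_relations_def Let_def ball_Un by (intro arg_cong2[of _ _ _ _ conj]) blast+
  also have "\<dots> \<longleftrightarrow> multilinear_map R M i T (\<lambda>as. \<phi> (free_gen R as))"
    using closed closed[OF tuples_update]
    by (auto simp: add smult multilinear_map_def linear_map_def)
  finally show ?thesis .
qed

lemma exterior_relations_iff:
  assumes T: "module R T" and \<phi>: "linear_map R (free_module R (tuples M i)) T \<phi>"
  shows "(\<forall>r\<in>exterior_relations R M i. \<phi> r = \<zero>\<^bsub>T\<^esub>) \<longleftrightarrow>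
    alternating_map R M i T (\<lambda>as. \<phi> (free_gen R as))"
  by (auto simp: exterior_relations_def alternating_map_def ball_Un
      simp flip: multilinear_relations_iff[OF T \<phi>])

lemma symmetric_relations_iff:
  assumes T: "module R T" and \<phi>: "linear_map R (free_module R (tuples M i)) T \<phi>"
  shows "(\<forall>r\<in>symmetric_relations R M i. \<phi> r = \<zero>\<^bsub>T\<^esub>) \<longleftrightarrow>
    multilinear_map R M i T (\<lambda>as. \<phi> (free_gen R as)) \<and>
    (\<forall>as\<in>tuples M i. \<forall>bs\<in>tuples M i. mset as = mset bs \<longrightarrow>
       \<phi> (free_gen R as) = \<phi> (free_gen R bs))"
proof -
  let ?F = "free_module R (tuples M i)"
  interpret F: module R ?F by (rule module_free_module) (rule M.is_cring)
  interpret T: module R T by fact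
  have "\<phi> (free_gen R as \<ominus>\<^bsub>?F\<^esub> free_gen R bs) = \<zero>\<^bsub>T\<^esub> \<longleftrightarrow> \<phi> (free_gen R as) = \<phi> (free_gen R bs)"
    if "as \<in> tuples M i" "bs \<in> tuples M i" for as bs
    using that[THEN free_gen_tuples] linear_mapD(1)[OF \<phi>]
    by (simp add: linear_map_minus[OF F.module_axioms T \<phi>] T.minus_eq_zero_iff)
  then show ?thesis
    unfolding multilinear_relations_iff[OF T \<phi>, symmetric] symmetric_relations_def by blast
qed

lemma bilinear_relations_carrier:
  assumes N: "module R N"
  shows "bilinear_relations R M N \<subseteq> carrier (free_module R (carrier M \<times> carrier N))"
proof -
  interpret N: module R N by fact
  interpret F: module R "free_module R (carrier M \<times> carrier N)"
    by (rule module_free_module) (rule M.is_cring)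
  show ?thesis
    by (auto simp: bilinear_relations_def Let_def intro!: free_gen_carrier[OF M.is_cring])
qed

lemma bilinear_relations_iff:
  assumes N: "module R N" and T: "module R T"
    and \<phi>: "linear_map R (free_module R (carrier M \<times> carrier N)) T \<phi>"
  shows "(\<forall>r\<in>bilinear_relations R M N. \<phi> r = \<zero>\<^bsub>T\<^esub>) \<longleftrightarrow>
    bilinear_map R M N T (\<lambda>z. \<phi> (free_gen R z))"
proof -
  let ?F = "free_module R (carrier M \<times> carrier N)"
  interpret F: module R ?F by (rule module_free_module) (rule M.is_cring)
  interpret N: module R N by fact
  interpret T: module R T by fact
  have d [simp]: "free_gen R (x, y) \<in> carrier ?F" if "x \<in> carrier M" "y \<in> carrier N" for x y
    using that by (intro free_gen_carrier[OF M.is_cring]) auto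
  have add: "\<phi> (a \<ominus>\<^bsub>?F\<^esub> (b \<oplus>\<^bsub>?F\<^esub> c)) = \<zero>\<^bsub>T\<^esub> \<longleftrightarrow> \<phi> a = \<phi> b \<oplus>\<^bsub>T\<^esub> \<phi> c"
    if "a \<in> carrier ?F" "b \<in> carrier ?F" "c \<in> carrier ?F" for a b c
    using that
    by (simp add: linear_map_minus[OF F.module_axioms T \<phi>] linear_mapD[OF \<phi>] T.minus_eq_zero_iff)
  have smult: "\<phi> (a \<ominus>\<^bsub>?F\<^esub> c \<odot>\<^bsub>?F\<^esub> b) = \<zero>\<^bsub>T\<^esub> \<longleftrightarrow> \<phi> a = c \<odot>\<^bsub>T\<^esub> \<phi> b"
    if "a \<in> carrier ?F" "b \<in> carrier ?F" "c \<in> carrier R" for a b c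
    using that
    by (simp add: linear_map_minus[OF F.module_axioms T \<phi>] linear_mapD[OF \<phi>] T.minus_eq_zero_iff)
  have closed: "\<phi> (free_gen R (x, y)) \<in> carrier T" if "x \<in> carrier M" "y \<in> carrier N" for x y
    using that by (intro linear_mapD(1)[OF \<phi>]) simp
  have "(\<forall>r\<in>bilinear_relations R M N. \<phi> r = \<zero>\<^bsub>T\<^esub>) \<longleftrightarrow>
      (((\<forall>x x' y. x \<in> carrier M \<and> x' \<in> carrier M \<and> y \<in> carrier N \<longrightarrow>
        \<phi> (free_gen R (x \<oplus>\<^bsub>M\<^esub> x', y) \<ominus>\<^bsub>?F\<^esub>
          (free_gen R (x, y) \<oplus>\<^bsub>?F\<^esub> free_gen R (x', y))) = \<zero>\<^bsub>T\<^esub>) \<and>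
      (\<forall>x y y'. x \<in> carrier M \<and> y \<in> carrier N \<and> y' \<in> carrier N \<longrightarrow>
        \<phi> (free_gen R (x, y \<oplus>\<^bsub>N\<^esub> y') \<ominus>\<^bsub>?F\<^esub>
          (free_gen R (x, y) \<oplus>\<^bsub>?F\<^esub> free_gen R (x, y'))) = \<zero>\<^bsub>T\<^esub>)) \<and>
      (\<forall>c x y. c \<in> carrier R \<and> x \<in> carrier M \<and> y \<in> carrier N \<longrightarrow>
        \<phi> (free_gen R (c \<odot>\<^bsub>M\<^esub> x, y) \<ominus>\<^bsub>?F\<^esub> c \<odot>\<^bsub>?F\<^esub> free_gen R (x, y)) = \<zero>\<^bsub>T\<^esub>)) \<and>
      (\<forall>c x y. c \<in> carrier R \<and> x \<in> carrier M \<and> y \<in> carrier N \<longrightarrow>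
        \<phi> (free_gen R (x, c \<odot>\<^bsub>N\<^esub> y) \<ominus>\<^bsub>?F\<^esub> c \<odot>\<^bsub>?F\<^esub> free_gen R (x, y)) = \<zero>\<^bsub>T\<^esub>)"
    unfolding bilinear_relations_def Let_def ball_Un
    by (intro arg_cong2[of _ _ _ _ conj]) blast+
  also have "\<dots> \<longleftrightarrow> bilinear_map R M N T (\<lambda>z. \<phi> (free_gen R z))"
    using closed by (auto simp: add smult bilinear_map_def linear_map_def)
  finally show ?thesis .
qed

lemma module_exterior_power: "module R (exterior_power R M i)"
  unfolding exterior_power_def
  by (rule module_presented_module[OF M.is_cring exterior_relations_carrier])

lemma module_symmetric_power: "module R (symmetric_power R M i)"
  unfolding symmetric_power_def
  by (rule module_presented_module[OF M.is_cring symmetric_relations_carrier])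

lemma module_tensor_product: "module R N \<Longrightarrow> module R (tensor_product R M N)"
  unfolding tensor_product_def
  by (rule module_presented_module[OF M.is_cring bilinear_relations_carrier])

lemma alternating_map_wedge: "alternating_map R M i (exterior_power R M i) (wedge R M)"
proof -
  note l = linear_map_presented_class[OF M.is_cring exterior_relations_carrier[of i]]
  have "alternating_map R M i (exterior_power R M i)
      (\<lambda>as. presented_class R (tuples M i) (exterior_relations R M i) (free_gen R as))"
    using presented_class_zero[OF M.is_cring exterior_relations_carrier[of i]]
    by (subst exterior_relations_iff[OF module_exterior_power, symmetric])
      (auto simp: exterior_power_def intro: l)
  then show ?thesis
    by (subst alternating_map_cong[OF M]) (auto simp: wedge_def presented_gen_eq_class tuples_def)
qed

lemma
  assumes T: "module R T" and A: "alternating_map R M i T A"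
  shows linear_map_exterior_extension:
      "linear_map R (exterior_power R M i) T (linear_extension R T A)"
    and exterior_extension_wedge:
      "as \<in> tuples M i \<Longrightarrow> linear_extension R T A (wedge R M as) = A as"
proof -
  have A_closed: "A \<in> tuples M i \<rightarrow> carrier T" using alternating_mapD(2)[OF A] by blast
  note \<phi> = linear_map_free_eval[OF T A_closed]
  have "alternating_map R M i T (\<lambda>as. free_eval R T A (free_gen R as))"
    using A free_eval_gen[OF T A_closed] by (subst alternating_map_cong[OF M]) auto
  then have rel: "free_eval R T A r = \<zero>\<^bsub>T\<^esub>" if "r \<in> exterior_relations R M i" for r
    using that by (simp flip: exterior_relations_iff[OF T \<phi>])
  show "linear_map R (exterior_power R M i) T (linear_extension R T A)"
    unfolding exterior_power_def
    by (rule linear_map_linear_extension[OF M.is_cring exterior_relations_carrier T A_closed rel])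
  show "linear_extension R T A (wedge R M as) = A as" if "as \<in> tuples M i"
    using linear_extension_presented_gen[OF M.is_cring exterior_relations_carrier T A_closed rel that]
      that by (simp add: wedge_def tuples_def)
qed

lemma exterior_linear_map_eqI:
  assumes T: "module R T"
    and f: "linear_map R (exterior_power R M i) T f" and g: "linear_map R (exterior_power R M i) T g"
    and eq: "\<And>as. as \<in> tuples M i \<Longrightarrow> f (wedge R M as) = g (wedge R M as)"
    and x: "\<omega> \<in> carrier (exterior_power R M i)"
  shows "f \<omega> = g \<omega>"
proof (rule presented_linear_map_eqI[OF M.is_cring exterior_relations_carrier T])
  show "f (presented_gen R (tuples M i) (exterior_relations R M i) as) =
      g (presented_gen R (tuples M i) (exterior_relations R M i) as)" if "as \<in> tuples M i" for as
    using eq[OF that] that by (simp add: wedge_def tuples_def)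
qed (use f g x in \<open>simp_all add: exterior_power_def\<close>)

lemma multilinear_map_sym_prod: "multilinear_map R M i (symmetric_power R M i) (sym_prod R M)"
  and sym_prod_mset: "as \<in> tuples M i \<Longrightarrow> bs \<in> tuples M i \<Longrightarrow> mset as = mset bs \<Longrightarrow>
    sym_prod R M as = sym_prod R M bs"
proof -
  note l = linear_map_presented_class[OF M.is_cring symmetric_relations_carrier[of i]]
  have eq: "sym_prod R M as = presented_class R (tuples M i) (symmetric_relations R M i) (free_gen R as)"
    if "as \<in> tuples M i" for as
    using that by (auto simp: sym_prod_def presented_gen_eq_class tuples_def)
  have *: "multilinear_map R M i (symmetric_power R M i)
      (\<lambda>as. presented_class R (tuples M i) (symmetric_relations R M i) (free_gen R as)) \<and>
      (\<forall>as\<in>tuples M i. \<forall>bs\<in>tuples M i. mset as = mset bs \<longrightarrow>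
        presented_class R (tuples M i) (symmetric_relations R M i) (free_gen R as) =
        presented_class R (tuples M i) (symmetric_relations R M i) (free_gen R bs))"
    using presented_class_zero[OF M.is_cring symmetric_relations_carrier[of i]]
    by (subst symmetric_relations_iff[OF module_symmetric_power, symmetric])
      (auto simp: symmetric_power_def intro: l)
  show "multilinear_map R M i (symmetric_power R M i) (sym_prod R M)"
    using conjunct1[OF *] by (subst multilinear_map_cong[OF M eq])
  show "sym_prod R M as = sym_prod R M bs"
    if "as \<in> tuples M i" "bs \<in> tuples M i" "mset as = mset bs"
    using conjunct2[OF *] that eq by metis
qed

lemma
  assumes T: "module R T" and A: "multilinear_map R M i T A"
    and sym: "\<And>as bs. as \<in> tuples M i \<Longrightarrow> bs \<in> tuples M i \<Longrightarrow> mset as = mset bs \<Longrightarrow> A as = A bs"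
  shows linear_map_symmetric_extension:
      "linear_map R (symmetric_power R M i) T (linear_extension R T A)"
    and symmetric_extension_sym_prod:
      "as \<in> tuples M i \<Longrightarrow> linear_extension R T A (sym_prod R M as) = A as"
proof -
  have A_closed: "A \<in> tuples M i \<rightarrow> carrier T" using multilinear_mapD(1)[OF A] by blast
  note \<phi> = linear_map_free_eval[OF T A_closed]
  have "multilinear_map R M i T (\<lambda>as. free_eval R T A (free_gen R as))"
    using A free_eval_gen[OF T A_closed] by (subst multilinear_map_cong[OF M]) auto
  moreover have "free_eval R T A (free_gen R as) = free_eval R T A (free_gen R bs)"
    if "as \<in> tuples M i" "bs \<in> tuples M i" "mset as = mset bs" for as bs
    using that sym[OF that] free_eval_gen[OF T A_closed] by simp
  ultimately have rel: "free_eval R T A r = \<zero>\<^bsub>T\<^esub>" if "r \<in> symmetric_relations R M i" for r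
    using that symmetric_relations_iff[OF T \<phi>] by blast
  show "linear_map R (symmetric_power R M i) T (linear_extension R T A)"
    unfolding symmetric_power_def
    by (rule linear_map_linear_extension[OF M.is_cring symmetric_relations_carrier T A_closed rel])
  show "linear_extension R T A (sym_prod R M as) = A as" if "as \<in> tuples M i"
    using linear_extension_presented_gen[OF M.is_cring symmetric_relations_carrier T A_closed rel that]
      that by (simp add: sym_prod_def tuples_def)
qed

lemma symmetric_linear_map_eqI:
  assumes T: "module R T"
    and f: "linear_map R (symmetric_power R M i) T f" and g: "linear_map R (symmetric_power R M i) T g"
    and eq: "\<And>as. as \<in> tuples M i \<Longrightarrow> f (sym_prod R M as) = g (sym_prod R M as)"
    and x: "\<alpha> \<in> carrier (symmetric_power R M i)"
  shows "f \<alpha> = g \<alpha>"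
proof (rule presented_linear_map_eqI[OF M.is_cring symmetric_relations_carrier T])
  show "f (presented_gen R (tuples M i) (symmetric_relations R M i) as) =
      g (presented_gen R (tuples M i) (symmetric_relations R M i) as)" if "as \<in> tuples M i" for as
    using eq[OF that] that by (simp add: sym_prod_def tuples_def)
qed (use f g x in \<open>simp_all add: symmetric_power_def\<close>)

lemma bilinear_map_tensor:
  assumes N: "module R N"
  shows "bilinear_map R M N (tensor_product R M N) (\<lambda>(x, y). tensor R M N x y)"
proof -
  note l = linear_map_presented_class[OF M.is_cring bilinear_relations_carrier[OF N]]
  have "bilinear_map R M N (tensor_product R M N)
      (\<lambda>z. presented_class R (carrier M \<times> carrier N) (bilinear_relations R M N) (free_gen R z))"
    using presented_class_zero[OF M.is_cring bilinear_relations_carrier[OF N]]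
    by (subst bilinear_relations_iff[OF N module_tensor_product[OF N], symmetric])
      (auto simp: tensor_product_def intro: l)
  then show ?thesis
    by (simp add: bilinear_map_def tensor_def presented_gen_eq_class)
qed

lemma bilinear_map_closed:
  "bilinear_map R M N T g \<Longrightarrow> g \<in> carrier M \<times> carrier N \<rightarrow> carrier T"
  by (auto simp: bilinear_map_def linear_map_def)

lemma
  assumes N: "module R N" and T: "module R T" and g: "bilinear_map R M N T g"
  shows linear_map_tensor_extension:
      "linear_map R (tensor_product R M N) T (linear_extension R T g)"
    and tensor_extension_tensor:
      "x \<in> carrier M \<Longrightarrow> y \<in> carrier N \<Longrightarrow>
        linear_extension R T g (tensor R M N x y) = g (x, y)"
proof -
  interpret N: module R N by fact
  note g_closed = bilinear_map_closed[OF g]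
  note \<phi> = linear_map_free_eval[OF T g_closed]
  have eq: "free_eval R T g (free_gen R (x, y)) = g (x, y)"
    if "x \<in> carrier M" "y \<in> carrier N" for x y
    using that by (intro free_eval_gen[OF T g_closed]) auto
  have "bilinear_map R M N T (\<lambda>z. free_eval R T g (free_gen R z))"
    unfolding bilinear_map_def
  proof (intro conjI ballI)
    show "linear_map R M T (\<lambda>x. free_eval R T g (free_gen R (x, y)))" if "y \<in> carrier N" for y
      using g that by (intro linear_map_cong[OF M eq]) (auto simp: bilinear_map_def)
    show "linear_map R N T (\<lambda>y. free_eval R T g (free_gen R (x, y)))" if "x \<in> carrier M" for x
      using g that by (intro linear_map_cong[OF N eq]) (auto simp: bilinear_map_def)
  qed
  then have rel: "free_eval R T g r = \<zero>\<^bsub>T\<^esub>" if "r \<in> bilinear_relations R M N" for r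
    using that bilinear_relations_iff[OF N T \<phi>] by blast
  show "linear_map R (tensor_product R M N) T (linear_extension R T g)"
    unfolding tensor_product_def
    by (rule linear_map_linear_extension[OF M.is_cring bilinear_relations_carrier[OF N] T g_closed rel])
  show "linear_extension R T g (tensor R M N x y) = g (x, y)" if "x \<in> carrier M" "y \<in> carrier N"
    unfolding tensor_def using that
    by (intro linear_extension_presented_gen[OF M.is_cring bilinear_relations_carrier[OF N] T g_closed rel])
      auto
qed

end

section \<open>Koszul sums\<close>

lemma length_omit: "j < length as \<Longrightarrow> length (omit j as) = length as - 1"
  by (simp add: omit_def)

lemma omit_append: "j = length P \<Longrightarrow> omit j (P @ x # S) = P @ S"
  by (simp add: omit_def)

lemma nth_omit:
  "j < length as \<Longrightarrow> m < length as - 1 \<Longrightarrow> omit j as ! m = as ! (if m < j then m else Suc m)"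
  by (auto simp: omit_def nth_append min_def)

lemma omit_tuples: "as \<in> tuples M i \<Longrightarrow> j < i \<Longrightarrow> omit j as \<in> tuples M (i - 1)"
  using set_take_subset[of j as] set_drop_subset[of "Suc j" as]
  by (auto simp: tuples_def length_omit) (auto simp: omit_def)

lemma omit_update_same: "omit j (as[j := x]) = omit j as"
  by (simp add: omit_def)

text \<open>Positions behind the deleted one move down by one, which is the case distinction on the
  right.\<close>

lemma omit_update:
  assumes "j < length as" "l \<noteq> j"
  shows "omit j (as[l := x]) = (omit j as)[(if l < j then l else l - 1) := x]"
proof (cases "l < j")
  case True
  then show ?thesis using assms by (simp add: omit_def take_update_swap list_update_append)
next
  case False
  then have "j < l" using assms by simp
  then have "l - 1 - j = l - Suc j" by simp
  then show ?thesis
    using assms \<open>j < l\<close> by (auto simp: omit_def drop_update_swap list_update_append min_def)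
qed

lemma not_distinct_omit:
  assumes "k < length as" "l < length as" "k \<noteq> l" "as ! k = as ! l" "j < length as" "j \<noteq> k" "j \<noteq> l"
  shows "\<not> distinct (omit j as)"
proof
  \<comment> \<open>\<open>f\<close> is the position that an entry other than the deleted one
    occupies afterwards; it keeps \<open>k\<close> and \<open>l\<close> apart.\<close>
  define f where "f m = (if m < j then m else m - 1)" for m
  assume "distinct (omit j as)"
  moreover have "f k < length (omit j as)" "f l < length (omit j as)" "f k \<noteq> f l"
    using assms by (auto simp: f_def length_omit)
  moreover have "omit j as ! f k = omit j as ! f l"
    using assms by (subst (1 2) nth_omit) (auto simp: f_def split: if_splits)
  ultimately show False by (simp add: nth_eq_iff_index_eq)
qed

lemma (in abelian_monoid) finsum_two:
  assumes "finite A" "k \<in> A" "l \<in> A" "k \<noteq> l" "f \<in> A \<rightarrow> carrier G"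
    and "\<And>j. j \<in> A \<Longrightarrow> j \<noteq> k \<Longrightarrow> j \<noteq> l \<Longrightarrow> f j = \<zero>"
  shows "(\<Oplus>j\<in>A. f j) = f k \<oplus> f l"
proof -
  have "(\<Oplus>j\<in>A. f j) = (\<Oplus>j\<in>{k, l}. f j)"
    using assms by (intro add.finprod_mono_neutral_cong_right) auto
  also have "\<dots> = f k \<oplus> f l"
    using assms(2-5) by (subst finsum_insert) (auto simp: Pi_iff)
  finally show ?thesis .
qed

lemma (in cring) alt_sign_closed: "alt_sign R j \<in> carrier R"
  by (simp add: alt_sign_def)

lemma (in cring) alt_sign_Suc: "alt_sign R (Suc j) = \<ominus> alt_sign R j"
  by (simp add: alt_sign_def r_minus)

lemma (in cring) alt_sign_add: "alt_sign R (i + j) = alt_sign R i \<otimes> alt_sign R j"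
  by (simp add: alt_sign_def nat_pow_mult)

text \<open>The pairing \<open>b x bs\<close> is left abstract: it will be \<open>f x\<close>
  tensored with a wedge in the two differentials, and a linear form times a minor in a Laplace
  expansion.\<close>

definition koszul_sum ::
    "('a, 'm) ring_scheme \<Rightarrow> ('a, 'c, 'l) module_scheme \<Rightarrow> nat \<Rightarrow> ('b \<Rightarrow> 'b list \<Rightarrow> 'c)
      \<Rightarrow> 'b list \<Rightarrow> 'c" where
  "koszul_sum R T i b as = (\<Oplus>\<^bsub>T\<^esub>j\<in>{..<i}. alt_sign R j \<odot>\<^bsub>T\<^esub> b (as ! j) (omit j as))"

section \<open>Alternating maps and Koszul sums\<close>

context
  fixes R :: "('a, 'm) ring_scheme" (structure) and M :: "('a, 'b, 'k) module_scheme"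
    and T :: "('a, 'c, 'l) module_scheme"
  assumes M: "module R M" and T: "module R T"
begin

interpretation M: module R M by (fact M)
interpretation T: module R T by (fact T)

text \<open>Polarisation: with x + y in both neighbouring slots the value is zero, and of the four
  terms of its expansion the two with equal entries vanish as well.\<close>

lemma alternating_map_swap:
  assumes A: "alternating_map R M i T A"
    and car: "set P \<subseteq> carrier M" "set S \<subseteq> carrier M" "x \<in> carrier M" "y \<in> carrier M"
    and len: "length P + Suc (Suc (length S)) = i"
  shows "A (P @ x # y # S) = \<ominus>\<^bsub>T\<^esub> A (P @ y # x # S)"
proof -
  note A' = alternating_mapD[OF A]
  have tup: "P @ u # v # S \<in> tuples M i" if "u \<in> carrier M" "v \<in> carrier M" for u v
    using that car len by (auto simp: tuples_def)
  note closed = A'(2)[OF tup]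
  have fst: "A (P @ (u \<oplus>\<^bsub>M\<^esub> u') # v # S) = A (P @ u # v # S) \<oplus>\<^bsub>T\<^esub> A (P @ u' # v # S)"
    if "u \<in> carrier M" "u' \<in> carrier M" "v \<in> carrier M" for u u' v
    using linear_mapD(2)[OF multilinear_map_slot[OF A'(1) M, of P "v # S"]] that car len by simp
  have snd: "A (P @ u # (v \<oplus>\<^bsub>M\<^esub> v') # S) = A (P @ u # v # S) \<oplus>\<^bsub>T\<^esub> A (P @ u # v' # S)"
    if "u \<in> carrier M" "v \<in> carrier M" "v' \<in> carrier M" for u v v'
    using linear_mapD(2)[OF multilinear_map_slot[OF A'(1) M, of "P @ [u]" S]] that car len by simp
  have zero: "A (P @ u # u # S) = \<zero>\<^bsub>T\<^esub>" if "u \<in> carrier M" for u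
    using A'(3)[OF tup[OF that that]] by simp
  have "\<zero>\<^bsub>T\<^esub> = A (P @ (x \<oplus>\<^bsub>M\<^esub> y) # (x \<oplus>\<^bsub>M\<^esub> y) # S)" using zero car by simp
  also have "\<dots> = A (P @ x # x # S) \<oplus>\<^bsub>T\<^esub> A (P @ y # x # S) \<oplus>\<^bsub>T\<^esub>
      (A (P @ x # y # S) \<oplus>\<^bsub>T\<^esub> A (P @ y # y # S))"
    using car by (simp add: fst snd)
  also have "\<dots> = A (P @ x # y # S) \<oplus>\<^bsub>T\<^esub> A (P @ y # x # S)"
    using car closed by (simp add: zero T.M.a_comm)
  finally show ?thesis using car closed by (simp add: T.M.minus_equality)
qed

text \<open>The entry \<open>a\<close> passes the members of \<open>Q\<close> one at a time, each
  transposition contributing a sign. The induction absorbs the head of \<open>Q\<close> into the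
  prefix, which is why \<open>P\<close> is generalised.\<close>

lemma alternating_map_move:
  assumes A: "alternating_map R M i T A"
    and "set P \<subseteq> carrier M" "set Q \<subseteq> carrier M" "set S \<subseteq> carrier M" "a \<in> carrier M"
    and "length P + length Q + Suc (length S) = i"
  shows "A (P @ Q @ a # S) = alt_sign R (length Q) \<odot>\<^bsub>T\<^esub> A (P @ a # Q @ S)"
  using assms(2-)
proof (induction Q arbitrary: P)
  case Nil
  then have "A (P @ a # S) \<in> carrier T"
    by (intro alternating_mapD(2)[OF A]) (auto simp: tuples_def)
  then show ?case by (simp add: alt_sign_def)
next
  case (Cons q Q)
  have closed: "A (P @ a # q # Q @ S) \<in> carrier T"
    using Cons.prems by (intro alternating_mapD(2)[OF A]) (auto simp: tuples_def)
  have "A (P @ q # Q @ a # S) = alt_sign R (length Q) \<odot>\<^bsub>T\<^esub> A (P @ q # a # Q @ S)"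
    using Cons.IH[of "P @ [q]"] Cons.prems by simp
  also have "A (P @ q # a # Q @ S) = \<ominus>\<^bsub>T\<^esub> A (P @ a # q # Q @ S)"
    using Cons.prems by (intro alternating_map_swap[OF A]) auto
  also have "alt_sign R (length Q) \<odot>\<^bsub>T\<^esub> \<dots> = alt_sign R (length (q # Q)) \<odot>\<^bsub>T\<^esub> A (P @ a # q # Q @ S)"
    using closed by (simp add: M.alt_sign_Suc M.alt_sign_closed T.smult_l_minus T.smult_r_minus)
  finally show ?case by simp
qed

context
  fixes b :: "'b \<Rightarrow> 'b list \<Rightarrow> 'c" and i :: nat
  assumes b1: "\<And>bs. bs \<in> tuples M (i - 1) \<Longrightarrow> linear_map R M T (\<lambda>x. b x bs)"
    and b2: "\<And>x. x \<in> carrier M \<Longrightarrow> alternating_map R M (i - 1) T (b x)"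
begin

lemma koszul_term_closed:
  assumes "as \<in> tuples M i" "j < i"
  shows "alt_sign R j \<odot>\<^bsub>T\<^esub> b (as ! j) (omit j as) \<in> carrier T"
  using assms
  by (intro T.smult_closed M.alt_sign_closed linear_mapD(1)[OF b1] omit_tuples)
    (auto simp: tuples_def)

text \<open>A given slot reaches its own summand through the first argument of \<open>b\<close> and
  every other summand through the shortened list, so both hypotheses on \<open>b\<close>
  enter.\<close>

lemma multilinear_map_koszul_sum: "multilinear_map R M i T (koszul_sum R T i b)"
  unfolding multilinear_map_def
proof (intro conjI ballI allI impI)
  show "koszul_sum R T i b as \<in> carrier T" if "as \<in> tuples M i" for as
    unfolding koszul_sum_def using that koszul_term_closed by (intro T.M.finsum_closed) auto
next
  fix as l assume as: "as \<in> tuples M i" and l: "l < i"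
  have len: "length as = i" using as by (simp add: tuples_def)
  have "linear_map R M T (\<lambda>x. b (as[l := x] ! j) (omit j (as[l := x])))" if j: "j < i" for j
  proof (cases "j = l")
    case True
    then show ?thesis using b1[OF omit_tuples[OF as l]] l len by (simp add: omit_update_same)
  next
    case False
    have "as ! j \<in> carrier M" using as j by (auto simp: tuples_def)
    then have "linear_map R M T (\<lambda>x. b (as ! j) ((omit j as)[(if l < j then l else l - 1) := x]))"
      using False l j
      by (intro multilinear_mapD(2)[OF alternating_mapD(1)[OF b2] omit_tuples[OF as j]]) auto
    then show ?thesis using False len j by (simp add: omit_update)
  qed
  then show "linear_map R M T (\<lambda>x. koszul_sum R T i b (as[l := x]))"
    unfolding koszul_sum_def
    by (intro linear_map_sum[OF M T] linear_map_scale[OF M T] M.alt_sign_closed) auto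
qed

text \<open>If \<open>a\<close> occurs at two positions, only the summands omitting one of them survive. Moving
  the remaining \<open>a\<close> from one position to the other shows that they cancel.\<close>

lemma alternating_map_koszul_sum: "alternating_map R M i T (koszul_sum R T i b)"
  unfolding alternating_map_def
proof (intro conjI ballI impI multilinear_map_koszul_sum)
  fix as assume as: "as \<in> tuples M i" and "\<not> distinct as"
  then obtain P Q S a where dec: "as = P @ a # Q @ a # S"
    using not_distinct_decomp[of as] by auto
  define k l where "k = length P" and "l = Suc (length P + length Q)"
  have i: "i = length P + Suc (length Q + Suc (length S))"
    using as by (simp add: dec tuples_def)
  have car: "set P \<subseteq> carrier M" "set Q \<subseteq> carrier M" "set S \<subseteq> carrier M" "a \<in> carrier M"
    using as by (auto simp: dec tuples_def)
  have nth: "as ! k = a" "as ! l = a"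
    by (simp_all add: dec k_def l_def nth_append)
  have om: "omit k as = P @ Q @ a # S" "omit l as = P @ a # Q @ S"
    using omit_append[of k P a "Q @ a # S"] omit_append[of l "P @ a # Q" a S]
    by (simp_all add: dec k_def l_def)
  have kl: "k < i" "l < i" "k \<noteq> l" using i by (simp_all add: k_def l_def)
  let ?A = "b a (P @ a # Q @ S)"
  have closed: "?A \<in> carrier T"
    using car i by (intro linear_mapD(1)[OF b1]) (auto simp: tuples_def)
  have "b (as ! j) (omit j as) = \<zero>\<^bsub>T\<^esub>" if "j < i" "j \<noteq> k" "j \<noteq> l" for j
  proof (rule alternating_mapD(3)[OF b2])
    show "as ! j \<in> carrier M" using as that by (auto simp: tuples_def)
    show "omit j as \<in> tuples M (i - 1)" using as that by (intro omit_tuples)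
    show "\<not> distinct (omit j as)"
      using as kl nth that by (intro not_distinct_omit[of k as l j]) (auto simp: tuples_def)
  qed
  then have "koszul_sum R T i b as =
      alt_sign R k \<odot>\<^bsub>T\<^esub> b (as ! k) (omit k as) \<oplus>\<^bsub>T\<^esub> alt_sign R l \<odot>\<^bsub>T\<^esub> b (as ! l) (omit l as)"
    unfolding koszul_sum_def using kl koszul_term_closed[OF as]
    by (intro T.M.finsum_two) (auto simp: M.alt_sign_closed)
  also have "\<dots> = alt_sign R k \<odot>\<^bsub>T\<^esub> (alt_sign R (length Q) \<odot>\<^bsub>T\<^esub> ?A) \<oplus>\<^bsub>T\<^esub> alt_sign R l \<odot>\<^bsub>T\<^esub> ?A"
    using alternating_map_move[OF b2[OF car(4)] car] i by (simp add: nth om)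
  \<comment> \<open>The positions differ by one more than the number of transpositions, so the two
    signs come out opposite.\<close>
  also have "alt_sign R l = \<ominus> (alt_sign R k \<otimes> alt_sign R (length Q))"
    by (simp add: l_def k_def M.alt_sign_Suc M.alt_sign_add)
  also have "alt_sign R k \<odot>\<^bsub>T\<^esub> (alt_sign R (length Q) \<odot>\<^bsub>T\<^esub> ?A) \<oplus>\<^bsub>T\<^esub>
      \<ominus> (alt_sign R k \<otimes> alt_sign R (length Q)) \<odot>\<^bsub>T\<^esub> ?A = \<zero>\<^bsub>T\<^esub>"
    using closed by (simp add: M.alt_sign_closed T.smult_l_minus T.smult_assoc1 T.M.r_neg)
  finally show "koszul_sum R T i b as = \<zero>\<^bsub>T\<^esub>" .
qed

end

text \<open>The exchange rule: a linear map applied to a relation with only two surviving terms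
  makes these negatives of each other.\<close>

lemma linear_map_two_terms:
  fixes x :: "'i \<Rightarrow> 'b"
  assumes f: "linear_map R M T f" and "finite A" and x: "x \<in> A \<rightarrow> carrier M"
    and sum: "(\<Oplus>\<^bsub>M\<^esub>l\<in>A. x l) = \<zero>\<^bsub>M\<^esub>" and "k \<in> A" "l \<in> A" "k \<noteq> l"
    and zero: "\<And>j. j \<in> A \<Longrightarrow> j \<noteq> k \<Longrightarrow> j \<noteq> l \<Longrightarrow> f (x j) = \<zero>\<^bsub>T\<^esub>"
  shows "f (x k) = \<ominus>\<^bsub>T\<^esub> f (x l)"
proof -
  have closed: "f (x j) \<in> carrier T" if "j \<in> A" for j
    using x linear_mapD(1)[OF f] that by blast
  have "\<zero>\<^bsub>T\<^esub> = (\<Oplus>\<^bsub>T\<^esub>j\<in>A. f (x j))"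
    using linear_map_finsum[OF M T f assms(2) x] sum linear_map_zero[OF M T f] by simp
  also have "\<dots> = f (x k) \<oplus>\<^bsub>T\<^esub> f (x l)"
    using assms closed by (intro T.M.finsum_two) auto
  finally show ?thesis using closed[OF assms(5)] closed[OF assms(6)] by (simp add: T.M.minus_equality)
qed

lemma smult_add_pow:
  fixes n :: nat
  assumes "u \<in> carrier T"
  shows "[n] \<cdot>\<^bsub>T\<^esub> u = ([n] \<cdot> \<one>) \<odot>\<^bsub>T\<^esub> u"
  using assms by (induction n) (simp_all add: T.smult_l_distr)

text \<open>Under the relation \<open>\<Sum>x\<^sub>l = 0\<close> the summands for \<open>j\<close> and \<open>j + 1\<close> agree: replace the entry
  \<open>x\<^sub>j\<^sub>+\<^sub>1\<close> by \<open>- x\<^sub>n\<close>, then the first factor \<open>x\<^sub>j\<close> by \<open>- x\<^sub>j\<^sub>+\<^sub>1\<close>, and finally \<open>x\<^sub>n\<close> by \<open>- x\<^sub>j\<close>. In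
  each step all other contributions have a repeated factor. Hence the sum is \<open>n\<close> times its
  first summand.\<close>

lemma koszul_sum_eq_zero:
  fixes x :: "nat \<Rightarrow> 'b"
  assumes b1: "\<And>bs. bs \<in> tuples M (n - 1) \<Longrightarrow> linear_map R M T (\<lambda>x. b x bs)"
    and b2: "\<And>x. x \<in> carrier M \<Longrightarrow> alternating_map R M (n - 1) T (b x)"
    and x: "\<And>l. l \<le> n \<Longrightarrow> x l \<in> carrier M"
    and sum: "(\<Oplus>\<^bsub>M\<^esub>l\<in>{..n}. x l) = \<zero>\<^bsub>M\<^esub>"
    and repeat: "\<And>l bs. l \<le> n \<Longrightarrow> bs \<in> tuples M (n - 1) \<Longrightarrow> x l \<in> set bs \<Longrightarrow> b (x l) bs = \<zero>\<^bsub>T\<^esub>"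
    and char: "[n] \<cdot> \<one> = \<zero>"
  shows "koszul_sum R T n b (map x [0..<n]) = \<zero>\<^bsub>T\<^esub>"
proof -
  let ?as = "map x [0..<n]"
  define c where "c j = alt_sign R j \<odot>\<^bsub>T\<^esub> b (?as ! j) (omit j ?as)" for j
  have as: "?as \<in> tuples M n" using x by (auto simp: tuples_def)
  have c_closed: "c j \<in> carrier T" if "j < n" for j
    unfolding c_def by (rule koszul_term_closed[OF b1 b2 as that])
  have step: "c (Suc j) = c j" if j: "Suc j < n" for j
  proof -
    define P S where "P = map x [0..<j]" and "S = map x [Suc (Suc j)..<n]"
    have split: "?as = P @ x j # x (Suc j) # S"
      using j upt_add_eq_append[of 0 j "n - j"] by (simp add: P_def S_def upt_conv_Cons)
    have om: "omit j ?as = P @ x (Suc j) # S" "omit (Suc j) ?as = P @ x j # S"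
      using omit_append[of j P "x j" "x (Suc j) # S"] omit_append[of "Suc j" "P @ [x j]" "x (Suc j)" S]
      by (simp_all add: split) (simp_all add: P_def)
    have PS: "set P \<subseteq> carrier M" "set S \<subseteq> carrier M" "length P + Suc (length S) = n - 1"
      using x j by (auto simp: P_def S_def)
    have tup: "P @ x l # S \<in> tuples M (n - 1)" if "l \<le> n" for l
      using PS x[OF that] by (auto simp: tuples_def)
    have mem: "x l \<in> set P \<union> set S" if "l \<le> n" "l \<noteq> j" "l \<noteq> Suc j" "l \<noteq> n" for l
      using that by (cases "l < j") (auto simp: P_def S_def)
    \<comment> \<open>The first factor is one of \<open>x j\<close>, \<open>x (Suc j)\<close>, and
      the exposed list entry is the other one. Of the remaining terms of the relation, the one that
      equals the first factor dies by \<open>repeat\<close>; every other one duplicates an entry of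
      \<open>P\<close> or \<open>S\<close> and dies because \<open>b (x k)\<close> is
      alternating.\<close>
    have slot: "b (x k) (P @ x l # S) = \<ominus>\<^bsub>T\<^esub> b (x k) (P @ x n # S)"
      if kl: "{k, l} = {j, Suc j}" for k l
    proof (rule linear_map_two_terms[OF multilinear_map_slot[OF alternating_mapD(1)[OF b2] M PS], of "x k" "{..n}" x l n])
      have k: "k \<le> n" "l \<le> n" "k \<noteq> l" "l \<noteq> n" using kl j by (auto simp: doubleton_eq_iff)
      then show "x k \<in> carrier M" "l \<in> {..n}" "l \<noteq> n" using x by auto
      fix m assume m: "m \<in> {..n}" "m \<noteq> l" "m \<noteq> n"
      show "b (x k) (P @ x m # S) = \<zero>\<^bsub>T\<^esub>"
      proof (cases "m = k")
        case True
        then show ?thesis using k by (intro repeat tup) auto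
      next
        case False
        then have "x m \<in> set P \<union> set S" using m kl by (intro mem) (auto simp: doubleton_eq_iff)
        then show ?thesis using m k x by (intro alternating_mapD(3)[OF b2] tup) auto
      qed
    qed (use x sum in auto)
    \<comment> \<open>With \<open>x n\<close> in the list, every term of the relation other than
      \<open>x j\<close> and \<open>x (Suc j)\<close> occurs there, so \<open>repeat\<close> alone
      removes them.\<close>
    have first: "b (x j) (P @ x n # S) = \<ominus>\<^bsub>T\<^esub> b (x (Suc j)) (P @ x n # S)"
    proof (rule linear_map_two_terms[OF b1[OF tup], of n "{..n}" x j "Suc j"])
      fix m assume m: "m \<in> {..n}" "m \<noteq> j" "m \<noteq> Suc j"
      then have "x m \<in> set (P @ x n # S)" using mem[of m] by (cases "m = n") auto
      then show "b (x m) (P @ x n # S) = \<zero>\<^bsub>T\<^esub>" using m by (intro repeat tup) auto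
    qed (use j x sum in auto)
    have closed: "b (x k) (P @ x l # S) \<in> carrier T" if "k \<le> n" "l \<le> n" for k l
      using x that by (intro linear_mapD(1)[OF b1] tup)
    \<comment> \<open>The three exchanges produce three signs, hence one minus in total, and it
      cancels against the change of \<open>alt_sign\<close> from \<open>j\<close> to
      \<open>Suc j\<close>.\<close>
    have "b (x (Suc j)) (P @ x j # S) = \<ominus>\<^bsub>T\<^esub> b (x (Suc j)) (P @ x n # S)"
      by (rule slot) auto
    also have "\<dots> = \<ominus>\<^bsub>T\<^esub> b (x j) (P @ x (Suc j) # S)"
      using first slot[of j "Suc j"] closed j by simp
    finally show ?thesis
      using j closed
      by (simp add: c_def om M.alt_sign_Suc M.alt_sign_closed T.smult_l_minus T.smult_r_minus)
  qed
  have const: "c j = c 0" if "j < n" for j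
    using that by (induction j) (auto simp: step)
  have "koszul_sum R T n b ?as = (\<Oplus>\<^bsub>T\<^esub>j\<in>{..<n}. c j)" by (simp add: koszul_sum_def c_def)
  also have "\<dots> = \<zero>\<^bsub>T\<^esub>"
  \<comment> \<open>For n = 0 there is no first summand to compare with, and \<open>c 0\<close> is
    not known to lie in \<open>T\<close>; the sum is simply empty.\<close>
  proof (cases "n = 0")
    case False
    have "(\<Oplus>\<^bsub>T\<^esub>j\<in>{..<n}. c j) = (\<Oplus>\<^bsub>T\<^esub>j\<in>{..<n}. c 0)"
    proof (rule T.M.finsum_cong')
      show "c j = c 0" if "j \<in> {..<n}" for j using const[of j] that by blast
    qed (use c_closed False in auto)
    also have "\<dots> = [n] \<cdot>\<^bsub>T\<^esub> c 0"
      using c_closed[of 0] False by (simp add: T.M.add.finprod_const)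
    finally show ?thesis using c_closed[of 0] False by (simp add: smult_add_pow char)
  qed simp
  finally show ?thesis .
qed

end

section \<open>The Koszul differentials\<close>

lemma multilinear_map_comp:
  "multilinear_map R M i N A \<Longrightarrow> linear_map R N T f \<Longrightarrow> multilinear_map R M i T (\<lambda>as. f (A as))"
  using linear_map_comp[of R M N _ T f] by (auto simp: multilinear_map_def linear_mapD(1))

lemma alternating_map_comp:
  assumes "module R N" "module R T" "alternating_map R M i N A" "linear_map R N T f"
  shows "alternating_map R M i T (\<lambda>as. f (A as))"
  using assms multilinear_map_comp[of R M i N A T f] linear_map_zero[OF assms(1,2,4)]
  by (auto simp: alternating_map_def)

text \<open>This freezes the relation vector as first argument of the determinant.\<close>

lemma alternating_map_Cons:
  assumes A: "alternating_map R M (Suc i) T A" and r: "r \<in> carrier M"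
  shows "alternating_map R M i T (\<lambda>as. A (r # as))"
proof -
  have tup: "r # as \<in> tuples M (Suc i)" if "as \<in> tuples M i" for as
    using that r by (auto simp: tuples_def)
  have "linear_map R M T (\<lambda>x. A (r # as[j := x]))" if "as \<in> tuples M i" "j < i" for as j
    using multilinear_mapD(2)[OF alternating_mapD(1)[OF A] tup, of as "Suc j"] that by simp
  then show ?thesis
    using alternating_mapD(2,3)[OF A tup] by (auto simp: alternating_map_def multilinear_map_def)
qed

section \<open>Differentials as linear extensions of Koszul sums\<close>

context
  fixes R :: "('a, 'm) ring_scheme" (structure) and M :: "('a, 'b, 'k) module_scheme"
  assumes M: "module R M"
begin

interpretation M: module R M by (fact M)

text \<open>Both sides of each linearity identity in \<alpha> are linear in \<omega>, so it suffices
  to compare them on wedges, where \<open>lin\<close> applies. This supplies the second half of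
  bilinearity for the nested extension in \<open>Kos_diff\<close>.\<close>

lemma linear_map_exterior_extension_param:
  assumes N: "module R N" and T: "module R T"
    and A: "\<And>\<alpha>. \<alpha> \<in> carrier N \<Longrightarrow> alternating_map R M i T (A \<alpha>)"
    and lin: "\<And>as. as \<in> tuples M i \<Longrightarrow> linear_map R N T (\<lambda>\<alpha>. A \<alpha> as)"
    and \<omega>: "\<omega> \<in> carrier (exterior_power R M i)"
  shows "linear_map R N T (\<lambda>\<alpha>. linear_extension R T (A \<alpha>) \<omega>)"
proof (rule linear_mapI)
  interpret N: module R N by fact
  note E = module_exterior_power[OF M, of i]
  note ext = linear_map_exterior_extension[OF M T A] and val = exterior_extension_wedge[OF M T A]
  fix \<alpha> assume \<alpha>: "\<alpha> \<in> carrier N"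
  show "linear_extension R T (A \<alpha>) \<omega> \<in> carrier T" using linear_mapD(1)[OF ext[OF \<alpha>] \<omega>] .
  show "linear_extension R T (A (\<alpha> \<oplus>\<^bsub>N\<^esub> \<beta>)) \<omega> =
      linear_extension R T (A \<alpha>) \<omega> \<oplus>\<^bsub>T\<^esub> linear_extension R T (A \<beta>) \<omega>" if \<beta>: "\<beta> \<in> carrier N" for \<beta>
    by (rule exterior_linear_map_eqI[OF M T ext linear_map_add[OF E T ext ext] _ \<omega>])
      (use \<alpha> \<beta> in \<open>simp_all add: val linear_mapD(2)[OF lin]\<close>)
  show "linear_extension R T (A (c \<odot>\<^bsub>N\<^esub> \<alpha>)) \<omega> = c \<odot>\<^bsub>T\<^esub> linear_extension R T (A \<alpha>) \<omega>"
    if c: "c \<in> carrier R" for c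
    by (rule exterior_linear_map_eqI[OF M T ext linear_map_scale[OF E T ext] _ \<omega>])
      (use \<alpha> c in \<open>simp_all add: val linear_mapD(3)[OF lin]\<close>)
qed

lemma linear_map_symmetric_extension_param:
  assumes N: "module R N" and T: "module R T"
    and A: "\<And>\<alpha>. \<alpha> \<in> carrier N \<Longrightarrow> multilinear_map R M i T (A \<alpha>)"
    and sym: "\<And>\<alpha> as bs. \<alpha> \<in> carrier N \<Longrightarrow> as \<in> tuples M i \<Longrightarrow> bs \<in> tuples M i \<Longrightarrow>
      mset as = mset bs \<Longrightarrow> A \<alpha> as = A \<alpha> bs"
    and lin: "\<And>as. as \<in> tuples M i \<Longrightarrow> linear_map R N T (\<lambda>\<alpha>. A \<alpha> as)"
    and \<omega>: "\<omega> \<in> carrier (symmetric_power R M i)"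
  shows "linear_map R N T (\<lambda>\<alpha>. linear_extension R T (A \<alpha>) \<omega>)"
proof (rule linear_mapI)
  interpret N: module R N by fact
  note S = module_symmetric_power[OF M, of i]
  note ext = linear_map_symmetric_extension[OF M T A sym]
    and val = symmetric_extension_sym_prod[OF M T A sym]
  fix \<alpha> assume \<alpha>: "\<alpha> \<in> carrier N"
  show "linear_extension R T (A \<alpha>) \<omega> \<in> carrier T" using linear_mapD(1)[OF ext[OF \<alpha> \<alpha>] \<omega>] .
  show "linear_extension R T (A (\<alpha> \<oplus>\<^bsub>N\<^esub> \<beta>)) \<omega> =
      linear_extension R T (A \<alpha>) \<omega> \<oplus>\<^bsub>T\<^esub> linear_extension R T (A \<beta>) \<omega>" if \<beta>: "\<beta> \<in> carrier N" for \<beta>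
    by (rule symmetric_linear_map_eqI[OF M T ext linear_map_add[OF S T ext ext] _ \<omega>])
      (use \<alpha> \<beta> in \<open>simp_all add: val linear_mapD(2)[OF lin]\<close>)
  show "linear_extension R T (A (c \<odot>\<^bsub>N\<^esub> \<alpha>)) \<omega> = c \<odot>\<^bsub>T\<^esub> linear_extension R T (A \<alpha>) \<omega>"
    if c: "c \<in> carrier R" for c
    by (rule symmetric_linear_map_eqI[OF M T ext linear_map_scale[OF S T ext] _ \<omega>])
      (use \<alpha> c in \<open>simp_all add: val linear_mapD(3)[OF lin]\<close>)
qed

text \<open>Appending a fixed last factor respects equality of multisets, so the product is well
  defined on symmetric powers; linearity in that factor follows from the parametrised
  extension.\<close>

lemma bilinear_map_sym_mult:
  "bilinear_map R (symmetric_power R M i) M (symmetric_power R M (Suc i))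
    (\<lambda>(\<alpha>, a). sym_mult R M i \<alpha> a)"
proof -
  let ?S = "symmetric_power R M (Suc i)"
  note S = module_symmetric_power[OF M, of "Suc i"]
  have tup: "as @ [a] \<in> tuples M (Suc i)" if "as \<in> tuples M i" "a \<in> carrier M" for as a
    using that by (auto simp: tuples_def)
  have lin: "linear_map R M ?S (\<lambda>a. sym_prod R M (as @ [a]))" if "as \<in> tuples M i" for as
    using multilinear_map_slot[OF multilinear_map_sym_prod[OF M, of "Suc i"] M, of as "[]"] that
    by (simp add: tuples_def)
  have mult: "multilinear_map R M i ?S (\<lambda>as. sym_prod R M (as @ [a]))" if a: "a \<in> carrier M" for a
    unfolding multilinear_map_def
  proof (intro conjI ballI allI impI)
    show "sym_prod R M (as @ [a]) \<in> carrier ?S" if "as \<in> tuples M i" for as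
      using multilinear_mapD(1)[OF multilinear_map_sym_prod[OF M] tup] that a .
    fix as j assume as: "as \<in> tuples M i" "j < i"
    then have "(as @ [a])[j := x] = as[j := x] @ [a]" for x
      by (simp add: tuples_def list_update_append)
    then show "linear_map R M ?S (\<lambda>x. sym_prod R M (as[j := x] @ [a]))"
      using multilinear_mapD(2)[OF multilinear_map_sym_prod[OF M] tup[OF as(1) a], of j] as(2)
      by simp
  qed
  have sym: "sym_prod R M (as @ [a]) = sym_prod R M (bs @ [a])"
    if "a \<in> carrier M" "as \<in> tuples M i" "bs \<in> tuples M i" "mset as = mset bs" for a as bs
    using sym_prod_mset[OF M tup[OF that(2,1)] tup[OF that(3,1)]] that(4) by simp
  show ?thesis
    unfolding bilinear_map_def sym_mult_def prod.case
    by (intro conjI ballI linear_map_symmetric_extension[OF M S mult sym]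
      linear_map_symmetric_extension_param[OF M S mult sym lin])
qed

text \<open>Both differentials of interest are Koszul sums of \<open>f x \<otimes> (a\<^sub>1 \<and> \<dots> \<and> a\<^sub>i)\<close> for a linear map \<open>f\<close>:
  the identity, or multiplication by a fixed element of a symmetric power.\<close>

lemma
  assumes N: "module R N" and f: "linear_map R M N f"
  shows linear_map_tensor_wedge: "bs \<in> tuples M i \<Longrightarrow>
      linear_map R M (tensor_product R N (exterior_power R M i))
        (\<lambda>x. tensor R N (exterior_power R M i) (f x) (wedge R M bs))"
    and alternating_map_tensor_wedge: "x \<in> carrier M \<Longrightarrow>
      alternating_map R M i (tensor_product R N (exterior_power R M i))
        (\<lambda>bs. tensor R N (exterior_power R M i) (f x) (wedge R M bs))"
proof -
  let ?E = "exterior_power R M i"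
  note E = module_exterior_power[OF M, of i] and w = alternating_map_wedge[OF M, of i]
  note t = bilinear_map_tensor[OF N E]
  show "linear_map R M (tensor_product R N ?E) (\<lambda>x. tensor R N ?E (f x) (wedge R M bs))"
    if "bs \<in> tuples M i"
    using t alternating_mapD(2)[OF w that]
    by (intro linear_map_comp[OF f]) (auto simp: bilinear_map_def)
  show "alternating_map R M i (tensor_product R N ?E) (\<lambda>bs. tensor R N ?E (f x) (wedge R M bs))"
    if "x \<in> carrier M"
    using t linear_mapD(1)[OF f that]
    by (intro alternating_map_comp[OF E module_tensor_product[OF N E] w]) (auto simp: bilinear_map_def)
qed

text \<open>By definition the differential is the linear extension of a Koszul sum; that it takes
  the prescribed values on wedges depends on this sum being alternating.\<close>

lemma
  fixes i :: nat
  defines "T \<equiv> tensor_product R M (exterior_power R M (i - 1))"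
  shows linear_map_exterior_diff:
      "linear_map R (exterior_power R M i) T (exterior_diff R M i)"
    and exterior_diff_wedge: "as \<in> tuples M i \<Longrightarrow> exterior_diff R M i (wedge R M as) =
      koszul_sum R T i (\<lambda>x bs. tensor R M (exterior_power R M (i - 1)) x (wedge R M bs)) as"
proof -
  let ?b = "\<lambda>x bs. tensor R M (exterior_power R M (i - 1)) x (wedge R M bs)"
  have T: "module R T"
    unfolding T_def by (rule module_tensor_product[OF M module_exterior_power[OF M]])
  have alt: "alternating_map R M i T (koszul_sum R T i ?b)"
    using alternating_map_koszul_sum[OF M T, of i ?b]
      linear_map_tensor_wedge[OF M linear_map_id] alternating_map_tensor_wedge[OF M linear_map_id]
    by (simp add: T_def)
  have "exterior_diff R M i = linear_extension R T (koszul_sum R T i ?b)"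
    by (simp add: exterior_diff_def T_def Let_def koszul_sum_def[abs_def])
  then show "linear_map R (exterior_power R M i) T (exterior_diff R M i)"
    and "as \<in> tuples M i \<Longrightarrow> exterior_diff R M i (wedge R M as) = koszul_sum R T i ?b as"
    using linear_map_exterior_extension[OF M T alt] exterior_extension_wedge[OF M T alt] by simp_all
qed

lemma module_Kos: "module R (Kos R M n i)"
  unfolding Kos_def
  by (rule module_tensor_product[OF module_symmetric_power[OF M] module_exterior_power[OF M]])

text \<open>The definition nests two extensions. The inner one is legitimate because its Koszul sum
  is alternating for each fixed \<alpha>, the outer one because the result is bilinear in \<alpha>
  and \<omega>.\<close>

lemma Kos_diff_tensor_wedge:
  assumes i: "0 < i" "i \<le> n"
    and \<alpha>: "\<alpha> \<in> carrier (symmetric_power R M (n - i))" and as: "as \<in> tuples M i"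
  shows "Kos_diff R M n i (tensor R (symmetric_power R M (n - i)) (exterior_power R M i) \<alpha> (wedge R M as)) =
    koszul_sum R (Kos R M n (i - 1)) i
      (\<lambda>x bs. tensor R (symmetric_power R M (n - (i - 1))) (exterior_power R M (i - 1))
        (sym_mult R M (n - i) \<alpha> x) (wedge R M bs)) as"
proof -
  let ?S = "symmetric_power R M (n - i)" and ?S' = "symmetric_power R M (n - (i - 1))"
  let ?E = "exterior_power R M i" and ?E' = "exterior_power R M (i - 1)"
  let ?T = "Kos R M n (i - 1)"
  define b where "b = (\<lambda>\<alpha> x bs. tensor R ?S' ?E' (sym_mult R M (n - i) \<alpha> x) (wedge R M bs))"
  define A where "A \<alpha> = koszul_sum R ?T i (b \<alpha>)" for \<alpha>
  note S = module_symmetric_power[OF M, of "n - i"] and S' = module_symmetric_power[OF M, of "n - (i - 1)"]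
  note E = module_exterior_power[OF M, of i] and E' = module_exterior_power[OF M, of "i - 1"]
  note T = module_Kos[of n "i - 1"]
  \<comment> \<open>Subtraction is truncated, so the range of \<open>i\<close> is needed to match
    the target degree of \<open>sym_mult\<close> with the symmetric degree in
    \<open>Kos R M n (i - 1)\<close>.\<close>
  have Suc: "Suc (n - i) = n - (i - 1)" using i by simp
  have sm: "linear_map R ?S ?S' (\<lambda>\<alpha>. sym_mult R M (n - i) \<alpha> x)" if "x \<in> carrier M" for x
    using bilinear_map_sym_mult[of "n - i"] that unfolding Suc by (auto simp: bilinear_map_def)
  have sm': "linear_map R M ?S' (\<lambda>x. sym_mult R M (n - i) \<alpha> x)" if "\<alpha> \<in> carrier ?S" for \<alpha>
    using bilinear_map_sym_mult[of "n - i"] that unfolding Suc by (auto simp: bilinear_map_def)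
  have alt: "alternating_map R M i ?T (A \<alpha>)" if "\<alpha> \<in> carrier ?S" for \<alpha>
    using alternating_map_koszul_sum[OF M T, of i "b \<alpha>"]
      linear_map_tensor_wedge[OF S' sm'[OF that]] alternating_map_tensor_wedge[OF S' sm'[OF that]]
    by (simp add: A_def b_def Kos_def)
  have lin: "linear_map R ?S ?T (\<lambda>\<alpha>. A \<alpha> bs)" if bs: "bs \<in> tuples M i" for bs
  proof -
    have "linear_map R ?S ?T (\<lambda>\<alpha>. b \<alpha> (bs ! j) (omit j bs))" if "j < i" for j
    proof -
      have "bs ! j \<in> carrier M" using bs that by (auto simp: tuples_def)
      moreover have "wedge R M (omit j bs) \<in> carrier ?E'"
        using alternating_mapD(2)[OF alternating_map_wedge[OF M] omit_tuples[OF bs that]] .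
      ultimately show ?thesis
        unfolding b_def Kos_def using bilinear_map_tensor[OF S' E']
        by (intro linear_map_comp[OF sm]) (auto simp: bilinear_map_def)
    qed
    then show ?thesis
      unfolding A_def koszul_sum_def
      by (intro linear_map_sum[OF S T] linear_map_scale[OF S T] M.alt_sign_closed) auto
  qed
  have bil: "bilinear_map R ?S ?E ?T (\<lambda>(\<alpha>, \<omega>). linear_extension R ?T (A \<alpha>) \<omega>)"
    unfolding bilinear_map_def prod.case
    by (intro conjI ballI linear_map_exterior_extension[OF M T alt]
      linear_map_exterior_extension_param[OF S T alt lin])
  have "Kos_diff R M n i = linear_extension R ?T (\<lambda>(\<alpha>, \<omega>). linear_extension R ?T (A \<alpha>) \<omega>)"
    by (simp add: Kos_diff_def A_def b_def Let_def koszul_sum_def[abs_def])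
  moreover have "wedge R M as \<in> carrier ?E"
    using alternating_mapD(2)[OF alternating_map_wedge[OF M] as] .
  ultimately have "Kos_diff R M n i (tensor R ?S ?E \<alpha> (wedge R M as)) =
      linear_extension R ?T (A \<alpha>) (wedge R M as)"
    using tensor_extension_tensor[OF S E T bil \<alpha>] by simp
  also have "\<dots> = A \<alpha> as" by (rule exterior_extension_wedge[OF M T alt[OF \<alpha>] as])
  finally show ?thesis by (simp add: A_def b_def)
qed

end

section \<open>A determinant and the non-vanishing of a wedge product\<close>

definition regular_module :: "('a, 'm) ring_scheme \<Rightarrow> ('a, 'a) module" where
  "regular_module R =
    \<lparr>carrier = carrier R, monoid.mult = monoid.mult R, one = one R, zero = zero R, add = add R,
     module.smult = monoid.mult R\<rparr>"

lemma regular_module_simps [simp]: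
  "carrier (regular_module R) = carrier R"
  "\<zero>\<^bsub>regular_module R\<^esub> = \<zero>\<^bsub>R\<^esub>"
  "x \<oplus>\<^bsub>regular_module R\<^esub> y = x \<oplus>\<^bsub>R\<^esub> y"
  "x \<odot>\<^bsub>regular_module R\<^esub> y = x \<otimes>\<^bsub>R\<^esub> y"
  by (simp_all add: regular_module_def)

lemma module_regular_module:
  assumes "cring R"
  shows "module R (regular_module R)"
proof -
  interpret cring R by fact
  show ?thesis
  proof (rule moduleI)
    show "abelian_group (regular_module R)"
      by (rule abelian_groupI) (auto simp: a_ac intro: bexI[of _ "\<ominus>\<^bsub>R\<^esub> x" for x])
  qed (auto simp: cring_simprules intro: assms)
qed

lemma linear_map_coordinate:
  assumes "cring R"
  shows "linear_map R (free_module R B) (regular_module R) (\<lambda>f. f i)"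
proof (rule linear_mapI)
  interpret cring R by fact
  show "f i \<in> carrier (regular_module R)" if "f \<in> carrier (free_module R B)" for f
    using that by (cases "i \<in> B") (auto simp: free_module_def)
qed (auto simp: free_module_def)

text \<open>Laplace expansion along a list of linear forms, so that being alternating is an instance of
  the corresponding property of Koszul sums.\<close>

primrec coord_det :: "('a, 'm) ring_scheme \<Rightarrow> ('b \<Rightarrow> 'a) list \<Rightarrow> 'b list \<Rightarrow> 'a" where
  "coord_det R [] = (\<lambda>_. \<one>\<^bsub>R\<^esub>)"
| "coord_det R (l # ls) =
    koszul_sum R (regular_module R) (Suc (length ls)) (\<lambda>x bs. l x \<otimes>\<^bsub>R\<^esub> coord_det R ls bs)"

context
  fixes R :: "('a, 'm) ring_scheme" (structure) and M :: "('a, 'b, 'k) module_scheme"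
  assumes M: "module R M"
begin

interpretation M: module R M by (fact M)

lemma linear_map_mult_right:
  assumes "linear_map R N (regular_module R) f" "c \<in> carrier R"
  shows "linear_map R N (regular_module R) (\<lambda>x. f x \<otimes> c)"
  using assms by (auto simp: linear_map_def M.l_distr M.m_assoc Pi_iff)

lemma alternating_map_coord_det:
  assumes "\<And>l. l \<in> set ls \<Longrightarrow> linear_map R M (regular_module R) l"
  shows "alternating_map R M (length ls) (regular_module R) (coord_det R ls)"
  using assms
proof (induction ls)
  case Nil
  then show ?case by (auto simp: alternating_map_def multilinear_map_def tuples_def)
next
  case (Cons l ls)
  note T = module_regular_module[OF M.is_cring]
  have l: "linear_map R M (regular_module R) l" using Cons.prems by simp
  have IH: "alternating_map R M (length ls) (regular_module R) (coord_det R ls)"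
    using Cons by simp
  have "linear_map R M (regular_module R) (\<lambda>x. l x \<otimes> coord_det R ls bs)"
    if "bs \<in> tuples M (length ls)" for bs
    using alternating_mapD(2)[OF IH that] by (intro linear_map_mult_right[OF l]) simp
  moreover have "alternating_map R M (length ls) (regular_module R) (\<lambda>bs. l x \<otimes> coord_det R ls bs)"
    if "x \<in> carrier M" for x
    using linear_map_scale[OF T T linear_map_id, of "l x"] linear_mapD(1)[OF l that]
    by (intro alternating_map_comp[OF T T IH]) simp
  ultimately show ?case
    using alternating_map_koszul_sum[OF M T, of "Suc (length ls)" "\<lambda>x bs. l x \<otimes> coord_det R ls bs"]
    by simp
qed

text \<open>Since the first form vanishes on every argument but the first, the Laplace expansion
  reduces to its summand for j = 0, whose sign is positive.\<close>

lemma coord_det_Cons: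
  assumes lin: "\<And>h. h \<in> set (l # ls) \<Longrightarrow> linear_map R M (regular_module R) h"
    and as: "x # as \<in> tuples M (Suc (length ls))"
    and zero: "\<And>y. y \<in> set as \<Longrightarrow> l y = \<zero>"
  shows "coord_det R (l # ls) (x # as) = l x \<otimes> coord_det R ls as"
proof -
  interpret T: module R "regular_module R" by (rule module_regular_module[OF M.is_cring])
  have closed: "coord_det R ls bs \<in> carrier R" if "bs \<in> tuples M (length ls)" for bs
    using alternating_mapD(2)[OF alternating_map_coord_det that] lin by simp
  define f where "f j = alt_sign R j \<odot>\<^bsub>regular_module R\<^esub>
    (l ((x # as) ! j) \<otimes> coord_det R ls (omit j (x # as)))" for j
  have "l x \<in> carrier R" using lin[of l] linear_mapD(1)[of R M "regular_module R" l x] as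
    by (simp add: tuples_def)
  moreover have "coord_det R ls as \<in> carrier R" using as by (intro closed) (simp add: tuples_def)
  ultimately have f0: "f 0 = l x \<otimes> coord_det R ls as" "f 0 \<in> carrier R"
    by (simp_all add: f_def alt_sign_def omit_def)
  have f: "f j = \<zero>" if "j < Suc (length ls)" "j \<noteq> 0" for j
  proof -
    have "l ((x # as) ! j) = \<zero>" using that as by (intro zero) (auto simp: tuples_def nth_Cons')
    moreover have "coord_det R ls (omit j (x # as)) \<in> carrier R"
      using omit_tuples[OF as that(1)] by (intro closed) simp
    ultimately show ?thesis by (simp add: f_def M.alt_sign_closed)
  qed
  have f_closed: "f j \<in> carrier R" if "j < Suc (length ls)" for j
    using f[OF that] f0(2) by (cases "j = 0") auto
  have "coord_det R (l # ls) (x # as) = (\<Oplus>\<^bsub>regular_module R\<^esub>j\<in>{..<Suc (length ls)}. f j)"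
    by (simp add: koszul_sum_def f_def)
  also have "\<dots> = (\<Oplus>\<^bsub>regular_module R\<^esub>j\<in>{0::nat}. f j)"
    using f f_closed by (intro T.M.add.finprod_mono_neutral_cong_right) auto
  also have "\<dots> = f 0" using f0 T.M.finsum_insert[of "{}" 0 f] by simp
  finally show ?thesis using f0 by simp
qed

lemma coord_det_diagonal:
  assumes "distinct L" and l: "\<And>i. i \<in> set L \<Longrightarrow> linear_map R M (regular_module R) (l i)"
    and x: "\<And>i. i \<in> set L \<Longrightarrow> x i \<in> carrier M"
    and zero: "\<And>i j. i \<in> set L \<Longrightarrow> j \<in> set L \<Longrightarrow> i \<noteq> j \<Longrightarrow> l i (x j) = \<zero>"
  shows "coord_det R (map l L) (map x L) = foldr (\<lambda>i s. l i (x i) \<otimes> s) L \<one>"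
  using assms
proof (induction L)
  case (Cons i L)
  have IH: "coord_det R (map l L) (map x L) = foldr (\<lambda>i s. l i (x i) \<otimes> s) L \<one>"
    using Cons.prems by (intro Cons.IH) auto
  have "coord_det R (l i # map l L) (x i # map x L) = l i (x i) \<otimes> coord_det R (map l L) (map x L)"
  proof (rule coord_det_Cons)
    show "x i # map x L \<in> tuples M (Suc (length (map l L)))"
      using Cons.prems(3) by (auto simp: tuples_def)
    show "l i y = \<zero>" if "y \<in> set (map x L)" for y
      using that Cons.prems(1,4) by auto
  qed (use Cons.prems(2) in auto)
  then show ?case using IH by simp
qed simp

end

section \<open>Descent of alternating maps and the determinant form\<close>

text \<open>The map on the presented module evaluates the given one on arbitrary lifts: changing a lift
  alters an entry by a combination of relations only.\<close>

lemma alternating_map_presented_module: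
  fixes R :: "('a, 'm) ring_scheme" (structure) and B :: "'b set"
  assumes T: "module R T" and G: "G \<subseteq> carrier (free_module R B)"
    and A: "alternating_map R (free_module R B) i T A"
    and rel: "\<And>r fs j. r \<in> G \<Longrightarrow> fs \<in> tuples (free_module R B) i \<Longrightarrow> j < i \<Longrightarrow> A (fs[j := r]) = \<zero>\<^bsub>T\<^esub>"
  obtains A' where "alternating_map R (presented_module R B G) i T A'"
    and "\<And>fs. fs \<in> tuples (free_module R B) i \<Longrightarrow> A' (map (presented_class R B G) fs) = A fs"
proof -
  let ?F = "free_module R B" and ?P = "presented_module R B G" and ?c = "presented_class R B G"
  interpret T: module R T by fact
  interpret F: module R ?F by (rule module_free_module) (rule T.is_cring)
  interpret P: module R ?P by (rule module_presented_module[OF T.is_cring G])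
  note c = linear_map_presented_class[OF T.is_cring G]
  \<comment> \<open>An arbitrary choice of lifts, with no linearity; \<open>indep\<close> shows that
    values do not depend on it.\<close>
  define rep where "rep u = (SOME f. f \<in> carrier ?F \<and> ?c f = u)" for u
  have rep: "rep u \<in> carrier ?F \<and> ?c (rep u) = u" if u: "u \<in> carrier ?P" for u
  proof -
    obtain f where "f \<in> carrier ?F \<and> ?c f = u"
      using u carrier_presented_module[OF T.is_cring G] by auto
    then show ?thesis unfolding rep_def
      by (rule someI[where P = "\<lambda>f. f \<in> carrier ?F \<and> ?c f = u"])
  qed
  have indep: "A (fs[j := f]) = A (fs[j := f'])"
    if fs: "fs \<in> tuples ?F i" "j < i" and f: "f \<in> carrier ?F" "f' \<in> carrier ?F" "?c f = ?c f'"
    for fs j f f'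
  proof -
    note lin = multilinear_mapD(2)[OF alternating_mapD(1)[OF A] fs]
    \<comment> \<open>The vectors that give zero in slot \<open>j\<close> form a submodule
      containing the relations, hence containing everything they generate.\<close>
    have "generated_submodule R ?F G \<subseteq> {h \<in> carrier ?F. A (fs[j := h]) = \<zero>\<^bsub>T\<^esub>}"
      using submodule_kernel[OF F.module_axioms T lin] rel[OF _ fs] G
      unfolding generated_submodule_def by blast
    moreover have "f \<ominus>\<^bsub>?F\<^esub> f' \<in> generated_submodule R ?F G"
      using f by (simp flip: presented_class_eq_iff[OF T.is_cring G])
    ultimately have "A (fs[j := f]) \<ominus>\<^bsub>T\<^esub> A (fs[j := f']) = \<zero>\<^bsub>T\<^esub>"
      using linear_map_minus[OF F.module_axioms T lin f(1,2)] by auto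
    then show ?thesis using linear_mapD(1)[OF lin] f by (simp add: T.minus_eq_zero_iff)
  qed
  have rep_tup: "map rep us \<in> tuples ?F i" if "us \<in> tuples ?P i" for us
    using that rep by (auto simp: tuples_def)
  have "linear_map R ?P T (\<lambda>u. A (map rep (us[j := u])))" if us: "us \<in> tuples ?P i" "j < i" for us j
  proof -
    note fs = rep_tup[OF us(1)] us(2)
    note lin = linear_mapD[OF multilinear_mapD(2)[OF alternating_mapD(1)[OF A] fs]]
    show ?thesis
      unfolding map_update
    proof (rule linear_mapI)
      fix u assume u: "u \<in> carrier ?P"
      show "A ((map rep us)[j := rep u]) \<in> carrier T" using lin(1) rep[OF u] by blast
      show "A ((map rep us)[j := rep (u \<oplus>\<^bsub>?P\<^esub> v)]) =
          A ((map rep us)[j := rep u]) \<oplus>\<^bsub>T\<^esub> A ((map rep us)[j := rep v])"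
        if v: "v \<in> carrier ?P" for v
        using rep[OF u] rep[OF v] rep[OF P.M.a_closed[OF u v]] linear_mapD(2)[OF c]
        by (simp add: indep[OF fs, of "rep (u \<oplus>\<^bsub>?P\<^esub> v)" "rep u \<oplus>\<^bsub>?F\<^esub> rep v"] lin(2))
      show "A ((map rep us)[j := rep (d \<odot>\<^bsub>?P\<^esub> u)]) = d \<odot>\<^bsub>T\<^esub> A ((map rep us)[j := rep u])"
        if d: "d \<in> carrier R" for d
        using rep[OF u] rep[OF P.smult_closed[OF d u]] linear_mapD(3)[OF c d] d
        by (simp add: indep[OF fs, of "rep (d \<odot>\<^bsub>?P\<^esub> u)" "d \<odot>\<^bsub>?F\<^esub> rep u"] lin(3))
    qed
  qed
  \<comment> \<open>Equal entries have equal lifts, so a repetition in \<open>us\<close> persists in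
    \<open>map rep us\<close>.\<close>
  then have "alternating_map R ?P i T (\<lambda>us. A (map rep us))"
    using alternating_mapD(2,3)[OF A rep_tup]
    by (auto simp: alternating_map_def multilinear_map_def distinct_map)
  \<comment> \<open>The chosen lifts are replaced by the original vectors from left to right;
    \<open>P\<close> is the part already restored.\<close>
  moreover have "A (P @ map rep (map ?c Q)) = A (P @ Q)" if "P @ Q \<in> tuples ?F i" for P Q
    using that
  proof (induction Q arbitrary: P)
    case (Cons q Q)
    have q: "q \<in> carrier ?F" using Cons.prems by (simp add: tuples_def)
    then have rq: "rep (?c q) \<in> carrier ?F" "?c (rep (?c q)) = ?c q"
      using rep linear_mapD(1)[OF c] by auto
    have "set (map rep (map ?c Q)) \<subseteq> carrier ?F"
      using Cons.prems rep linear_mapD(1)[OF c] by (auto simp: tuples_def)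
    then have "P @ q # map rep (map ?c Q) \<in> tuples ?F i" "length P < i"
      using Cons.prems by (auto simp: tuples_def)
    from indep[OF this rq(1) q rq(2)]
    have "A (P @ map rep (map ?c (q # Q))) = A ((P @ [q]) @ map rep (map ?c Q))" by simp
    also have "\<dots> = A (P @ q # Q)" using Cons.IH[of "P @ [q]"] Cons.prems by simp
    finally show ?case .
  qed simp
  from this[of "[]"] have "A (map rep (map ?c fs)) = A fs" if "fs \<in> tuples ?F i" for fs
    using that by simp
  ultimately show thesis by (rule that)
qed

text \<open>The form is \<open>a\<^sub>1 \<and> \<dots> \<and> a\<^sub>n \<mapsto> det (r, a\<^sub>1, \<dots>, a\<^sub>n)\<close>, which does not change when multiples of
  \<open>r\<close> are added to the \<open>a\<^sub>i\<close>.\<close>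

lemma exterior_form_relation:
  fixes R :: "('a, 'm) ring_scheme" (structure) and t :: "nat \<Rightarrow> 'a" and n :: nat
  defines "F \<equiv> free_module R {1..n + 1}"
  defines "r \<equiv> (\<Oplus>\<^bsub>F\<^esub>i\<in>{1..n + 1}. t i \<odot>\<^bsub>F\<^esub> free_gen R i)"
  defines "M \<equiv> presented_module R {1..n + 1} {r}"
  assumes R: "cring R" and t: "\<And>i. i \<in> {1..n + 1} \<Longrightarrow> t i \<in> carrier R"
  obtains A where "alternating_map R M n (regular_module R) A"
    and "A (map (\<lambda>i. t i \<odot>\<^bsub>M\<^esub> presented_gen R {1..n + 1} {r} i) [1..<n + 1]) =
      foldr (\<lambda>i s. t i \<otimes> s) (Suc n # [1..<n + 1]) \<one>"
proof -
  interpret R: cring R by fact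
  have F: "module R F" unfolding F_def by (rule module_free_module[OF R])
  interpret F: module R F by fact
  note T = module_regular_module[OF R]
  interpret T: module R "regular_module R" by (rule T)
  \<comment> \<open>Coordinate n+1 is listed first. It vanishes on t_1 e_1, ..., t_n e_n, so
    expanding along it pairs it with \<open>r\<close> alone and leaves a diagonal minor; this order
    also avoids the sign of a cyclic permutation.\<close>
  let ?x = "\<lambda>i. t i \<odot>\<^bsub>F\<^esub> free_gen R i" and ?L = "Suc n # [1..<n + 1]"
  have gen: "free_gen R i \<in> carrier F" if "i \<in> {1..n + 1}" for i
    unfolding F_def by (rule free_gen_carrier[OF R that])
  have x: "?x i \<in> carrier F" if "i \<in> {1..n + 1}" for i
    using gen[OF that] t[OF that] by simp
  have r: "r \<in> carrier F" unfolding r_def using x by (intro F.M.finsum_closed) auto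
  have coord: "linear_map R F (regular_module R) (\<lambda>f. f i)" for i
    unfolding F_def by (rule linear_map_coordinate[OF R])
  have x_coord: "?x j i = (if i = j then t j else \<zero>)" if "j \<in> {1..n + 1}" for i j
    using t[OF that] by (simp add: F_def free_module_def free_gen_def)
  have r_coord: "r i = t i" if i: "i \<in> {1..n + 1}" for i
  proof -
    have "r i = (\<Oplus>\<^bsub>regular_module R\<^esub>j\<in>{1..n + 1}. ?x j i)"
      unfolding r_def using x by (intro linear_map_finsum[OF F T coord]) auto
    also have "\<dots> = (\<Oplus>\<^bsub>regular_module R\<^esub>j\<in>{i}. t i)"
      using i t x_coord by (intro T.M.add.finprod_mono_neutral_cong_right) auto
    also have "\<dots> = t i" using t[OF i] T.M.finsum_insert[of "{}" i "\<lambda>_. t i"] by simp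
    finally show ?thesis .
  qed
  define D where "D = coord_det R (map (\<lambda>i f. f i) ?L)"
  have lin: "linear_map R F (regular_module R) l" if "l \<in> set (map (\<lambda>i f. f i) K)" for l K
    using that coord by auto
  have len: "length (map (\<lambda>i (f :: nat \<Rightarrow> 'a). f i) ?L) = Suc n" by simp
  have D: "alternating_map R F (Suc n) (regular_module R) D"
    using alternating_map_coord_det[OF F, of "map (\<lambda>i f. f i) ?L"] lin[of _ ?L]
    unfolding D_def len by blast
  \<comment> \<open>Putting the relation into any slot makes \<open>r\<close> occur twice in the
    determinant, which is the condition for descent to the quotient.\<close>
  have "D (r # fs[j := r]) = \<zero>\<^bsub>regular_module R\<^esub>" if "fs \<in> tuples F n" "j < n" for fs j
  proof (rule alternating_mapD(3)[OF D])
    show "r # fs[j := r] \<in> tuples F (Suc n)"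
      using tuples_update[OF that(1) r] r by (auto simp: tuples_def)
    show "\<not> distinct (r # fs[j := r])"
      using that by (simp add: tuples_def set_update_memI)
  qed
  then obtain A where A: "alternating_map R M n (regular_module R) A"
    and val: "\<And>fs. fs \<in> tuples F n \<Longrightarrow> A (map (presented_class R {1..n + 1} {r}) fs) = D (r # fs)"
    using alternating_map_presented_module[OF T, of "{r}" "{1..n + 1}" n "\<lambda>fs. D (r # fs)"]
      r alternating_map_Cons[OF D r]
    unfolding F_def M_def by blast
  have "A (map (\<lambda>i. t i \<odot>\<^bsub>M\<^esub> presented_gen R {1..n + 1} {r} i) [1..<n + 1]) =
      A (map (presented_class R {1..n + 1} {r}) (map ?x [1..<n + 1]))"
  proof -
    have "presented_class R {1..n + 1} {r} (?x i) = t i \<odot>\<^bsub>M\<^esub> presented_gen R {1..n + 1} {r} i"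
      if "i \<in> {1..n + 1}" for i
      using linear_mapD(3)[OF linear_map_presented_class[OF R] t[OF that] gen[OF that, unfolded F_def], of "{r}"] r
      by (simp add: presented_gen_eq_class M_def F_def)
    then show ?thesis
      unfolding map_map o_def by (intro arg_cong[where f = A] map_cong refl) auto
  qed
  also have "\<dots> = D (r # map ?x [1..<n + 1])"
    using x by (intro val) (auto simp: tuples_def)
  also have "\<dots> = r (Suc n) \<otimes> coord_det R (map (\<lambda>i f. f i) [1..<n + 1]) (map ?x [1..<n + 1])"
    unfolding D_def list.map(2)
  proof (rule coord_det_Cons[OF F])
    show "r # map ?x [1..<n + 1] \<in> tuples F (Suc (length (map (\<lambda>i f. f i) [1..<n + 1])))"
      using r x by (auto simp: tuples_def)
    show "linear_map R F (regular_module R) l"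
      if "l \<in> set ((\<lambda>f. f (Suc n)) # map (\<lambda>i f. f i) [1..<n + 1])" for l
      using lin[of l ?L] that by (simp only: list.map(2))
    show "y (Suc n) = \<zero>" if "y \<in> set (map ?x [1..<n + 1])" for y
      using that x_coord by auto
  qed
  also have "coord_det R (map (\<lambda>i f. f i) [1..<n + 1]) (map ?x [1..<n + 1]) =
      foldr (\<lambda>i s. ?x i i \<otimes> s) [1..<n + 1] \<one>"
    using coord x x_coord by (intro coord_det_diagonal[OF F]) auto
  also have "\<dots> = foldr (\<lambda>i s. t i \<otimes> s) [1..<n + 1] \<one>"
    by (intro foldr_cong) (auto simp: x_coord)
  finally show thesis using that[OF A] r_coord[of "Suc n"] by simp
qed

section \<open>The base ring\<close>

lemma residue_ring_simps:
  "\<one>\<^bsub>residue_ring m\<^esub> = 1" "\<zero>\<^bsub>residue_ring m\<^esub> = 0"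
  "x \<oplus>\<^bsub>residue_ring m\<^esub> y = (x + y) mod m" "x \<otimes>\<^bsub>residue_ring m\<^esub> y = x * y mod m"
  by (simp_all add: residue_ring_def)

lemma add_pow_one_residue_ring:
  "1 < m \<Longrightarrow> [(n::nat)] \<cdot>\<^bsub>residue_ring m\<^esub> \<one>\<^bsub>residue_ring m\<^esub> = int n mod m"
  by (induction n) (simp_all add: add_pow_def nat_pow_def residue_ring_simps mod_simps add.commute)

section \<open>Monomials and squarefree coefficients of polynomials\<close>

context cring
begin

interpretation P: cring "mpoly_ring R I" for I :: "'c set"
  by (rule cring_mpoly_ring) (rule is_cring)

lemma indexed_var_mult:
  assumes "Q \<in> carrier (mpoly_ring R I)"
  shows "indexed_var i \<otimes>\<^bsub>mpoly_ring R I\<^esub> Q = indexed_pmult Q i"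
proof -
  have Q: "carrier_coeff Q" by (rule mpoly_coeff[OF assms])
  have "carrier_coeff (indexed_const \<one> :: 'd multiset \<Rightarrow> 'a)"
    by (auto simp: carrier_coeff_def indexed_const_def)
  then have "indexed_var i \<otimes>\<^bsub>mpoly_ring R I\<^esub> Q =
      indexed_pmult (indexed_const \<one> \<otimes>\<^bsub>mpoly_ring R I\<^esub> Q) i"
    unfolding indexed_var_def using Q by (rule mpoly_mult_pmult)
  also have "indexed_const \<one> \<otimes>\<^bsub>mpoly_ring R I\<^esub> Q = Q"
    using Q by (simp add: mpoly_mult_const carrier_coeff_def)
  finally show ?thesis .
qed

lemma indexed_var_closed: "i \<in> I \<Longrightarrow> indexed_var i \<in> carrier (mpoly_ring R I)"
  by (auto simp: mpoly_ring_def indexed_var_def intro: indexed_pset.intros)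

text \<open>Multiplication by a variable shifts coefficients, and repetitions in \<open>L\<close>
  are allowed. The formula thus covers the squares that generate the ideal as well as the squarefree
  monomial that must survive.\<close>

lemma monomial_prod:
  assumes "set L \<subseteq> I"
  shows "foldr (\<lambda>i Q. indexed_var i \<otimes>\<^bsub>mpoly_ring R I\<^esub> Q) L \<one>\<^bsub>mpoly_ring R I\<^esub> =
    (\<lambda>m. if m = mset L then \<one> else \<zero>)"
  using assms
proof (induction L)
  case Nil
  then show ?case by (simp add: mpoly_ring_def indexed_const_def)
next
  case (Cons i L)
  have closed: "foldr (\<lambda>i Q. indexed_var i \<otimes>\<^bsub>mpoly_ring R I\<^esub> Q) L \<one>\<^bsub>mpoly_ring R I\<^esub> \<in>
      carrier (mpoly_ring R I)" if "set L \<subseteq> I" for L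
    using that by (induction L) (auto intro: indexed_var_closed)
  have "i \<in># m \<and> m - {#i#} = mset L \<longleftrightarrow> m = add_mset i (mset L)" for m
    by (metis add_mset_remove_trivial insert_DiffM union_single_eq_member)
  then show ?case
    using Cons closed[of L] by (auto simp: indexed_var_mult indexed_pmult_def fun_eq_iff)
qed

text \<open>A submultiset of a squarefree multiset is squarefree, so every term of the convolution
  at such a monomial contains a vanishing coefficient of \<open>P\<close>. This ideal bounds
  \<open>square_ideal\<close> from above.\<close>

lemma ideal_vanishing_on_squarefree:
  "ideal {P \<in> carrier (mpoly_ring R I). \<forall>m. (\<forall>i. count m i \<le> 1) \<longrightarrow> P m = \<zero>} (mpoly_ring R I)"
    (is "ideal ?J _")
proof (rule idealI)
  show "ring (mpoly_ring R I)" by (rule P.ring_axioms)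
  have mult: "P \<otimes>\<^bsub>mpoly_ring R I\<^esub> Q \<in> ?J" if P: "P \<in> ?J" and Q: "Q \<in> carrier (mpoly_ring R I)" for P Q
  proof -
    have "(P \<otimes>\<^bsub>mpoly_ring R I\<^esub> Q) m = \<zero>" if m: "\<forall>i. count m i \<le> 1" for m
    proof -
      have Qm: "Q m' \<in> carrier R" for m' using mpoly_coeff[OF Q] by (simp add: carrier_coeff_def)
      have "P a = \<zero>" if "a \<subseteq># m" for a
      proof -
        have "count a i \<le> 1" for i using m mset_subset_eq_count[OF that, of i] by (meson le_trans)
        then show ?thesis using P by blast
      qed
      then have "(\<Oplus>a\<in>{a. a \<subseteq># m}. P a \<otimes> Q (m - a)) = (\<Oplus>a\<in>{a. a \<subseteq># m}. \<zero>)"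
        using Qm by (intro finsum_cong') auto
      then show ?thesis by (simp add: mpoly_ring_def)
    qed
    then show ?thesis using P Q by simp
  qed
  show "Q \<otimes>\<^bsub>mpoly_ring R I\<^esub> P \<in> ?J" if "P \<in> ?J" "Q \<in> carrier (mpoly_ring R I)" for P Q
  proof -
    have "P \<otimes>\<^bsub>mpoly_ring R I\<^esub> Q = Q \<otimes>\<^bsub>mpoly_ring R I\<^esub> P"
      using that by (intro P.m_comm) auto
    then show ?thesis using mult[OF that] by argo
  qed
  show "P \<otimes>\<^bsub>mpoly_ring R I\<^esub> Q \<in> ?J" if "P \<in> ?J" "Q \<in> carrier (mpoly_ring R I)" for P Q
    using mult that by blast
  have zero: "\<zero>\<^bsub>mpoly_ring R I\<^esub> m = \<zero>" and add: "(P \<oplus>\<^bsub>mpoly_ring R I\<^esub> Q) m = P m \<oplus> Q m" for P Q m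
    by (simp_all add: mpoly_ring_def indexed_zero_def indexed_padd_def)
  show "subgroup ?J (add_monoid (mpoly_ring R I))"
  proof (rule group.subgroupI[OF P.a_group])
    show "inv\<^bsub>add_monoid (mpoly_ring R I)\<^esub> P \<in> ?J" if "P \<in> ?J" for P
    proof -
      \<comment> \<open>Negation is multiplication by -1, so closure follows from
        \<open>mult\<close>.\<close>
      have "P \<otimes>\<^bsub>mpoly_ring R I\<^esub> (\<ominus>\<^bsub>mpoly_ring R I\<^esub> \<one>\<^bsub>mpoly_ring R I\<^esub>) \<in> ?J"
        using that by (intro mult) auto
      moreover have "P \<in> carrier (mpoly_ring R I)" using that by blast
      ultimately show ?thesis by (simp only: P.r_minus P.one_closed P.r_one flip: a_inv_def)
    qed
    have "\<zero>\<^bsub>mpoly_ring R I\<^esub> \<in> ?J" using zero by blast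
    then show "?J \<noteq> {}" by blast
    show "P \<otimes>\<^bsub>add_monoid (mpoly_ring R I)\<^esub> Q \<in> ?J" if "P \<in> ?J" "Q \<in> ?J" for P Q
      using that add by simp
  qed auto
qed

end

section \<open>The truncated polynomial ring over the prime field\<close>

context
  fixes p n :: nat
  assumes p: "prime p"
begin

interpretation F: cring "residue_ring (int p)"
proof (rule residues.cring)
  show "residues (int p)" using prime_gt_1_nat[OF p] by (simp add: residues_def)
qed

interpretation P: cring "poly_Fp p n"
  unfolding poly_Fp_def by (rule cring_mpoly_ring) (rule F.is_cring)

lemma poly_var_closed: "i \<in> {1..n + 1} \<Longrightarrow> poly_var p i \<in> carrier (poly_Fp p n)"
  unfolding poly_var_def poly_Fp_def by (rule F.indexed_var_closed)

lemma ideal_square_ideal: "ideal (square_ideal p n) (poly_Fp p n)"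
  unfolding square_ideal_def using poly_var_closed by (intro P.genideal_ideal) auto

interpretation I: ideal "square_ideal p n" "poly_Fp p n"
  by (rule ideal_square_ideal)

interpretation k: cring "base_ring p n"
  by (rule cring_base_ring[OF p])

lemma base_ring_hom: "(+>\<^bsub>poly_Fp p n\<^esub>) (square_ideal p n) \<in> ring_hom (poly_Fp p n) (base_ring p n)"
  unfolding base_ring_def by (rule I.rcos_ring_hom)

lemma base_ring_class_zero_iff:
  assumes "P \<in> carrier (poly_Fp p n)"
  shows "square_ideal p n +>\<^bsub>poly_Fp p n\<^esub> P = \<zero>\<^bsub>base_ring p n\<^esub> \<longleftrightarrow> P \<in> square_ideal p n"
proof -
  have "\<zero>\<^bsub>base_ring p n\<^esub> = square_ideal p n" by (simp add: base_ring_def FactRing_def)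
  then show ?thesis using I.a_rcos_const I.rcos_const_imp_mem assms by auto
qed

lemma t_elem_closed: "i \<in> {1..n + 1} \<Longrightarrow> t_elem p n i \<in> carrier (base_ring p n)"
  unfolding t_elem_def by (rule ring_hom_closed[OF base_ring_hom poly_var_closed])

lemma t_elem_square:
  assumes "i \<in> {1..n + 1}"
  shows "t_elem p n i \<otimes>\<^bsub>base_ring p n\<^esub> t_elem p n i = \<zero>\<^bsub>base_ring p n\<^esub>"
proof -
  have v: "poly_var p i \<in> carrier (poly_Fp p n)" by (rule poly_var_closed[OF assms])
  have "poly_var p i [^]\<^bsub>poly_Fp p n\<^esub> (2::nat) \<in> square_ideal p n"
    unfolding square_ideal_def using assms poly_var_closed
    by (intro subsetD[OF P.genideal_self]) auto
  then have "poly_var p i \<otimes>\<^bsub>poly_Fp p n\<^esub> poly_var p i \<in> square_ideal p n"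
    using v by (simp add: numeral_2_eq_2)
  then show ?thesis
    using v ring_hom_mult[OF base_ring_hom v v]
      base_ring_class_zero_iff[of "poly_var p i \<otimes>\<^bsub>poly_Fp p n\<^esub> poly_var p i"]
    by (simp add: t_elem_def)
qed

lemma square_ideal_squarefree:
  assumes P: "P \<in> square_ideal p n" and m: "\<And>i. count m i \<le> 1"
  shows "P m = 0"
proof -
  let ?J = "{P \<in> carrier (poly_Fp p n). \<forall>m. (\<forall>i. count m i \<le> 1) \<longrightarrow> P m = 0}"
  have J: "ideal ?J (poly_Fp p n)"
    using F.ideal_vanishing_on_squarefree[of "{1..n + 1}"] unfolding poly_Fp_def residue_ring_simps .
  have "square_ideal p n \<subseteq> ?J"
    unfolding square_ideal_def
  proof (rule P.genideal_minimal[OF J], safe)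
    fix i assume i: "i \<in> {1..n + 1}"
    have v: "poly_var p i \<in> carrier (poly_Fp p n)" by (rule poly_var_closed[OF i])
    then show "poly_var p i [^]\<^bsub>poly_Fp p n\<^esub> (2::nat) \<in> carrier (poly_Fp p n)" by simp
    fix m :: "nat multiset" assume m: "\<forall>i. count m i \<le> 1"
    \<comment> \<open>The square is brought into the right-nested form of
      \<open>monomial_prod\<close> for the list \<open>[i, i]\<close>.\<close>
    have eq: "poly_var p i [^]\<^bsub>poly_Fp p n\<^esub> (2::nat) =
        poly_var p i \<otimes>\<^bsub>poly_Fp p n\<^esub> (poly_var p i \<otimes>\<^bsub>poly_Fp p n\<^esub> \<one>\<^bsub>poly_Fp p n\<^esub>)"
      using v by (simp add: numeral_2_eq_2)
    have "(poly_var p i [^]\<^bsub>poly_Fp p n\<^esub> (2::nat)) m = (if m = {#i, i#} then 1 else 0)"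
      unfolding eq using F.monomial_prod[of "[i, i]" "{1..n + 1}"] i
      by (simp add: poly_var_def poly_Fp_def residue_ring_simps fun_eq_iff)
    also have "\<dots> = 0" using m by (auto dest: spec[of _ i])
    finally show "(poly_var p i [^]\<^bsub>poly_Fp p n\<^esub> (2::nat)) m = 0" .
  qed
  then show ?thesis using P m by auto
qed

text \<open>The product lifts to a polynomial whose coefficient at the squarefree monomial
  \<open>mset L\<close> is 1, whereas members of \<open>square_ideal\<close> have coefficient 0
  there.\<close>

lemma t_elem_prod_nonzero:
  assumes L: "distinct L" "set L \<subseteq> {1..n + 1}"
  shows "foldr (\<lambda>i s. t_elem p n i \<otimes>\<^bsub>base_ring p n\<^esub> s) L \<one>\<^bsub>base_ring p n\<^esub> \<noteq> \<zero>\<^bsub>base_ring p n\<^esub>"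
proof -
  define Q where "Q L = foldr (\<lambda>i Q. poly_var p i \<otimes>\<^bsub>poly_Fp p n\<^esub> Q) L \<one>\<^bsub>poly_Fp p n\<^esub>" for L
  have "Q L \<in> carrier (poly_Fp p n) \<and>
      foldr (\<lambda>i s. t_elem p n i \<otimes>\<^bsub>base_ring p n\<^esub> s) L \<one>\<^bsub>base_ring p n\<^esub> =
      square_ideal p n +>\<^bsub>poly_Fp p n\<^esub> Q L"
    using L(2)
  proof (induction L)
    case Nil
    then show ?case by (simp add: Q_def ring_hom_one[OF base_ring_hom])
  next
    case (Cons i L)
    then show ?case
      using poly_var_closed[of i] ring_hom_mult[OF base_ring_hom, of "poly_var p i" "Q L"]
      by (auto simp: Q_def t_elem_def)
  qed
  moreover have "Q L (mset L) = 1"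
    using F.monomial_prod[OF L(2)]
    by (simp add: Q_def poly_var_def poly_Fp_def residue_ring_simps)
  moreover have "count (mset L) i \<le> 1" for i
    using L(1) by (simp add: distinct_count_atmost_1)
  ultimately show ?thesis
    using square_ideal_squarefree[of "Q L" "mset L"] by (auto simp: base_ring_class_zero_iff)
qed

text \<open>Multiples of 1 are computed in the residue ring and carried along constant polynomials
  and the quotient map.\<close>

lemma base_ring_char:
  assumes "p dvd n'"
  shows "[(n'::nat)] \<cdot>\<^bsub>base_ring p n\<^esub> \<one>\<^bsub>base_ring p n\<^esub> = \<zero>\<^bsub>base_ring p n\<^esub>"
proof -
  have zero: "square_ideal p n +>\<^bsub>poly_Fp p n\<^esub> \<zero>\<^bsub>poly_Fp p n\<^esub> = \<zero>\<^bsub>base_ring p n\<^esub>"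
    using base_ring_class_zero_iff[OF P.zero_closed] by simp
  have "[j] \<cdot>\<^bsub>base_ring p n\<^esub> \<one>\<^bsub>base_ring p n\<^esub> =
      square_ideal p n +>\<^bsub>poly_Fp p n\<^esub> ([j] \<cdot>\<^bsub>poly_Fp p n\<^esub> \<one>\<^bsub>poly_Fp p n\<^esub>)" for j :: nat
    by (induction j)
      (simp_all add: zero ring_hom_one[OF base_ring_hom] ring_hom_add[OF base_ring_hom])
  moreover have "[j] \<cdot>\<^bsub>poly_Fp p n\<^esub> \<one>\<^bsub>poly_Fp p n\<^esub> =
      F.indexed_const ([j] \<cdot>\<^bsub>residue_ring (int p)\<^esub> \<one>\<^bsub>residue_ring (int p)\<^esub>)" for j :: nat
    by (induction j) (simp_all add: poly_Fp_def mpoly_ring_def add_pow_def nat_pow_def F.indexed_padd_const)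
  moreover have "[n'] \<cdot>\<^bsub>residue_ring (int p)\<^esub> \<one>\<^bsub>residue_ring (int p)\<^esub> = \<zero>\<^bsub>residue_ring (int p)\<^esub>"
    using assms prime_gt_1_nat[OF p] by (simp add: add_pow_one_residue_ring) (simp add: residue_ring_simps)
  moreover have "F.indexed_const \<zero>\<^bsub>residue_ring (int p)\<^esub> = \<zero>\<^bsub>poly_Fp p n\<^esub>"
    by (simp add: poly_Fp_def mpoly_ring_def)
  ultimately show ?thesis by (simp add: zero)
qed

end

section \<open>The kernel of the differential\<close>

text \<open>The repetition is between the first factor and the list, so alternation says nothing
  about it. Instead the scalar \<open>c\<close> is pulled out once from each place, which gives c^2
  = 0.\<close>

lemma smult_square_zero_repeat:
  fixes R :: "('a, 'm) ring_scheme" (structure)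
  assumes M: "module R M" and T: "module R T"
    and b1: "\<And>bs. bs \<in> tuples M i \<Longrightarrow> linear_map R M T (\<lambda>x. b x bs)"
    and b2: "\<And>x. x \<in> carrier M \<Longrightarrow> alternating_map R M i T (b x)"
    and c: "c \<in> carrier R" "c \<otimes> c = \<zero>" and e: "e \<in> carrier M"
    and bs: "bs \<in> tuples M i" "c \<odot>\<^bsub>M\<^esub> e \<in> set bs"
  shows "b (c \<odot>\<^bsub>M\<^esub> e) bs = \<zero>\<^bsub>T\<^esub>"
proof -
  interpret T: module R T by fact
  from bs obtain j where j: "j < i" "bs ! j = c \<odot>\<^bsub>M\<^esub> e"
    by (auto simp: tuples_def in_set_conv_nth)
  have closed: "b e (bs[j := e]) \<in> carrier T"
    using linear_mapD(1)[OF b1[OF tuples_update[OF bs(1) e]] e] .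
  have "b (c \<odot>\<^bsub>M\<^esub> e) bs = c \<odot>\<^bsub>T\<^esub> b e bs" using linear_mapD(3)[OF b1[OF bs(1)] c(1) e] .
  also have "b e bs = b e (bs[j := c \<odot>\<^bsub>M\<^esub> e])" by (simp flip: j(2))
  also have "\<dots> = c \<odot>\<^bsub>T\<^esub> b e (bs[j := e])"
    using linear_mapD(3)[OF multilinear_mapD(2)[OF alternating_mapD(1)[OF b2[OF e]] bs(1) j(1)] c(1) e] .
  also have "c \<odot>\<^bsub>T\<^esub> (c \<odot>\<^bsub>T\<^esub> b e (bs[j := e])) = \<zero>\<^bsub>T\<^esub>"
    using closed c by (simp flip: T.smult_assoc1)
  finally show ?thesis .
qed

section \<open>The elements t_i e_i and their wedge product\<close>

context
  fixes n p :: nat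
  assumes p: "prime p"
begin

abbreviation (input) "te i \<equiv> t_elem p n i \<odot>\<^bsub>M_module p n\<^esub> e_elem p n i"

interpretation k: cring "base_ring p n" by (rule cring_base_ring[OF p])

lemma M_relation_closed: "{M_relation p n} \<subseteq> carrier (free_module (base_ring p n) {1..n + 1})"
proof -
  interpret F: module "base_ring p n" "free_module (base_ring p n) {1..n + 1}"
    by (rule module_free_module[OF k.is_cring])
  have "M_relation p n \<in> carrier (free_module (base_ring p n) {1..n + 1})"
    unfolding M_relation_def Let_def
    by (intro F.M.finsum_closed funcsetI F.smult_closed t_elem_closed[OF p] free_gen_carrier[OF k.is_cring])
  then show ?thesis by simp
qed

lemma module_M_module: "module (base_ring p n) (M_module p n)"
  unfolding M_module_def by (rule module_presented_module[OF k.is_cring M_relation_closed])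

interpretation M: module "base_ring p n" "M_module p n" by (rule module_M_module)

lemma e_elem_closed: "i \<in> {1..n + 1} \<Longrightarrow> e_elem p n i \<in> carrier (M_module p n)"
  unfolding M_module_def e_elem_def by (rule presented_gen_closed[OF k.is_cring M_relation_closed])

lemma te_closed: "i \<in> {1..n + 1} \<Longrightarrow> te i \<in> carrier (M_module p n)"
  using e_elem_closed t_elem_closed[OF p] by simp

lemma te_tuple: "map te [1..<n + 1] \<in> tuples (M_module p n) n"
  using te_closed by (auto simp: tuples_def)

lemma sum_te: "(\<Oplus>\<^bsub>M_module p n\<^esub>i\<in>{1..n + 1}. te i) = \<zero>\<^bsub>M_module p n\<^esub>"
proof -
  let ?F = "free_module (base_ring p n) {1..n + 1}"
  let ?c = "presented_class (base_ring p n) {1..n + 1} {M_relation p n}"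
  have F: "module (base_ring p n) ?F" by (rule module_free_module[OF k.is_cring])
  interpret F: module "base_ring p n" ?F by (rule F)
  have c: "linear_map (base_ring p n) ?F (M_module p n) ?c"
    unfolding M_module_def by (rule linear_map_presented_class[OF k.is_cring M_relation_closed])
  have gen: "free_gen (base_ring p n) i \<in> carrier ?F" if "i \<in> {1..n + 1}" for i
    by (rule free_gen_carrier[OF k.is_cring that])
  have "?c (M_relation p n) = \<zero>\<^bsub>M_module p n\<^esub>"
    unfolding M_module_def by (rule presented_class_zero[OF k.is_cring M_relation_closed]) simp
  also have "?c (M_relation p n) =
      (\<Oplus>\<^bsub>M_module p n\<^esub>i\<in>{1..n + 1}. ?c (t_elem p n i \<odot>\<^bsub>?F\<^esub> free_gen (base_ring p n) i))"
    unfolding M_relation_def Let_def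
    by (intro linear_map_finsum[OF F M.module_axioms c[unfolded M_relation_def Let_def]] funcsetI
      F.smult_closed t_elem_closed[OF p] gen) simp_all
  also have "\<dots> = (\<Oplus>\<^bsub>M_module p n\<^esub>i\<in>{1..n + 1}. te i)"
    using te_closed linear_mapD(3)[OF c t_elem_closed[OF p] gen]
    by (intro M.M.finsum_cong') (auto simp: e_elem_def presented_gen_eq_class)
  finally show ?thesis by simp
qed

text \<open>Stated for an arbitrary linear \<open>f\<close> so as to serve both differentials:
  \<open>f\<close> is the identity for the exterior one, and multiplication by the unit of the
  symmetric algebra for the leftmost Koszul one.\<close>

lemma koszul_sum_te:
  assumes dvd: "p dvd n" and N: "module (base_ring p n) N"
    and f: "linear_map (base_ring p n) (M_module p n) N f"
  defines "E \<equiv> exterior_power (base_ring p n) (M_module p n) (n - 1)"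
  shows "koszul_sum (base_ring p n) (tensor_product (base_ring p n) N E) n
      (\<lambda>x bs. tensor (base_ring p n) N E (f x) (wedge (base_ring p n) (M_module p n) bs))
      (map te [1..<n + 1]) = \<zero>\<^bsub>tensor_product (base_ring p n) N E\<^esub>"
proof -
  have E: "module (base_ring p n) E" unfolding E_def by (rule module_exterior_power[OF M.module_axioms])
  note T = module_tensor_product[OF N E]
  note b1 = linear_map_tensor_wedge[OF M.module_axioms N f, of _ "n - 1", folded E_def]
  note b2 = alternating_map_tensor_wedge[OF M.module_axioms N f, of _ "n - 1", folded E_def]
  \<comment> \<open>\<open>koszul_sum_eq_zero\<close> counts from 0, so its \<open>x l\<close> is
    the element with index l+1 and its buffer \<open>x n\<close> is t_(n+1) e_(n+1).\<close>
  have "{1..n + 1} = Suc ` {..n}" by (simp add: image_Suc_atMost)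
  then have sum: "(\<Oplus>\<^bsub>M_module p n\<^esub>l\<in>{..n}. te (Suc l)) = \<zero>\<^bsub>M_module p n\<^esub>"
    using sum_te M.M.finsum_reindex[of te Suc "{..n}"] te_closed by (simp add: Pi_iff)
  have "koszul_sum (base_ring p n) (tensor_product (base_ring p n) N E) n
      (\<lambda>x bs. tensor (base_ring p n) N E (f x) (wedge (base_ring p n) (M_module p n) bs))
      (map (\<lambda>l. te (Suc l)) [0..<n]) = \<zero>\<^bsub>tensor_product (base_ring p n) N E\<^esub>"
  proof (rule koszul_sum_eq_zero[OF M.module_axioms T b1 b2 _ sum])
    fix l bs
    assume l: "l \<le> n" and bs: "bs \<in> tuples (M_module p n) (n - 1)" "te (Suc l) \<in> set bs"
    then have "Suc l \<in> {1..n + 1}" by simp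
    then show "tensor (base_ring p n) N E (f (te (Suc l))) (wedge (base_ring p n) (M_module p n) bs) =
        \<zero>\<^bsub>tensor_product (base_ring p n) N E\<^esub>"
      using bs
      by (intro smult_square_zero_repeat[where i = "n - 1", OF M.module_axioms T b1 b2]
        t_elem_closed[OF p] t_elem_square[OF p] e_elem_closed) auto
  qed (use te_closed base_ring_char[OF p dvd] in auto)
  also have "map (\<lambda>l. te (Suc l)) [0..<n] = map te [1..<n + 1]"
    by (simp add: o_def del: upt_Suc flip: map_Suc_upt)
  finally show ?thesis .
qed

text \<open>The form itself is kept, not just the non-vanishing of the wedge, because it is also
  needed to detect the tensor in the top Koszul component.\<close>

lemma exterior_form_te:
  obtains \<phi> where
    "linear_map (base_ring p n) (exterior_power (base_ring p n) (M_module p n) n)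
      (regular_module (base_ring p n)) \<phi>"
    and "\<phi> (wedge (base_ring p n) (M_module p n) (map te [1..<n + 1])) \<noteq> \<zero>\<^bsub>base_ring p n\<^esub>"
proof -
  obtain A where A: "alternating_map (base_ring p n) (M_module p n) n (regular_module (base_ring p n)) A"
    and val: "A (map te [1..<n + 1]) =
      foldr (\<lambda>i s. t_elem p n i \<otimes>\<^bsub>base_ring p n\<^esub> s) (Suc n # [1..<n + 1]) \<one>\<^bsub>base_ring p n\<^esub>"
    unfolding M_module_def e_elem_def M_relation_def Let_def
    by (rule exterior_form_relation[where t = "t_elem p n" and n = n, OF k.is_cring t_elem_closed[OF p]])
  note T = module_regular_module[OF k.is_cring]
  have "A (map te [1..<n + 1]) \<noteq> \<zero>\<^bsub>base_ring p n\<^esub>"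
    unfolding val by (rule t_elem_prod_nonzero[OF p]) auto
  then show thesis
    using that[OF linear_map_exterior_extension[OF M.module_axioms T A]]
      exterior_extension_wedge[OF M.module_axioms T A te_tuple] by simp
qed

lemma wedge_te_nonzero:
  "wedge (base_ring p n) (M_module p n) (map te [1..<n + 1]) \<noteq>
    \<zero>\<^bsub>exterior_power (base_ring p n) (M_module p n) n\<^esub>"
proof -
  obtain \<phi> where \<phi>: "linear_map (base_ring p n) (exterior_power (base_ring p n) (M_module p n) n)
      (regular_module (base_ring p n)) \<phi>"
    and nz: "\<phi> (wedge (base_ring p n) (M_module p n) (map te [1..<n + 1])) \<noteq> \<zero>\<^bsub>base_ring p n\<^esub>"
    by (rule exterior_form_te)
  show ?thesis
    using linear_map_zero[OF module_exterior_power[OF M.module_axioms]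
      module_regular_module[OF k.is_cring] \<phi>] nz by auto
qed

text \<open>With \<epsilon> the form on the symmetric power of degree 0 that sends the empty product
  to 1, the product of \<epsilon> and \<phi> detects the tensor. No identification of the top Koszul
  component with the exterior power is required.\<close>

lemma tensor_wedge_te_nonzero:
  defines "S \<equiv> symmetric_power (base_ring p n) (M_module p n) 0"
    and "E \<equiv> exterior_power (base_ring p n) (M_module p n) n"
  shows "tensor (base_ring p n) S E (sym_prod (base_ring p n) (M_module p n) [])
      (wedge (base_ring p n) (M_module p n) (map te [1..<n + 1])) \<noteq>
    \<zero>\<^bsub>tensor_product (base_ring p n) S E\<^esub>"
proof -
  let ?R = "base_ring p n" and ?M = "M_module p n"
  let ?\<alpha> = "sym_prod ?R ?M []" and ?w = "wedge ?R ?M (map te [1..<n + 1])"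
  have S: "module ?R S" unfolding S_def by (rule module_symmetric_power[OF M.module_axioms])
  have E: "module ?R E" unfolding E_def by (rule module_exterior_power[OF M.module_axioms])
  note K = module_regular_module[OF k.is_cring]
  obtain \<phi> where \<phi>: "linear_map ?R E (regular_module ?R) \<phi>" and nz: "\<phi> ?w \<noteq> \<zero>\<^bsub>?R\<^esub>"
    unfolding E_def by (rule exterior_form_te)
  \<comment> \<open>In degree 0 there are no slots, so a constant function is multilinear.\<close>
  define \<epsilon> where "\<epsilon> = linear_extension ?R (regular_module ?R) (\<lambda>_ :: (nat \<Rightarrow> (nat multiset \<Rightarrow> int) set) set list. \<one>\<^bsub>?R\<^esub>)"
  have one: "multilinear_map ?R ?M 0 (regular_module ?R) (\<lambda>_. \<one>\<^bsub>?R\<^esub>)"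
    by (simp add: multilinear_map_def)
  have \<epsilon>: "linear_map ?R S (regular_module ?R) \<epsilon>" "\<epsilon> ?\<alpha> = \<one>\<^bsub>?R\<^esub>"
    unfolding \<epsilon>_def S_def
    using linear_map_symmetric_extension[OF M.module_axioms K one]
      symmetric_extension_sym_prod[OF M.module_axioms K one, of "[]"]
    by (simp_all add: tuples_def)
  have \<alpha>: "?\<alpha> \<in> carrier S"
    using multilinear_mapD(1)[OF multilinear_map_sym_prod[OF M.module_axioms, of 0], of "[]"]
    by (simp add: tuples_def S_def)
  have w: "?w \<in> carrier E"
    using alternating_mapD(2)[OF alternating_map_wedge[OF M.module_axioms] te_tuple] by (simp add: E_def)
  have bil: "bilinear_map ?R S E (regular_module ?R) (\<lambda>(\<alpha>, \<omega>). \<epsilon> \<alpha> \<otimes>\<^bsub>?R\<^esub> \<phi> \<omega>)"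
    unfolding bilinear_map_def prod.case
  proof (intro conjI ballI)
    show "linear_map ?R S (regular_module ?R) (\<lambda>\<alpha>. \<epsilon> \<alpha> \<otimes>\<^bsub>?R\<^esub> \<phi> \<omega>)" if "\<omega> \<in> carrier E" for \<omega>
      using linear_map_mult_right[OF S \<epsilon>(1), of "\<phi> \<omega>"] linear_mapD(1)[OF \<phi> that] by simp
    show "linear_map ?R E (regular_module ?R) (\<lambda>\<omega>. \<epsilon> \<alpha> \<otimes>\<^bsub>?R\<^esub> \<phi> \<omega>)" if "\<alpha> \<in> carrier S" for \<alpha>
      using linear_map_scale[OF E K \<phi>, of "\<epsilon> \<alpha>"] linear_mapD(1)[OF \<epsilon>(1) that] by simp
  qed
  let ?h = "linear_extension ?R (regular_module ?R) (\<lambda>(\<alpha>, \<omega>). \<epsilon> \<alpha> \<otimes>\<^bsub>?R\<^esub> \<phi> \<omega>)"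
  have "?h (tensor ?R S E ?\<alpha> ?w) = \<phi> ?w"
    using tensor_extension_tensor[OF S E K bil \<alpha> w] \<epsilon>(2) linear_mapD(1)[OF \<phi> w] by simp
  moreover have "?h \<zero>\<^bsub>tensor_product ?R S E\<^esub> = \<zero>\<^bsub>?R\<^esub>"
    using linear_map_zero[OF module_tensor_product[OF S E] K linear_map_tensor_extension[OF S E K bil]]
    by simp
  ultimately show ?thesis using nz by auto
qed

end

theorem proposition5p8:
  fixes n p :: nat
  assumes "prime p" and "p dvd n"
  defines "k \<equiv> base_ring p n"
    and "M \<equiv> M_module p n"
    and "t \<equiv> t_elem p n"
    and "e \<equiv> e_elem p n"
  defines "d \<equiv> exterior_diff k M n"
    and "w \<equiv> wedge k M (map (\<lambda>i. t i \<odot>\<^bsub>M\<^esub> e i) [1..<n + 1])"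
  shows "\<not> inj_on d (carrier (exterior_power k M n)) \<and>
    \<not> acyclic_complex n (Kos k M n) (Kos_diff k M n) \<and>
    w \<in> a_kernel (exterior_power k M n) (tensor_product k M (exterior_power k M (n - 1))) d \<and>
    w \<noteq> \<zero>\<^bsub>exterior_power k M n\<^esub>"
proof -
  note p = \<open>prime p\<close>
  interpret k: cring k unfolding k_def by (rule cring_base_ring[OF p])
  interpret M: module k M unfolding k_def M_def by (rule module_M_module[OF p])
  note M = M.module_axioms
  let ?E = "exterior_power k M n" and ?E' = "exterior_power k M (n - 1)"
  let ?xs = "map (\<lambda>i. t i \<odot>\<^bsub>M\<^esub> e i) [1..<n + 1]"
  interpret E: module k ?E by (rule module_exterior_power[OF M])
  have xs: "?xs \<in> tuples M n"
    unfolding M_def t_def e_def by (rule te_tuple[OF p])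
  \<comment> \<open>For n = 0 the truncated \<open>n - 1\<close> is 0 and the sum is empty, so the
    identity still holds.\<close>
  have sum: "koszul_sum k (tensor_product k M ?E') n (\<lambda>x bs. tensor k M ?E' x (wedge k M bs)) ?xs =
      \<zero>\<^bsub>tensor_product k M ?E'\<^esub>"
    using koszul_sum_te[OF p \<open>p dvd n\<close>, of M "\<lambda>x. x"] M linear_map_id
    unfolding k_def M_def t_def e_def by blast
  have w: "w \<in> carrier ?E"
    unfolding w_def by (rule alternating_mapD(2)[OF alternating_map_wedge[OF M] xs])
  have w_nz: "w \<noteq> \<zero>\<^bsub>?E\<^esub>"
    unfolding w_def k_def M_def t_def e_def by (rule wedge_te_nonzero[OF p])
  have dw: "d w = \<zero>\<^bsub>tensor_product k M ?E'\<^esub>"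
    using exterior_diff_wedge[OF M xs] sum by (simp add: d_def w_def)
  have d0: "d \<zero>\<^bsub>?E\<^esub> = \<zero>\<^bsub>tensor_product k M ?E'\<^esub>"
    unfolding d_def
    by (rule linear_map_zero[OF E.module_axioms
      module_tensor_product[OF M module_exterior_power[OF M]] linear_map_exterior_diff[OF M]])
  have "\<not> inj_on d (carrier ?E)"
    using dw d0 w w_nz E.M.zero_closed by (metis inj_onD)
  moreover have "\<not> acyclic_complex n (Kos k M n) (Kos_diff k M n)"
  proof
    assume acyclic: "acyclic_complex n (Kos k M n) (Kos_diff k M n)"
    let ?S = "symmetric_power k M 0" and ?\<alpha> = "sym_prod k M []"
    define u where "u = tensor k ?S ?E ?\<alpha> w"
    have \<alpha>: "?\<alpha> \<in> carrier ?S"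
      using multilinear_mapD(1)[OF multilinear_map_sym_prod[OF M, of 0], of "[]"]
      by (simp add: tuples_def)
    note S = module_symmetric_power[OF M, of 0]
    have u: "u \<in> carrier (Kos k M n n)"
      using funcset_mem[OF bilinear_map_closed[OF S bilinear_map_tensor[OF S E.module_axioms]], of "(?\<alpha>, w)"]
        \<alpha> w by (simp add: u_def Kos_def)
    have u_nz: "u \<noteq> \<zero>\<^bsub>Kos k M n n\<^esub>"
      using tensor_wedge_te_nonzero[OF p, of n]
      by (simp add: u_def Kos_def w_def k_def M_def t_def e_def)
    show False
    \<comment> \<open>For n = 0 the complex has a single component, and acyclicity would make that
      component zero. For n > 0 acyclicity at the left end says that the leftmost differential has
      trivial kernel.\<close>
    proof (cases "n = 0")
      case True
      then have "carrier (Kos k M n n) = {\<zero>\<^bsub>Kos k M n n\<^esub>}"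
        using acyclic by (auto simp: acyclic_complex_def)
      then show False using u u_nz by blast
    next
      case False
      then have ker: "a_kernel (Kos k M n n) (Kos k M n (n - 1)) (Kos_diff k M n n) = {\<zero>\<^bsub>Kos k M n n\<^esub>}"
        using acyclic by (auto simp: acyclic_complex_def)
      have one: "n - (n - 1) = Suc 0" using False by simp
      have lin: "linear_map k M (symmetric_power k M (Suc 0)) (\<lambda>x. sym_mult k M 0 ?\<alpha> x)"
        using bilinear_map_sym_mult[OF M, of 0] \<alpha> by (simp add: bilinear_map_def)
      have "Kos_diff k M n n u = koszul_sum k (Kos k M n (n - 1)) n
          (\<lambda>x bs. tensor k (symmetric_power k M (Suc 0)) ?E' (sym_mult k M 0 ?\<alpha> x) (wedge k M bs)) ?xs"
        using Kos_diff_tensor_wedge[OF M, of n n ?\<alpha> ?xs] False \<alpha> xs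
        by (simp add: u_def w_def one)
      also have "\<dots> = \<zero>\<^bsub>Kos k M n (n - 1)\<^esub>"
        using koszul_sum_te[OF p \<open>p dvd n\<close>, of "symmetric_power k M (Suc 0)" "sym_mult k M 0 ?\<alpha>"]
          module_symmetric_power[OF M, of "Suc 0"] lin
        unfolding Kos_def one k_def M_def t_def e_def by blast
      finally have "u \<in> a_kernel (Kos k M n n) (Kos k M n (n - 1)) (Kos_diff k M n n)"
        using u by (simp add: a_kernel_def')
      then show False using ker u_nz by blast
    qed
  qed
  ultimately show ?thesis
    using w w_nz dw by (simp add: a_kernel_def')
qed

end
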